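(* Let $n\ge 1$ and $\lambda\ge 2$ be integers, let $\Lambda:=\{0,1,\dots,\lambda-1\}^n$, and let $N\le\lambda^n$ be a positive integer. Let $S$ be a rational trigonometric polynomial that is nonnegative on $\mathbb{T}^n$. Assume that $S$ is continuous at $0$ with $S(0)=1$, and $S,1/S\in L^\infty(\mathbb{T}^n)$. For each $1\le l\le N$, suppose that rational trigonometric polynomials $p_l$ and $g_l$ satisfy $$\frac{1}{S(\xi)}-|p_l(\xi)|^2=\lambda^n|g_l(\xi)|^2$$ for all $\xi\in\mathbb{T}^n$ at which both sides are defined, and $p_l(0)=1$. Let $s$ be a rational trigonometric polynomial satisfying $|s|^2=1/S$ with $s(0)=1$. In case $N<\lambda^n$, let $p_l$ be a rational trigonometric polynomial satisfying $|p_l|^2=1/S$ for $l=N+1,\dots,\lambda^n$. Define the rational trigonometric polynomial $$\tau(\xi)=\frac{\lambda^{-n}\sum_{l=1}^{\lambda^n}p_l(\lambda\xi)e^{i\nu_l\cdot\xi}}{\overline{s(\xi)}},$$ where $\nu_1,\dots,\nu_{\lambda^n}$ are the distinct elements of $\Lambda$ (in some order), and assume $\tau(0)=1$. Define the $N+\lambda^n$ functions $$q_{1,l}(\xi)=S(\lambda\xi)\tau(\xi)\overline{g_l(\lambda\xi)},\qquad 1\le l\le N,$$ $$q_{2,m}(\xi)=\lambda^{-n/2}\left(S(\xi)s(\xi)e^{i\nu_m\cdot\xi}-S(\lambda\xi)\tau(\xi)\overline{p_m(\lambda\xi)}\right),\qquad 1\le m\le\lambda^n.$$ Then the wavelet system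 $X(\tau,(q_{1,l}:l=1,\dots,N),(q_{2,m}:m=1,\dots,\lambda^n))$ is a tight wavelet frame for $L^2(\mathbb{R}^n)$.
   Context: A trigonometric polynomial on $\mathbb{T}^n=\mathbb{R}^n/(2\pi\mathbb{Z})^n$ is a finite sum $\sum_{k\in\mathbb{Z}^n}h(k)e^{-ik\cdot\xi}$ with complex coefficients. A rational trigonometric polynomial is a quotient $\tau_1/\tau_2$ of trigonometric polynomials with $\tau_2\not\equiv0$ and with the greatest common divisor of $\tau_1$ and $\tau_2$ constant; prescribing its value at a point includes that it is defined there. Identities between rational trigonometric polynomials are understood at all points where both sides are defined. The Fourier transform is normalized by $\widehat f(\xi)=\int_{\mathbb{R}^n}f(x)e^{-ix\cdot\xi}\,dx$ for $f\in L^1(\mathbb{R}^n)\cap L^2(\mathbb{R}^n)$. For a finite set $\Psi\subset L^2(\mathbb{R}^n)$ (of mother wavelets), the wavelet system generated by $\Psi$ is $X(\Psi)=\{\psi_{j,k}:=\lambda^{jn/2}\psi(\lambda^j\cdot-k):\psi\in\Psi,\ j\in\mathbb{Z},\ k\in\mathbb{Z}^n\}$. It is a tight wavelet frame (TWF) for $L^2(\mathbb{R}^n)$ if $\sum_{\psi\in\Psi}\sum_{j\in\mathbb{Z},k\in\mathbb{Z}^n}|\langle f,\psi_{j,k}\rangle|^2=\|f\|_{L^2(\mathbb{R}^n)}^2$ for all $f\in L^2(\mathbb{R}^n)$. For a mask $\tau$ with $\tau(0)=1$, $\phi_\tau$ is defined by $\widehat{\phi_\tau}(\xi)=\prod_{j=1}^\infty\tau(\lambda^{-j}\xi)$;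 it serves as the refinable function, satisfying $\widehat{\phi_\tau}(\lambda\xi)=\tau(\xi)\widehat{\phi_\tau}(\xi)$. For functions $q_1,\dots,q_L$, the wavelet system $X(\tau,q_1,\dots,q_L)$ is $X(\psi^{(1)},\dots,\psi^{(L)})$, where $\widehat{\psi^{(l)}}(\lambda\xi)=q_l(\xi)\widehat{\phi_\tau}(\xi)$, $1\le l\le L$ (the generators are indexed by $l$ and counted with multiplicity). *)

theory Defs
  imports "HOL-Analysis.Analysis"
begin

section \<open>Rational trigonometric polynomials\<close>

definition int_vec :: "int ^ 'n \<Rightarrow> real ^ 'n" where
  "int_vec k = (\<chi> i. real_of_int (k $ i))"

definition trig_poly :: "(real ^ 'n \<Rightarrow> complex) \<Rightarrow> bool" where
  "trig_poly t \<longleftrightarrow>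
     (\<exists>(K :: (int ^ 'n) set) h. finite K \<and>
        t = (\<lambda>\<xi>. \<Sum>k\<in>K. h k * cis (- (int_vec k \<bullet> \<xi>))))"

definition trig_dvd :: "(real ^ 'n \<Rightarrow> complex) \<Rightarrow> (real ^ 'n \<Rightarrow> complex) \<Rightarrow> bool" where
  "trig_dvd d t \<longleftrightarrow> (\<exists>c. trig_poly c \<and> t = (\<lambda>\<xi>. d \<xi> * c \<xi>))"

text \<open>The monomials are units of the ring of trigonometric polynomials, so greatest common
  divisors are determined only up to monomial factors. That the greatest common divisor is
  constant therefore means that every common divisor is a unit.\<close>

definition trig_coprime :: "(real ^ 'n \<Rightarrow> complex) \<Rightarrow> (real ^ 'n \<Rightarrow> complex) \<Rightarrow> bool" where
  "trig_coprime a b \<longleftrightarrow>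
     (\<forall>d. trig_poly d \<longrightarrow> trig_dvd d a \<longrightarrow> trig_dvd d b \<longrightarrow> trig_dvd d (\<lambda>_. 1))"

text \<open>A rational trigonometric polynomial is represented by a total function, which takes the
  value 0 (division by zero) at the zeros of the denominator of its reduced fraction. The reduced
  fraction is unique up to units, so the set of points at which the rational trigonometric
  polynomial is defined can be recovered from the function. In particular, if such a function has
  a nonzero value at a point, then it is defined there.\<close>

definition reduced_fraction ::
  "(real ^ 'n \<Rightarrow> complex) \<Rightarrow> (real ^ 'n \<Rightarrow> complex) \<Rightarrow> (real ^ 'n \<Rightarrow> complex) \<Rightarrow> bool" where
  "reduced_fraction f a b \<longleftrightarrow>
     trig_poly a \<and> trig_poly b \<and> b \<noteq> (\<lambda>_. 0) \<and> trig_coprime a b \<and> f = (\<lambda>\<xi>. a \<xi> / b \<xi>)"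

definition rational_trig_poly :: "(real ^ 'n \<Rightarrow> complex) \<Rightarrow> bool" where
  "rational_trig_poly f \<longleftrightarrow> (\<exists>a b. reduced_fraction f a b)"

definition defined_at :: "(real ^ 'n \<Rightarrow> complex) \<Rightarrow> real ^ 'n \<Rightarrow> bool" where
  "defined_at f \<xi> \<longleftrightarrow> (\<exists>a b. reduced_fraction f a b \<and> b \<xi> \<noteq> 0)"

text \<open>Functions on the torus are functions on the whole space that are periodic with respect to
  $2\pi\mathbb{Z}^n$; the cube is a fundamental domain.\<close>

definition Linf_torus :: "(real ^ 'n \<Rightarrow> complex) \<Rightarrow> bool" where
  "Linf_torus f \<longleftrightarrow>
     (\<forall>k \<xi>. f (\<xi> + (2 * pi) *\<^sub>R int_vec k) = f \<xi>) \<and>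
     (let Q = lebesgue_on {\<xi>. \<forall>i. 0 \<le> \<xi> $ i \<and> \<xi> $ i < 2 * pi}
      in f \<in> borel_measurable Q \<and> (\<exists>C::real. AE \<xi> in Q. norm (f \<xi>) \<le> C))"


section \<open>Square-integrable functions and the Fourier transform\<close>

text \<open>Every class in $L^2(\mathbb{R}^n)$ has a Borel measurable representative.\<close>

definition square_integrable :: "(real ^ 'n \<Rightarrow> complex) \<Rightarrow> bool" where
  "square_integrable f \<longleftrightarrow>
     f \<in> borel_measurable lborel \<and> integrable lborel (\<lambda>x. (norm (f x))\<^sup>2)"

definition L2_inner :: "(real ^ 'n \<Rightarrow> complex) \<Rightarrow> (real ^ 'n \<Rightarrow> complex) \<Rightarrow> complex" where
  "L2_inner f g = (LINT x|lborel. f x * cnj (g x))"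

definition L2_norm :: "(real ^ 'n \<Rightarrow> complex) \<Rightarrow> real" where
  "L2_norm f = sqrt (LINT x|lborel. (norm (f x))\<^sup>2)"

definition L2_tendsto :: "(nat \<Rightarrow> real ^ 'n \<Rightarrow> complex) \<Rightarrow> (real ^ 'n \<Rightarrow> complex) \<Rightarrow> bool" where
  "L2_tendsto h f \<longleftrightarrow>
     (\<lambda>m. \<integral>\<^sup>+x. ennreal ((norm (h m x - f x))\<^sup>2) \<partial>lborel) \<longlonglongrightarrow> 0"

definition fourier_integral :: "(real ^ 'n \<Rightarrow> complex) \<Rightarrow> real ^ 'n \<Rightarrow> complex" where
  "fourier_integral f \<xi> = (LINT x|lborel. f x * cis (- (x \<bullet> \<xi>)))"

text \<open>\<open>has_fourier_L2 f F\<close>: a representative of the Fourier transform of \<open>f\<close> is \<open>F\<close>, where the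
  Fourier transform is the continuous extension of \<^const>\<open>fourier_integral\<close> from
  $L^1(\mathbb{R}^n)\cap L^2(\mathbb{R}^n)$ to $L^2(\mathbb{R}^n)$.\<close>

definition has_fourier_L2 :: "(real ^ 'n \<Rightarrow> complex) \<Rightarrow> (real ^ 'n \<Rightarrow> complex) \<Rightarrow> bool" where
  "has_fourier_L2 f F \<longleftrightarrow>
     square_integrable f \<and> square_integrable F \<and>
     (\<exists>h. (\<forall>m. integrable lborel (h m) \<and> square_integrable (h m)) \<and>
          L2_tendsto h f \<and> L2_tendsto (\<lambda>m. fourier_integral (h m)) F)"


section \<open>Wavelet systems\<close>

definition wavelet ::
  "nat \<Rightarrow> (real ^ 'n \<Rightarrow> complex) \<Rightarrow> int \<Rightarrow> int ^ 'n \<Rightarrow> real ^ 'n \<Rightarrow> complex" where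
  "wavelet lam \<psi> j k x =
     of_real (real lam powr (real_of_int j * real CARD('n) / 2)) *
     \<psi> ((real lam powi j) *\<^sub>R x - int_vec k)"

definition tight_wavelet_frame ::
  "nat \<Rightarrow> 'i set \<Rightarrow> ('i \<Rightarrow> real ^ 'n \<Rightarrow> complex) \<Rightarrow> bool" where
  "tight_wavelet_frame lam I \<psi> \<longleftrightarrow>
     finite I \<and> (\<forall>i\<in>I. square_integrable (\<psi> i)) \<and>
     (\<forall>f. square_integrable f \<longrightarrow>
        ((\<lambda>(i, j, k). (norm (L2_inner f (wavelet lam (\<psi> i) j k)))\<^sup>2) has_sum (L2_norm f)\<^sup>2)
          (I \<times> (UNIV :: int set) \<times> (UNIV :: (int ^ 'n) set)))"

definition refinable_hat :: "nat \<Rightarrow> (real ^ 'n \<Rightarrow> complex) \<Rightarrow> real ^ 'n \<Rightarrow> complex" where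
  "refinable_hat lam \<tau> \<xi> = (\<Prod>j. \<tau> ((1 / real lam ^ Suc j) *\<^sub>R \<xi>))"

text \<open>The equation below is $\widehat{\psi^{(i)}}(\lambda\xi)=q_i(\xi)\widehat{\phi_\tau}(\xi)$
  with $\xi$ replaced by $\xi/\lambda$.\<close>

definition mother_wavelets ::
  "nat \<Rightarrow> (real ^ 'n \<Rightarrow> complex) \<Rightarrow> 'i set \<Rightarrow> ('i \<Rightarrow> real ^ 'n \<Rightarrow> complex) \<Rightarrow>
   ('i \<Rightarrow> real ^ 'n \<Rightarrow> complex) \<Rightarrow> bool" where
  "mother_wavelets lam \<tau> I q \<psi> \<longleftrightarrow>
     (\<forall>i\<in>I. has_fourier_L2 (\<psi> i)
        (\<lambda>\<xi>. q i ((1 / real lam) *\<^sub>R \<xi>) * refinable_hat lam \<tau> ((1 / real lam) *\<^sub>R \<xi>)))"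

text \<open>The mother wavelets are determined by their Fourier transforms up to null sets; that they
  exist in $L^2(\mathbb{R}^n)$ is part of the claim.\<close>

definition mask_system_tight_wavelet_frame ::
  "nat \<Rightarrow> (real ^ 'n \<Rightarrow> complex) \<Rightarrow> 'i set \<Rightarrow> ('i \<Rightarrow> real ^ 'n \<Rightarrow> complex) \<Rightarrow> bool" where
  "mask_system_tight_wavelet_frame lam \<tau> I q \<longleftrightarrow>
     (\<exists>\<psi>. mother_wavelets lam \<tau> I q \<psi>) \<and>
     (\<forall>\<psi>. mother_wavelets lam \<tau> I q \<psi> \<longrightarrow> tight_wavelet_frame lam I \<psi>)"

end

theory Submission
  imports Defs "HOL-Complex_Analysis.Conformal_Mappings"
begin

text \<open>Writing $[G,\phi]=\sum_k G(\cdot+2\pi k)\overline{\phi(\cdot+2\pi k)}$, Parseval's identity turns the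
  sum of the squared wavelet coefficients of one scale into $\int_{\mathbb{T}^n}\sum_i|[G,\widehat{\psi^{(i)}}]|^2$,
  where \<open>G\<close> is a dilate of the Fourier transform of \<open>f\<close>. The masks satisfy the oblique extension
  identity $S(\lambda\xi)\tau(\xi)\overline{\tau(\xi+\omega)}+\sum_i q_i(\xi)\overline{q_i(\xi+\omega)}=S(\xi)\delta_{\omega,0}$,
  so these integrals are differences of consecutive values of $\int_{\mathbb{T}^n}S\,|[G,\widehat{\phi_\tau}]|^2$,
  suitably scaled. The sum over all scales telescopes; the two limits follow from
  $S\,[\widehat{\phi_\tau},\widehat{\phi_\tau}]\le 1$ almost everywhere, which is itself obtained by iterating the
  identity, and from $S(0)=\widehat{\phi_\tau}(0)=1$.\<close>

section \<open>Zero sets of trigonometric polynomials\<close>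

text \<open>Nothing is known about decay or smoothness of \<open>refinable_hat\<close>. Near 0 it is
  controlled only along the sequences \<xi> / lam^J, where it tends to 1; elsewhere only through the
  bracket bound, so every estimate carries the weight S. The identities between masks hold where the
  reduced fractions are defined, hence almost everywhere, and this survives lattice translations and
  dilations. The extension identity is an energy balance on the cosets of one point. The
  \<open>q2\<close> are residuals: the vector is analysed by an orthogonal matrix of exponentials
  and a prediction from its low-pass component is subtracted. Since \<tau> is built from the p_l,
  low-pass part and residuals together fall short of the full energy by a multiple of the sum of the
  1/S - |p_l|^2. By the hypotheses this deficit is exactly the energy of the \<open>q1\<close>, and
  the indices l > N contribute none. Energies are extended nonnegative reals, so that sums,
  integrals and limits can be exchanged by Tonelli, Fatou and dominated convergence.\<close>

lemma trig_poly_continuous: "trig_poly t \<Longrightarrow> continuous_on UNIV t"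
  unfolding trig_poly_def by (auto intro!: continuous_intros continuous_on_compose2[OF continuous_on_cis])

lemma trig_poly_measurable [measurable_dest]: "trig_poly t \<Longrightarrow> t \<in> borel_measurable borel"
  using trig_poly_continuous borel_measurable_continuous_onI by blast

lemma nn_integral_lborel_affine:
  fixes a :: "'a::euclidean_space"
  assumes [measurable]: "f \<in> borel_measurable borel" and "c \<noteq> 0"
  shows "(\<integral>\<^sup>+x. f x \<partial>lborel) = ennreal (\<bar>c\<bar> ^ DIM('a)) * (\<integral>\<^sup>+x. f (a + c *\<^sub>R x) \<partial>lborel)"
  by (subst lborel_affine[OF \<open>c \<noteq> 0\<close>, of a])
     (simp add: nn_integral_density nn_integral_distr nn_integral_cmult)

lemma nn_integral_lborel_translate:
  fixes a :: "'a::euclidean_space"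
  assumes [measurable]: "f \<in> borel_measurable borel"
  shows "(\<integral>\<^sup>+x. f (a + x) \<partial>lborel) = (\<integral>\<^sup>+x. f x \<partial>lborel)"
  using nn_integral_lborel_affine[OF assms, of 1 a] by simp

lemma AE_lborel_affine:
  fixes a :: "'a::euclidean_space"
  assumes "AE x in lborel. P x" and "c \<noteq> 0"
  shows "AE x in lborel. P (a + c *\<^sub>R x)"
proof -
  obtain N where N: "{x. \<not> P x} \<subseteq> N" "emeasure lborel N = 0" "N \<in> sets lborel"
    using assms(1) by (auto elim!: AE_E)
  then have [measurable]: "N \<in> sets borel" by simp
  have "ennreal (\<bar>c\<bar> ^ DIM('a)) * (\<integral>\<^sup>+x. indicator N (a + c *\<^sub>R x) \<partial>lborel) = 0"
    using nn_integral_lborel_affine[of "indicator N" c a] N \<open>c \<noteq> 0\<close> by simp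
  then have "(\<integral>\<^sup>+x. indicator N (a + c *\<^sub>R x) \<partial>lborel) = 0"
    using \<open>c \<noteq> 0\<close> by auto
  then have "AE x in lborel. indicator N (a + c *\<^sub>R x) = (0::ennreal)"
    by (subst (asm) nn_integral_0_iff_AE) auto
  then show ?thesis
    by eventually_elim (use N(1) in \<open>auto simp: indicator_def split: if_splits\<close>)
qed

text \<open>On every line through a point where it does not vanish, a trigonometric polynomial is
  the restriction of a nonzero entire function, so it has only countably many zeros there;
  integrating in polar fashion gives the claim.\<close>

lemma trig_poly_AE_nonzero:
  fixes t :: "real ^ 'n \<Rightarrow> complex"
  assumes t: "trig_poly t" and "t \<noteq> (\<lambda>_. 0)"
  shows "AE \<xi> in lborel. t \<xi> \<noteq> 0"
proof -
  obtain K :: "(int ^ 'n) set" and h where K: "finite K"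
    and t_eq: "t = (\<lambda>\<xi>. \<Sum>k\<in>K. h k * cis (- (int_vec k \<bullet> \<xi>)))"
    using t unfolding trig_poly_def by blast
  obtain a where a: "t a \<noteq> 0" using assms(2) by auto
  have [measurable]: "t \<in> borel_measurable borel" using t by (rule trig_poly_measurable)
  define Z where "Z = {\<xi>. t \<xi> = 0}"
  have [measurable]: "Z \<in> sets borel" unfolding Z_def by measurable
  have line: "AE r in lborel. a + r *\<^sub>R x \<notin> Z" for x :: "real ^ 'n"
  proof -
    define f where "f z = (\<Sum>k\<in>K. h k * (cis (- (int_vec k \<bullet> a)) * exp (- (\<i> * z * of_real (int_vec k \<bullet> x)))))" for z
    have f_real: "f (of_real r) = t (a + r *\<^sub>R x)" for r
      unfolding f_def t_eq
      by (rule sum.cong) (auto simp: inner_add_right cis_conv_exp exp_add[symmetric] algebra_simps)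
    have "f holomorphic_on UNIV" unfolding f_def by (intro holomorphic_intros)
    have "countable {z. f z = 0}"
    proof (cases "f constant_on UNIV")
      case True
      moreover have "f 0 \<noteq> 0" using f_real[of 0] a by simp
      ultimately have "f z \<noteq> 0" for z unfolding constant_on_def by (metis UNIV_I)
      then show ?thesis by simp
    next
      case False
      then show ?thesis
        using holomorphic_countable_zeros[of f UNIV] connected_UNIV False \<open>f holomorphic_on UNIV\<close> by simp
    qed
    then have "countable ((of_real :: real \<Rightarrow> complex) ` (of_real -` {z. f z = 0}))"
      by (rule countable_subset[rotated]) blast
    then have "countable (of_real -` {z. f z = 0} :: real set)"
      by (rule countable_image_inj_on) (simp add: inj_on_def)
    moreover have "{r. a + r *\<^sub>R x \<in> Z} = of_real -` {z. f z = 0}"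
      by (auto simp: Z_def f_real)
    ultimately have "{r. a + r *\<^sub>R x \<in> Z} \<in> null_sets lborel"
      by (simp add: countable_imp_null_set_lborel)
    then show ?thesis by (rule AE_I'[where P="\<lambda>r. a + r *\<^sub>R x \<notin> Z"]) auto
  qed
  \<comment> \<open>For fixed r the inner integral measures a translated and rescaled copy of
    \<open>Z\<close>; one nonzero r at which it vanishes is enough to make \<open>Z\<close>
    null.\<close>
  have "(\<integral>\<^sup>+r. (\<integral>\<^sup>+x. indicator Z (a + r *\<^sub>R x) \<partial>lborel) \<partial>(lborel :: real measure))
      = (\<integral>\<^sup>+x. (\<integral>\<^sup>+r. indicator Z (a + r *\<^sub>R x) \<partial>lborel) \<partial>lborel)"
    by (rule lborel_pair.Fubini') measurable
  also have "\<dots> = 0"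
  proof -
    have "(\<integral>\<^sup>+r. indicator Z (a + r *\<^sub>R x) \<partial>lborel) = (\<integral>\<^sup>+r. 0 \<partial>(lborel :: real measure))" for x
      by (rule nn_integral_cong_AE) (use line[of x] in \<open>auto simp: indicator_def elim!: eventually_mono\<close>)
    then show ?thesis by simp
  qed
  finally have "AE r in (lborel :: real measure). (\<integral>\<^sup>+x. indicator Z (a + r *\<^sub>R x) \<partial>lborel) = (0::ennreal)"
    by (subst (asm) nn_integral_0_iff_AE) auto
  moreover have "AE r in (lborel :: real measure). r \<noteq> 0"
    by (rule AE_lborel_singleton)
  ultimately have "AE r in (lborel :: real measure). emeasure lborel Z = 0"
  proof eventually_elim
    case (elim r)
    then show ?case using nn_integral_lborel_affine[of "indicator Z" r a] by simp
  qed
  \<comment> \<open>The property no longer mentions r, so it holds outright because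
    \<open>lborel\<close> is not the zero measure.\<close>
  then have "emeasure lborel Z = 0"
    by (simp add: eventually_const_iff ae_filter_eq_bot_iff)
  then show ?thesis
    by (intro AE_I'[of Z]) (auto simp: Z_def null_sets_def)
qed

section \<open>Tilings\<close>

definition fundamental_domain :: "real \<Rightarrow> (real ^ 'n) set \<Rightarrow> bool" where
  "fundamental_domain c D \<longleftrightarrow> D \<in> sets borel \<and> (\<forall>x. \<exists>!k. x + c *\<^sub>R int_vec k \<in> D)"

definition cube :: "real \<Rightarrow> (real ^ 'n) set" where
  "cube c = {x. \<forall>i. 0 \<le> x $ i \<and> x $ i < c}"

lemma int_vec_nth [simp]: "int_vec k $ i = real_of_int (k $ i)"
  by (simp add: int_vec_def)

lemma int_vec_add: "int_vec (k + l) = int_vec k + int_vec l"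
  and int_vec_diff: "int_vec (k - l) = int_vec k - int_vec l"
  and int_vec_minus: "int_vec (- k) = - int_vec k"
  and int_vec_0 [simp]: "int_vec 0 = 0"
  by (auto simp: vec_eq_iff)

lemma cube_borel [measurable]: "cube c \<in> sets borel"
  unfolding cube_def by measurable


lemma fundamental_domain_cube:
  assumes "0 < c"
  shows "fundamental_domain c {x. x - a \<in> cube c}"
proof -
  \<comment> \<open>The half-open intervals determine the translation coordinate by coordinate, by a
    floor.\<close>
  have mem: "x + c *\<^sub>R int_vec k - a \<in> cube c \<longleftrightarrow> k = (\<chi> i. - \<lfloor>(x $ i - a $ i) / c\<rfloor>)" for x k
  proof -
    have "0 \<le> x $ i + c * real_of_int (k $ i) - a $ i \<and> x $ i + c * real_of_int (k $ i) - a $ i < c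
      \<longleftrightarrow> k $ i = - \<lfloor>(x $ i - a $ i) / c\<rfloor>" for i
    proof -
      have "\<lfloor>(x $ i - a $ i) / c\<rfloor> = - k $ i \<longleftrightarrow> - real_of_int (k $ i) \<le> (x $ i - a $ i) / c \<and> (x $ i - a $ i) / c < - real_of_int (k $ i) + 1"
        by (simp add: floor_eq_iff)
      also have "\<dots> \<longleftrightarrow> 0 \<le> x $ i + c * real_of_int (k $ i) - a $ i \<and> x $ i + c * real_of_int (k $ i) - a $ i < c"
        using assms by (simp add: field_simps) 
      finally show ?thesis by auto
    qed
    then show ?thesis by (simp add: cube_def vec_eq_iff)
  qed
  show ?thesis unfolding fundamental_domain_def mem
  proof
    show "{x. x - a \<in> cube c} \<in> sets borel" by measurable
  qed (simp add: mem)
qed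

interpretation cs: sigma_finite_measure "count_space (UNIV :: (int ^ 'n) set)"
  by (rule sigma_finite_measure_count_space)

interpretation lborel_cs: pair_sigma_finite "lborel :: (real ^ 'n) measure" "count_space (UNIV :: (int ^ 'm) set)" ..

text \<open>The index set is countable, so joint measurability follows from that of each slice. This
  serves the exchanges of lattice sums with integrals.\<close>

lemma measurable_pair_cs:
  fixes f :: "'a \<Rightarrow> int ^ 'n \<Rightarrow> 'b"
  assumes "\<And>k. (\<lambda>x. f x k) \<in> measurable M N"
  shows "(\<lambda>(x, k). f x k) \<in> measurable (M \<Otimes>\<^sub>M count_space UNIV) N"
proof -
  have "(\<lambda>z. (\<lambda>k z. f (fst z) k) (snd z) z) \<in> measurable (M \<Otimes>\<^sub>M count_space UNIV) N"
    by (rule measurable_compose_countable[where g=snd and f="\<lambda>k z. f (fst z) k"])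
       (use assms in \<open>auto intro: measurable_compose[OF measurable_fst]\<close>)
  then show ?thesis by (simp add: case_prod_beta')
qed

lemma measurable_nn_integral_cs [measurable]:
  fixes f :: "'a \<Rightarrow> int ^ 'n \<Rightarrow> ennreal"
  assumes "\<And>k. (\<lambda>x. f x k) \<in> borel_measurable M"
  shows "(\<lambda>x. \<integral>\<^sup>+k. f x k \<partial>count_space UNIV) \<in> borel_measurable M"
  by (rule cs.borel_measurable_nn_integral) (rule measurable_pair_cs[OF assms])

lemma measurable_integral_cs [measurable]:
  fixes f :: "'a \<Rightarrow> int ^ 'n \<Rightarrow> complex"
  assumes "\<And>k. (\<lambda>x. f x k) \<in> borel_measurable M"
  shows "(\<lambda>x. \<integral>k. f x k \<partial>count_space UNIV) \<in> borel_measurable M"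
  by (rule cs.borel_measurable_lebesgue_integral) (rule measurable_pair_cs[OF assms])

lemma nn_integral_cs_swap:
  fixes f :: "'a \<Rightarrow> int ^ 'n \<Rightarrow> ennreal"
  assumes "\<And>k. (\<lambda>x. f x k) \<in> borel_measurable M"
  shows "(\<integral>\<^sup>+x. (\<integral>\<^sup>+k. f x k \<partial>count_space UNIV) \<partial>M) = (\<integral>\<^sup>+k. (\<integral>\<^sup>+x. f x k \<partial>M) \<partial>count_space UNIV)"
  by (rule nn_integral_count_space_nn_integral[where f="\<lambda>k x. f x k"]) (auto simp: assms)

lemma fundamental_domain_measurable [measurable_dest]: "fundamental_domain c D \<Longrightarrow> D \<in> sets borel"
  by (simp add: fundamental_domain_def)

lemma fundamental_domain_sum:
  fixes D :: "(real ^ 'n) set"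
  assumes "fundamental_domain c D"
  shows "(\<integral>\<^sup>+k. indicator D (x + c *\<^sub>R int_vec k) \<partial>count_space UNIV) = 1"
proof -
  obtain k0 where k0: "\<And>k. x + c *\<^sub>R int_vec k \<in> D \<longleftrightarrow> k = k0"
    using assms unfolding fundamental_domain_def by metis
  have "(\<integral>\<^sup>+k. indicator D (x + c *\<^sub>R int_vec k) \<partial>count_space UNIV) = (\<integral>\<^sup>+k. indicator {k0} k \<partial>count_space UNIV)"
    by (intro nn_integral_cong) (auto simp: indicator_def k0)
  then show ?thesis by simp
qed

text \<open>The indicators of the translates of \<open>D\<close> sum to 1. Inserting this sum,
  exchanging it with the integral, translating each term back to \<open>D\<close> and reflecting k
  gives the folded integral.\<close>

lemma nn_integral_tile:
  fixes f :: "real ^ 'n \<Rightarrow> ennreal"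
  assumes D: "fundamental_domain c D" and [measurable]: "f \<in> borel_measurable borel"
  shows "(\<integral>\<^sup>+x. f x \<partial>lborel)
    = (\<integral>\<^sup>+x\<in>D. (\<integral>\<^sup>+k. f (x + c *\<^sub>R int_vec k) \<partial>count_space UNIV) \<partial>lborel)"
proof -
  note [measurable] = fundamental_domain_measurable[OF D]
  have "(\<integral>\<^sup>+x. f x \<partial>lborel) = (\<integral>\<^sup>+x. f x * (\<integral>\<^sup>+k. indicator D (x + c *\<^sub>R int_vec k) \<partial>count_space UNIV) \<partial>lborel)"
    by (simp add: fundamental_domain_sum[OF D])
  also have "\<dots> = (\<integral>\<^sup>+x. (\<integral>\<^sup>+k. f x * indicator D (x + c *\<^sub>R int_vec k) \<partial>count_space UNIV) \<partial>lborel)"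
    by (simp add: nn_integral_cmult)
  also have "\<dots> = (\<integral>\<^sup>+k. (\<integral>\<^sup>+x. f x * indicator D (x + c *\<^sub>R int_vec k) \<partial>lborel) \<partial>count_space UNIV)"
    by (rule nn_integral_cs_swap) measurable
  also have "\<dots> = (\<integral>\<^sup>+k. (\<integral>\<^sup>+x. f (x + c *\<^sub>R int_vec (- k)) * indicator D x \<partial>lborel) \<partial>count_space UNIV)"
  proof (rule nn_integral_cong)
    fix k :: "int ^ 'n"
    show "(\<integral>\<^sup>+x. f x * indicator D (x + c *\<^sub>R int_vec k) \<partial>lborel)
      = (\<integral>\<^sup>+x. f (x + c *\<^sub>R int_vec (- k)) * indicator D x \<partial>lborel)"
      by (subst nn_integral_lborel_translate[of _ "c *\<^sub>R int_vec (- k)", symmetric])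
         (auto simp: int_vec_minus algebra_simps)
  qed
  also have "\<dots> = (\<integral>\<^sup>+k. (\<integral>\<^sup>+x. f (x + c *\<^sub>R int_vec k) * indicator D x \<partial>lborel) \<partial>count_space UNIV)"
    by (rule nn_integral_bij_count_space[where g=uminus]) (simp add: bij_uminus)
  also have "\<dots> = (\<integral>\<^sup>+x. (\<integral>\<^sup>+k. f (x + c *\<^sub>R int_vec k) * indicator D x \<partial>count_space UNIV) \<partial>lborel)"
    by (rule nn_integral_cs_swap[symmetric]) measurable
  also have "\<dots> = (\<integral>\<^sup>+x\<in>D. (\<integral>\<^sup>+k. f (x + c *\<^sub>R int_vec k) \<partial>count_space UNIV) \<partial>lborel)"
    by (simp add: nn_integral_multc)
  finally show ?thesis .
qed

text \<open>The same folding as an image measure of \<open>D\<close> times the lattice. In this form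
  Fubini for Bochner integrals yields the complex-valued version.\<close>

lemma lborel_tile:
  fixes D :: "(real ^ 'n) set"
  assumes D: "fundamental_domain c D"
  shows "distr (density (lborel \<Otimes>\<^sub>M count_space UNIV) (\<lambda>z. indicator D (fst z))) borel
      (\<lambda>z. fst z + c *\<^sub>R int_vec (snd z)) = lborel" (is "distr ?M borel ?f = _")
proof (rule measure_eqI)
  note [measurable] = fundamental_domain_measurable[OF D]
  have f [measurable]: "?f \<in> borel_measurable (lborel \<Otimes>\<^sub>M count_space UNIV)"
    using measurable_pair_cs[of "\<lambda>x k. x + c *\<^sub>R int_vec k" lborel borel] by (simp add: case_prod_beta')
  fix A assume "A \<in> sets (distr ?M borel ?f)"
  then have [measurable]: "A \<in> sets borel" by simp
  have "emeasure (distr ?M borel ?f) A = (\<integral>\<^sup>+z. indicator A z \<partial>distr ?M borel ?f)" by simp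
  also have "\<dots> = (\<integral>\<^sup>+z. indicator A (?f z) \<partial>?M)" by (rule nn_integral_distr) simp_all
  also have "\<dots> = (\<integral>\<^sup>+z. indicator D (fst z) * indicator A (?f z) \<partial>(lborel \<Otimes>\<^sub>M count_space UNIV))"
    by (rule nn_integral_density) measurable
  also have "\<dots> = (\<integral>\<^sup>+x. (\<integral>\<^sup>+k. indicator D x * indicator A (x + c *\<^sub>R int_vec k) \<partial>count_space UNIV) \<partial>lborel)"
    by (subst cs.nn_integral_fst[symmetric]) simp_all
  also have "\<dots> = (\<integral>\<^sup>+x\<in>D. (\<integral>\<^sup>+k. indicator A (x + c *\<^sub>R int_vec k) \<partial>count_space UNIV) \<partial>lborel)"
    by (simp add: nn_integral_cmult mult.commute)
  also have "\<dots> = (\<integral>\<^sup>+x. indicator A x \<partial>lborel)"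
    by (rule nn_integral_tile[OF D, symmetric]) measurable
  finally show "emeasure (distr ?M borel ?f) A = emeasure lborel A" by simp
qed simp

lemma integral_tile:
  fixes f :: "real ^ 'n \<Rightarrow> complex"
  assumes D: "fundamental_domain c D" and f: "integrable lborel f"
  shows "(\<integral>x. f x \<partial>lborel) = (\<integral>x. indicator D x *\<^sub>R (\<integral>k. f (x + c *\<^sub>R int_vec k) \<partial>count_space UNIV) \<partial>lborel)"
    and "integrable lborel (\<lambda>x. indicator D x *\<^sub>R (\<integral>k. f (x + c *\<^sub>R int_vec k) \<partial>count_space UNIV))"
proof -
  note [measurable] = fundamental_domain_measurable[OF D]
  let ?P = "lborel \<Otimes>\<^sub>M count_space (UNIV :: (int ^ 'n) set)"
  have [measurable]: "(\<lambda>z. fst z + c *\<^sub>R int_vec (snd z)) \<in> borel_measurable ?P"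
    using measurable_pair_cs[of "\<lambda>x k. x + c *\<^sub>R int_vec k" lborel borel] by (simp add: case_prod_beta')
  have [measurable]: "f \<in> borel_measurable borel" using f by auto
  let ?M = "density ?P (\<lambda>z. ennreal (indicator D (fst z)))"
  let ?g = "\<lambda>z. indicator D (fst z) *\<^sub>R f (fst z + c *\<^sub>R int_vec (snd z))"
  have M: "distr ?M borel (\<lambda>z. fst z + c *\<^sub>R int_vec (snd z)) = lborel"
    using lborel_tile[OF D] by (simp add: ennreal_indicator)
  have "integrable ?M (\<lambda>z. f (fst z + c *\<^sub>R int_vec (snd z)))"
    using f by (subst (asm) M[symmetric], subst (asm) integrable_distr_eq) auto
  then have int: "integrable ?P ?g"
    by (subst (asm) integrable_density) auto
  have "(\<integral>x. f x \<partial>lborel) = (\<integral>z. f (fst z + c *\<^sub>R int_vec (snd z)) \<partial>?M)"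
    by (subst M[symmetric], subst integral_distr) auto
  also have "\<dots> = (\<integral>z. ?g z \<partial>?P)"
    by (subst integral_density) auto
  also have "\<dots> = (\<integral>x. (\<integral>k. indicator D x *\<^sub>R f (x + c *\<^sub>R int_vec k) \<partial>count_space UNIV) \<partial>lborel)"
    using lborel_cs.integral_fst'[OF int] by simp
  finally show "(\<integral>x. f x \<partial>lborel) = (\<integral>x. indicator D x *\<^sub>R (\<integral>k. f (x + c *\<^sub>R int_vec k) \<partial>count_space UNIV) \<partial>lborel)"
    by simp
  show "integrable lborel (\<lambda>x. indicator D x *\<^sub>R (\<integral>k. f (x + c *\<^sub>R int_vec k) \<partial>count_space UNIV))"
    using lborel_cs.integrable_fst'[OF int] by simp
qed

section \<open>Fourier series\<close>

lemma fundamental_domain_cube0: "0 < c \<Longrightarrow> fundamental_domain c (cube c)"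
  using fundamental_domain_cube[of c 0] by simp

lemma emeasure_cube:
  assumes "0 < c"
  shows "emeasure lborel (cube c :: (real ^ 'n) set) = ennreal (c ^ CARD('n))"
proof -
  let ?u = "(\<chi> i. c) :: real ^ 'n"
  have b: "?u \<bullet> b = c" if "b \<in> Basis" for b
    using that by (auto simp: Basis_vec_def inner_axis)
  have "emeasure lborel (box 0 ?u) \<le> emeasure lborel (cube c :: (real ^ 'n) set)"
    by (rule emeasure_mono) (auto simp: cube_def mem_box_cart intro: less_imp_le)
  moreover have "emeasure lborel (cube c :: (real ^ 'n) set) \<le> emeasure lborel (cbox 0 ?u)"
    by (rule emeasure_mono) (auto simp: cube_def mem_box_cart less_imp_le)
  ultimately show ?thesis
    using assms by (simp add: emeasure_lborel_cbox_eq emeasure_lborel_box_eq b DIM_cart)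
qed

text \<open>The torus as a half-open cube with unnormalised Lebesgue measure. Its mass (2 pi)^n is
  the source of the powers of 2 pi in Parseval's and Plancherel's identities.\<close>

abbreviation TM :: "(real ^ 'n) measure" where
  "TM \<equiv> restrict_space lborel (cube (2 * pi))"

lemma emeasure_TM: "emeasure (TM :: (real ^ 'n) measure) (space TM) = ennreal ((2 * pi) ^ CARD('n))"
  by (simp add: emeasure_restrict_space emeasure_cube space_restrict_space)

interpretation TM: finite_measure "TM :: (real ^ 'n) measure"
  by (rule finite_measureI) (simp only: emeasure_TM, simp)

lemma nn_integral_TM: "(\<integral>\<^sup>+x. f x \<partial>(TM :: (real ^ 'n) measure)) = (\<integral>\<^sup>+x\<in>cube (2 * pi). f x \<partial>lborel)"
  by (rule nn_integral_restrict_space) simp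

lemma integral_TM: "(\<integral>x. f x \<partial>(TM :: (real ^ 'n) measure)) = (\<integral>x. indicator (cube (2 * pi)) x *\<^sub>R (f x :: 'b::{banach, second_countable_topology}) \<partial>lborel)"
  by (rule integral_restrict_space) simp

lemma AE_TM: "(AE x in lborel. P x) \<Longrightarrow> (AE x in (TM :: (real ^ 'n) measure). P x)"
  by (subst AE_restrict_space_iff) (auto elim: eventually_mono)

lemma measurable_TM [measurable (raw)]: "f \<in> borel_measurable borel \<Longrightarrow> f \<in> borel_measurable TM"
  by (rule measurable_restrict_space1) simp

lemma integral_lborel_affine:
  fixes a :: "'a::euclidean_space" and f :: "'a \<Rightarrow> complex"
  assumes [measurable]: "f \<in> borel_measurable borel" and "c \<noteq> 0"
  shows "(\<integral>x. f x \<partial>lborel) = of_real (\<bar>c\<bar> ^ DIM('a)) * (\<integral>x. f (a + c *\<^sub>R x) \<partial>lborel)"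
  by (subst lborel_affine[OF \<open>c \<noteq> 0\<close>, of a])
     (simp add: integral_density integral_distr scaleR_conv_of_real)

text \<open>Folding the restriction of f to \<open>D'\<close> onto \<open>D\<close> returns f
  itself, because exactly one translate of each point lies in \<open>D'\<close>.\<close>

lemma integral_fundamental_domain_shift:
  fixes f :: "real ^ 'n \<Rightarrow> complex"
  assumes D: "fundamental_domain c D" and D': "fundamental_domain c D'"
    and per: "\<And>x k. f (x + c *\<^sub>R int_vec k) = f x"
    and int: "integrable lborel (\<lambda>x. indicator D' x *\<^sub>R f x)"
  shows "(\<integral>x. indicator D' x *\<^sub>R f x \<partial>lborel) = (\<integral>x. indicator D x *\<^sub>R f x \<partial>lborel)"
proof -
  have "(\<integral>k. indicator D' (x + c *\<^sub>R int_vec k) *\<^sub>R f (x + c *\<^sub>R int_vec k) \<partial>count_space UNIV) = f x" for x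
  proof -
    obtain k0 where k0: "\<And>k. x + c *\<^sub>R int_vec k \<in> D' \<longleftrightarrow> k = k0"
      using D' unfolding fundamental_domain_def by metis
    have "(\<integral>k. indicator D' (x + c *\<^sub>R int_vec k) *\<^sub>R f (x + c *\<^sub>R int_vec k) \<partial>count_space UNIV)
      = (\<integral>k. indicator {k0} k *\<^sub>R f x \<partial>count_space UNIV)"
      by (intro Bochner_Integration.integral_cong) (auto simp: indicator_def k0 per)
    then show ?thesis by simp
  qed
  then show ?thesis using integral_tile(1)[OF D int] by simp
qed

text \<open>The sign is that of \<open>trig_poly\<close> and \<open>fourier_integral\<close>, so
  integrating against \<open>ek k\<close> evaluates a Fourier integral at the lattice point
  k.\<close>

definition ek :: "int ^ 'n \<Rightarrow> real ^ 'n \<Rightarrow> complex" where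
  "ek k x = cis (- (int_vec k \<bullet> x))"

lemma ek_measurable [measurable]: "ek k \<in> borel_measurable borel"
  unfolding ek_def by (intro borel_measurable_continuous_onI continuous_intros continuous_on_compose2[OF continuous_on_cis]) auto

lemma norm_ek [simp]: "cmod (ek k x) = 1"
  by (simp add: ek_def)

lemma inner_int_vec: "int_vec k \<bullet> int_vec l = real_of_int (\<Sum>i\<in>UNIV. k $ i * l $ i)"
  by (simp add: inner_vec_def)

lemma cis_add_2pi_int: "cis (x + 2 * pi * real_of_int k) = cis x"
  by (simp add: cis_mult[symmetric] cis_multiple_2pi)

lemma ek_periodic: "ek k (x + (2 * pi) *\<^sub>R int_vec l) = ek k x"
proof -
  have "- (int_vec k \<bullet> (x + (2 * pi) *\<^sub>R int_vec l)) = - (int_vec k \<bullet> x) + 2 * pi * real_of_int (- (\<Sum>i\<in>UNIV. k $ i * l $ i))"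
    by (simp add: inner_add_right inner_int_vec)
  then show ?thesis unfolding ek_def by (simp only: cis_add_2pi_int)
qed

lemma ek_mult_cnj: "ek k x * cnj (ek l x) = ek (k - l) x"
  by (simp add: ek_def cis_cnj cis_mult int_vec_diff inner_diff_left)

lemma ek_0 [simp]: "ek 0 x = 1"
  by (simp add: ek_def)

lemma integrable_TM_bounded:
  fixes f :: "real ^ 'n \<Rightarrow> complex"
  assumes "f \<in> borel_measurable borel" "\<And>x. cmod (f x) \<le> B"
  shows "integrable TM f"
  using assms by (intro TM.integrable_const_bound[of _ B]) auto

text \<open>For nonzero k, a translation by a vector a with k . a = pi changes the sign of
  \<open>ek k\<close>; by periodicity it does not change the integral over a period, which is
  therefore 0.\<close>

lemma integral_ek:
  fixes k :: "int ^ 'n"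
  shows "(\<integral>x. ek k x \<partial>TM) = (if k = 0 then of_real ((2 * pi) ^ CARD('n)) else 0)"
proof (cases "k = 0")
  case True
  then show ?thesis
    using emeasure_TM[where 'n='n] by (simp add: measure_def scaleR_conv_of_real space_restrict_space)
next
  case False
  define a where "a = (pi / (int_vec k \<bullet> int_vec k)) *\<^sub>R int_vec k"
  have "int_vec k \<noteq> 0" using False by (auto simp: vec_eq_iff)
  then have a: "int_vec k \<bullet> a = pi" by (simp add: a_def)
  let ?D = "{x. x - a \<in> cube (2 * pi)}"
  have int: "integrable lborel (\<lambda>x. indicator ?D x *\<^sub>R ek k x)"
  proof -
    have "emeasure lborel ?D = (\<integral>\<^sup>+x. indicator (cube (2 * pi)) (x - a) \<partial>lborel)"
      by (subst nn_integral_indicator[symmetric]) (auto intro!: nn_integral_cong simp del: nn_integral_indicator split: split_indicator)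
    also have "\<dots> = emeasure lborel (cube (2 * pi) :: (real ^ 'n) set)"
      using nn_integral_lborel_translate[of "indicator (cube (2 * pi))" "- a"] by simp
    finally have "emeasure lborel ?D < \<infinity>" by (simp add: emeasure_cube)
    then have "integrable lborel (indicator ?D :: real ^ 'n \<Rightarrow> real)"
      by (intro integrable_real_indicator) auto
    then show ?thesis
      by (rule Bochner_Integration.integrable_bound) (auto simp: indicator_def)
  qed
  have "(\<integral>x. indicator (cube (2 * pi)) x *\<^sub>R ek k x \<partial>lborel) = (\<integral>x. indicator ?D x *\<^sub>R ek k x \<partial>lborel)"
    by (rule integral_fundamental_domain_shift[OF fundamental_domain_cube0 fundamental_domain_cube _ int, symmetric])
       (auto simp: ek_periodic)
  also have "\<dots> = (\<integral>x. indicator ?D (a + x) *\<^sub>R ek k (a + x) \<partial>lborel)"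
    using integral_lborel_affine[of "\<lambda>x. indicator ?D x *\<^sub>R ek k x" 1 a] by simp
  also have "\<dots> = (\<integral>x. - (indicator (cube (2 * pi)) x *\<^sub>R ek k x) \<partial>lborel)"
    by (intro Bochner_Integration.integral_cong)
       (auto simp: indicator_def ek_def inner_add_right a complex_eq_iff cos_add sin_add cos_diff sin_diff)
  finally show ?thesis using False by (simp add: integral_TM)
qed

section \<open>The ring of trigonometric polynomials\<close>

lemma trig_poly_sum:
  assumes "finite I"
  shows "trig_poly (\<lambda>x. \<Sum>i\<in>I. c i * ek (\<kappa> i) x)"
proof -
  \<comment> \<open>Frequencies may repeat along \<kappa>, whereas \<open>trig_poly\<close> sums
    over a set of frequencies; the coefficients are collected over the fibres of \<kappa>.\<close>
  have "(\<Sum>i\<in>I. c i * ek (\<kappa> i) x) = (\<Sum>k\<in>\<kappa> ` I. (\<Sum>i\<in>{i\<in>I. \<kappa> i = k}. c i) * cis (- (int_vec k \<bullet> x)))" for x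
    by (subst sum.image_gen[OF assms, of _ \<kappa>])
       (auto intro!: sum.cong simp: sum_distrib_right ek_def)
  then show ?thesis unfolding trig_poly_def using assms by (intro exI[of _ "\<kappa> ` I"] exI) auto
qed

lemma trig_polyE:
  assumes "trig_poly t"
  obtains K h where "finite K" "t = (\<lambda>x. \<Sum>k\<in>K. h k * ek k x)"
  using assms unfolding trig_poly_def ek_def by blast

lemma trig_poly_const: "trig_poly (\<lambda>x. c)"
  using trig_poly_sum[of "{0::nat}" "\<lambda>_. c" "\<lambda>_. 0"] by simp

lemma trig_poly_ek: "trig_poly (ek k)"
  using trig_poly_sum[of "{0::nat}" "\<lambda>_. 1" "\<lambda>_. k"] by simp

lemma trig_poly_add:
  assumes "trig_poly s" "trig_poly t"
  shows "trig_poly (\<lambda>x. s x + t x)"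
proof -
  obtain K h where K: "finite K" "s = (\<lambda>x. \<Sum>k\<in>K. h k * ek k x)" using assms(1) by (rule trig_polyE)
  obtain L g where L: "finite L" "t = (\<lambda>x. \<Sum>k\<in>L. g k * ek k x)" using assms(2) by (rule trig_polyE)
  have "trig_poly (\<lambda>x. \<Sum>i\<in>K <+> L. case_sum h g i * ek (case_sum id id i) x)"
    using K L by (intro trig_poly_sum) auto
  then show ?thesis using K L by (simp add: sum.Plus)
qed

lemma trig_poly_mult:
  assumes "trig_poly s" "trig_poly t"
  shows "trig_poly (\<lambda>x. s x * t x)"
proof -
  obtain K h where K: "finite K" "s = (\<lambda>x. \<Sum>k\<in>K. h k * ek k x)" using assms(1) by (rule trig_polyE)
  obtain L g where L: "finite L" "t = (\<lambda>x. \<Sum>k\<in>L. g k * ek k x)" using assms(2) by (rule trig_polyE)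
  have ek: "ek (k + l) x = ek k x * ek l x" for k l and x :: "real ^ 'a"
    by (simp add: ek_def cis_mult int_vec_add inner_add_left)
  have "trig_poly (\<lambda>x. \<Sum>i\<in>K \<times> L. (h (fst i) * g (snd i)) * ek (fst i + snd i) x)"
    using K L by (intro trig_poly_sum) auto
  moreover have "s x * t x = (\<Sum>i\<in>K \<times> L. (h (fst i) * g (snd i)) * ek (fst i + snd i) x)" for x
    unfolding K(2) L(2) sum_product sum.cartesian_product
    by (intro sum.cong) (auto simp: ek mult_ac)
  ultimately show ?thesis by simp
qed

lemma trig_poly_setsum:
  assumes "\<And>i. i \<in> I \<Longrightarrow> trig_poly (t i)"
  shows "trig_poly (\<lambda>x. \<Sum>i\<in>I. t i x)"
  using assms by (induction I rule: infinite_finite_induct) (auto intro: trig_poly_const trig_poly_add)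

section \<open>Uniform approximation by trigonometric polynomials\<close>

lemma trig_poly_cis_nth:
  "trig_poly (\<lambda>x::real ^ 'n. cis (x $ i))" "trig_poly (\<lambda>x::real ^ 'n. cis (- (x $ i)))"
proof -
  have 1: "int_vec (axis i 1) \<bullet> x = x $ i" for x :: "real ^ 'n"
  proof -
    have "int_vec (axis i 1 :: int ^ 'n) = axis i 1" by (auto simp: vec_eq_iff axis_def)
    then show ?thesis by (simp add: inner_axis' )
  qed
  show "trig_poly (\<lambda>x::real ^ 'n. cis (x $ i))"
    using trig_poly_ek[of "- axis i 1"] by (simp add: ek_def[abs_def] int_vec_minus 1)
  show "trig_poly (\<lambda>x::real ^ 'n. cis (- (x $ i)))"
    using trig_poly_ek[of "axis i 1"] by (simp add: ek_def[abs_def] 1)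
qed

text \<open>On the product of unit circles a real linear functional is a combination of cos x_i and
  sin x_i, and sums and products stay trigonometric. This converts the real polynomials of the
  Stone-Weierstrass theorem into trigonometric ones.\<close>

lemma trig_poly_real_polynomial:
  fixes g :: "complex ^ 'n \<Rightarrow> real"
  assumes "real_polynomial_function g"
  shows "trig_poly (\<lambda>x. of_real (g (\<chi> i. cis (x $ i))))"
  using assms
proof induction
  case (linear f)
  then interpret f: bounded_linear f .
  have eq: "complex_of_real (f (\<chi> i. cis (x $ i))) =
     (\<Sum>i\<in>UNIV. (of_real (f (axis i 1)) / 2) * (cis (x $ i) + cis (- (x $ i)))
        + (of_real (f (axis i \<i>)) / (2 * \<i>)) * (cis (x $ i) + (- 1) * cis (- (x $ i))))" for x :: "real ^ 'n"
  proof -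
    have "(\<chi> i. cis (x $ i)) = (\<Sum>i\<in>UNIV. cos (x $ i) *\<^sub>R axis i 1 + sin (x $ i) *\<^sub>R axis i \<i>)"
      by (auto simp: vec_eq_iff axis_def complex_eq_iff sum.distrib if_distrib cong: if_cong)
    then have "f (\<chi> i. cis (x $ i)) = (\<Sum>i\<in>UNIV. cos (x $ i) * f (axis i 1) + sin (x $ i) * f (axis i \<i>))"
      by (simp add: f.sum f.add f.scaleR)
    moreover have cs: "cis t + cis (- t) = 2 * of_real (cos t)" "cis t + (- 1) * cis (- t) = 2 * \<i> * of_real (sin t)" for t
      by (auto simp: complex_eq_iff)
    have "complex_of_real (cos t * A + sin t * B) =
        of_real A / 2 * (cis t + cis (- t)) + of_real B / (2 * \<i>) * (cis t + (- 1) * cis (- t))" for t A B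
      unfolding cs by (simp add: complex_eq_iff)
    ultimately show ?thesis
      by (simp only: of_real_sum)
  qed
  show ?case unfolding eq
    by (intro trig_poly_setsum trig_poly_add trig_poly_mult trig_poly_const trig_poly_cis_nth)
next
  case (const c)
  then show ?case by (rule trig_poly_const)
next
  case (add f g)
  then show ?case using trig_poly_add by fastforce
next
  case (mult f g)
  then show ?case using trig_poly_mult by fastforce
qed

text \<open>Because u vanishes off the open cube, it descends to a continuous function on the
  product of unit circles. Stone-Weierstrass applies there, and the approximant is pulled back along
  the angle map \<open>E\<close>.\<close>

lemma trig_poly_approx_continuous:
  fixes u :: "real ^ 'n \<Rightarrow> real"
  assumes u: "continuous_on UNIV u" and supp: "\<And>x. \<not> (\<forall>i. 0 < x $ i \<and> x $ i < 2 * pi) \<Longrightarrow> u x = 0"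
    and "0 < e"
  obtains P where "trig_poly P" "\<And>x. x \<in> cube (2 * pi) \<Longrightarrow> cmod (of_real (u x) - P x) < e"
proof -
  define E :: "real ^ 'n \<Rightarrow> complex ^ 'n" where "E x = (\<chi> i. cis (x $ i))" for x
  define S where "S = {z :: complex ^ 'n. \<forall>i. cmod (z $ i) = 1}"
  define X where "X = cbox 0 ((\<chi> i. 2 * pi) :: real ^ 'n)"
  define U where "U z = u (\<chi> i. Arg2pi (z $ i))" for z :: "complex ^ 'n"
  have E_cont: "continuous_on A E" for A
    unfolding E_def by (intro continuous_on_vec_lambda continuous_on_compose2[OF continuous_on_cis[OF continuous_on_id]] continuous_intros) auto
  have Arg_cis: "Arg2pi (cis t) = t" if "0 \<le> t" "t < 2 * pi" for t
    using that by (intro Arg2pi_unique[of 1]) (auto simp: cis_conv_exp mult.commute)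
  have UE: "U (E x) = u x" if "x \<in> X" for x
  proof (cases "\<forall>i. x $ i < 2 * pi")
    case True
    then have "(\<chi> i. Arg2pi (E x $ i)) = x"
      using that by (auto simp: E_def X_def mem_box_cart vec_eq_iff Arg_cis)
    then show ?thesis by (simp add: U_def)
  next
    case False
    then obtain i where "2 * pi \<le> x $ i" by (auto simp: not_less)
    moreover have "x $ i \<le> 2 * pi" using that by (auto simp: X_def mem_box_cart)
    ultimately have i: "x $ i = 2 * pi" by simp
    \<comment> \<open>At the far face the angle wraps round to 0, so \<open>U\<close> reads u on the
      opposite face; u vanishes on both faces.\<close>
    then have 0: "(\<chi> i. Arg2pi (E x $ i)) $ i = 0"
      by (simp add: E_def cis_conv_exp exp_two_pi_i Arg2pi_of_real[of 1, simplified] mult.commute)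
    then have "U (E x) = 0" unfolding U_def using 0 by (intro supp notI) (auto dest: spec[of _ i])
    moreover have "u x = 0" using i by (intro supp notI) (auto dest: spec[of _ i])
    ultimately show ?thesis by simp
  qed
  have "compact X" by (simp add: X_def)
  have EX: "E ` X = S"
  proof safe
    fix x show "E x \<in> S" by (simp add: E_def S_def)
  next
    fix z assume z: "z \<in> S"
    have "cis (Arg2pi (z $ i)) = z $ i" for i
      using z complex_norm_eq_1_exp[of "z $ i"] by (simp add: S_def cis_conv_exp)
    then have "z = E (\<chi> i. Arg2pi (z $ i))" by (simp add: E_def vec_eq_iff)
    moreover have "(\<chi> i. Arg2pi (z $ i)) \<in> X"
      using Arg2pi by (auto simp: X_def mem_box_cart less_imp_le)
    ultimately show "z \<in> E ` X" by blast
  qed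
  have "compact S" using compact_continuous_image[OF E_cont \<open>compact X\<close>] EX by simp
  \<comment> \<open>The angle itself is discontinuous, so preimages are used: under \<open>U\<close>
    the preimage of a closed set is the image under \<open>E\<close> of a compact subset of
    \<open>X\<close>.\<close>
  have "continuous_on S U"
  proof (subst continuous_on_closed_vimage[OF compact_imp_closed[OF \<open>compact S\<close>]], safe)
    fix B :: "real set" assume "closed B"
    have "U -` B \<inter> S = E ` (u -` B \<inter> X)"
    proof safe
      fix z assume "z \<in> S" "U z \<in> B"
      then obtain x where "x \<in> X" "z = E x" using EX by blast
      then show "z \<in> E ` (u -` B \<inter> X)" using UE[of x] \<open>U z \<in> B\<close> by auto
    qed (use EX UE in auto)
    moreover have "closed (u -` B \<inter> X)"
      using continuous_closed_vimage[OF \<open>closed B\<close>, of u] u \<open>compact X\<close>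
      by (intro closed_Int) (auto simp: continuous_on_eq_continuous_at compact_imp_closed)
    then have "compact (u -` B \<inter> X)" using \<open>compact X\<close>
      by (metis compact_Int_closed inf.left_idem inf_commute)
    ultimately show "closed (U -` B \<inter> S)"
      using compact_continuous_image[OF E_cont] compact_imp_closed by metis
  qed
  then obtain g where g: "real_polynomial_function g" "\<And>z. z \<in> S \<Longrightarrow> \<bar>U z - g z\<bar> < e"
    using Stone_Weierstrass_real_polynomial_function[OF \<open>compact S\<close> _ \<open>0 < e\<close>] by blast
  show ?thesis
  proof (rule that)
    show "trig_poly (\<lambda>x. of_real (g (E x)))" unfolding E_def by (rule trig_poly_real_polynomial[OF g(1)])
    fix x :: "real ^ 'n" assume "x \<in> cube (2 * pi)"
    then have "x \<in> X" by (auto simp: X_def cube_def mem_box_cart intro: less_imp_le)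
    then have "\<bar>u x - g (E x)\<bar> < e" using UE[of x] g(2)[of "E x"] EX by auto
    then show "cmod (of_real (u x) - of_real (g (E x))) < e"
      by (metis norm_of_real of_real_diff)
  qed
qed

section \<open>Fourier coefficients, mean-square density and Parseval's identity\<close>

lemma integrable_TM_square:
  fixes H :: "real ^ 'n \<Rightarrow> complex"
  assumes H [measurable]: "H \<in> borel_measurable borel" and fin: "(\<integral>\<^sup>+x. ennreal ((cmod (H x))\<^sup>2) \<partial>TM) < \<infinity>"
  shows "integrable TM (\<lambda>x. (cmod (H x))\<^sup>2)" "integrable TM (\<lambda>x. H x * ek k x)"
proof -
  show *: "integrable TM (\<lambda>x. (cmod (H x))\<^sup>2)"
    using fin by (intro integrableI_bounded) auto
  have "integrable TM (\<lambda>x. 1 + (cmod (H x))\<^sup>2)" using * by simp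
  then show "integrable TM (\<lambda>x. H x * ek k x)"
  proof (rule Bochner_Integration.integrable_bound)
    have "t \<le> 1 + t\<^sup>2" for t :: real
      using zero_le_power2[of "t - 1 / 2"] by (simp add: power2_eq_square field_simps)
    then show "AE x in TM. norm (H x * ek k x) \<le> norm (1 + (cmod (H x))\<^sup>2)"
      by (auto simp: norm_mult)
  qed measurable
qed

text \<open>Completing the square in the coefficients a k. With a k = c k / w the last term vanishes
  and Bessel's inequality results; for any other choice that term is nonnegative, so a good
  approximation forces the c k to carry almost all the energy.\<close>

lemma bessel_identity:
  fixes H :: "real ^ 'n \<Rightarrow> complex" and a :: "int ^ 'n \<Rightarrow> complex"
  assumes H [measurable]: "H \<in> borel_measurable borel" and fin: "(\<integral>\<^sup>+x. ennreal ((cmod (H x))\<^sup>2) \<partial>TM) < \<infinity>"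
    and K: "finite K"
  defines "w \<equiv> (2 * pi) ^ CARD('n)"
  defines "c \<equiv> \<lambda>k. \<integral>x. H x * ek k x \<partial>TM"
  shows "(\<integral>x. (cmod (H x - (\<Sum>k\<in>K. a k * ek (- k) x)))\<^sup>2 \<partial>TM)
    = (\<integral>x. (cmod (H x))\<^sup>2 \<partial>TM) - (\<Sum>k\<in>K. (cmod (c k))\<^sup>2) / w + w * (\<Sum>k\<in>K. (cmod (a k - c k / of_real w))\<^sup>2)"
    and "integrable TM (\<lambda>x. (cmod (H x - (\<Sum>k\<in>K. a k * ek (- k) x)))\<^sup>2)"
proof -
  have w: "w > 0" by (simp add: w_def)
  have cnj_ek: "cnj (ek k x) = ek (- k) x" for k and x :: "real ^ 'n"
    by (simp add: ek_def cis_cnj int_vec_minus)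
  note iH = integrable_TM_square[OF H fin]
  have iHc: "integrable TM (\<lambda>x. cnj (H x) * ek (- k) x)" for k
    using integrable_cnj[OF iH(2)[of k]] by (simp add: cnj_ek)
  have ie: "integrable TM (ek k :: real ^ 'n \<Rightarrow> complex)" for k
    by (rule integrable_TM_bounded[of _ 1]) auto
  have int_cnj: "(\<integral>x. cnj (H x) * ek (- k) x \<partial>TM) = cnj (\<integral>x. H x * ek k x \<partial>TM)" for k
    using integral_bounded_linear[OF bounded_linear_cnj iH(2)[of k]] by (simp add: cnj_ek)
  define P where "P x = (\<Sum>k\<in>K. a k * ek (- k) x)" for x
  have expand: "complex_of_real ((cmod (H x - P x))\<^sup>2) = of_real ((cmod (H x))\<^sup>2)
      - (\<Sum>k\<in>K. cnj (a k) * (H x * ek k x)) - (\<Sum>k\<in>K. a k * (cnj (H x) * ek (- k) x))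
      + (\<Sum>k\<in>K. \<Sum>l\<in>K. a k * cnj (a l) * ek (l - k) x)" for x
  proof -
    have cP: "cnj (P x) = (\<Sum>k\<in>K. cnj (a k) * ek k x)"
      by (simp add: P_def cnj_ek)
    have "P x * cnj (P x) = (\<Sum>k\<in>K. \<Sum>l\<in>K. a k * cnj (a l) * ek (l - k) x)"
      unfolding cP unfolding P_def sum_product
      by (intro sum.cong refl) (simp add: ek_mult_cnj[symmetric] cnj_ek)
    moreover have "complex_of_real ((cmod (H x - P x))\<^sup>2) = of_real ((cmod (H x))\<^sup>2) - H x * cnj (P x) - cnj (H x) * P x + P x * cnj (P x)"
      unfolding complex_norm_square by (simp add: algebra_simps)
    moreover have "H x * cnj (P x) = (\<Sum>k\<in>K. cnj (a k) * (H x * ek k x))"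
      "cnj (H x) * P x = (\<Sum>k\<in>K. a k * (cnj (H x) * ek (- k) x))"
      unfolding cP by (simp_all add: P_def sum_distrib_left mult_ac)
    ultimately show ?thesis by simp
  qed
  note int_intros = Bochner_Integration.integrable_add Bochner_Integration.integrable_diff
    Bochner_Integration.integrable_sum integrable_mult_right integrable_of_real iH iHc ie
  have int4: "integrable TM (\<lambda>x. of_real ((cmod (H x - P x))\<^sup>2) :: complex)"
    unfolding expand by (intro int_intros)
  then show "integrable TM (\<lambda>x. (cmod (H x - (\<Sum>k\<in>K. a k * ek (- k) x)))\<^sup>2)"
    unfolding P_def by (simp only: complex_of_real_integrable_eq)
  have "complex_of_real (\<integral>x. (cmod (H x - P x))\<^sup>2 \<partial>TM) = (\<integral>x. of_real ((cmod (H x - P x))\<^sup>2) \<partial>TM)"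
    by (rule integral_complex_of_real[symmetric])
  also have "\<dots> = of_real (\<integral>x. (cmod (H x))\<^sup>2 \<partial>TM) - (\<Sum>k\<in>K. cnj (a k) * c k) - (\<Sum>k\<in>K. a k * cnj (c k))
     + (\<Sum>k\<in>K. \<Sum>l\<in>K. a k * cnj (a l) * (if l - k = 0 then of_real w else 0))"
    unfolding expand
    apply (subst Bochner_Integration.integral_add)
    subgoal by (intro int_intros)
    subgoal by (intro int_intros)
    apply (subst Bochner_Integration.integral_diff)
    subgoal by (intro int_intros)
    subgoal by (intro int_intros)
    apply (subst Bochner_Integration.integral_diff)
    subgoal by (intro int_intros)
    subgoal by (intro int_intros)
    by (simp only: Bochner_Integration.integral_sum[OF integrable_mult_right[OF iH(2)]]
      Bochner_Integration.integral_sum[OF integrable_mult_right[OF iHc]]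
      Bochner_Integration.integral_sum[OF integrable_mult_right[OF ie]]
      Bochner_Integration.integral_sum[OF Bochner_Integration.integrable_sum[OF integrable_mult_right[OF ie]]]
      integral_mult_right_zero c_def int_cnj integral_ek integral_complex_of_real w_def)
  also have "(\<Sum>k\<in>K. \<Sum>l\<in>K. a k * cnj (a l) * (if l - k = 0 then of_real w else 0)) = (\<Sum>k\<in>K. a k * cnj (a k) * of_real w)"
    using K by (intro sum.cong refl) (simp add: if_distrib[of "(*) _"] sum.delta' cong: if_cong)
  also have "of_real (\<integral>x. (cmod (H x))\<^sup>2 \<partial>TM) - (\<Sum>k\<in>K. cnj (a k) * c k) - (\<Sum>k\<in>K. a k * cnj (c k)) + (\<Sum>k\<in>K. a k * cnj (a k) * of_real w)
     = of_real (\<integral>x. (cmod (H x))\<^sup>2 \<partial>TM) + (\<Sum>k\<in>K. a k * cnj (a k) * of_real w - cnj (a k) * c k - a k * cnj (c k))"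
    by (simp add: sum.distrib sum_subtractf)
  also have "\<dots> = of_real (\<integral>x. (cmod (H x))\<^sup>2 \<partial>TM) + (\<Sum>k\<in>K. of_real (w * (cmod (a k - c k / of_real w))\<^sup>2 - (cmod (c k))\<^sup>2 / w))"
  proof -
    have "a k * cnj (a k) * of_real w - cnj (a k) * c k - a k * cnj (c k)
       = of_real (w * (cmod (a k - c k / of_real w))\<^sup>2 - (cmod (c k))\<^sup>2 / w)" for k
      unfolding of_real_diff of_real_mult of_real_divide complex_norm_square
      using w by (simp add: field_simps)
    then show ?thesis by simp
  qed
  also have "\<dots> = of_real ((\<integral>x. (cmod (H x))\<^sup>2 \<partial>TM) - (\<Sum>k\<in>K. (cmod (c k))\<^sup>2) / w + w * (\<Sum>k\<in>K. (cmod (a k - c k / of_real w))\<^sup>2))"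
    by (simp add: sum_subtractf sum_distrib_left sum_divide_distrib)
  finally show "(\<integral>x. (cmod (H x - (\<Sum>k\<in>K. a k * ek (- k) x)))\<^sup>2 \<partial>TM)
    = (\<integral>x. (cmod (H x))\<^sup>2 \<partial>TM) - (\<Sum>k\<in>K. (cmod (c k))\<^sup>2) / w + w * (\<Sum>k\<in>K. (cmod (a k - c k / of_real w))\<^sup>2)"
    unfolding P_def by (simp only: of_real_eq_iff)
qed

lemma norm_add_square_le: "(norm (a + b))\<^sup>2 \<le> 2 * (norm a)\<^sup>2 + 2 * (norm (b :: 'a :: real_normed_vector))\<^sup>2"
proof -
  have "(norm (a + b))\<^sup>2 \<le> (norm a + norm b)\<^sup>2" by (intro power_mono norm_triangle_ineq) simp
  also have "\<dots> \<le> 2 * (norm a)\<^sup>2 + 2 * (norm b)\<^sup>2"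
    using zero_le_power2[of "norm a - norm b"] by (simp add: power2_eq_square algebra_simps)
  finally show ?thesis .
qed

text \<open>A measurable H is an almost everywhere limit of continuous functions. Clipped to [-B, B]
  and cut off at the boundary of the cube, these meet the conditions of
  \<open>trig_poly_approx_continuous\<close> and converge to H in mean square by dominated
  convergence.\<close>

lemma trig_poly_dense_bounded:
  fixes H :: "real ^ 'n \<Rightarrow> real"
  assumes H [measurable]: "H \<in> borel_measurable borel" and B: "\<And>x. \<bar>H x\<bar> \<le> B" and "0 < e"
  obtains P where "trig_poly P" "(\<integral>\<^sup>+x. ennreal ((cmod (of_real (H x) - P x))\<^sup>2) \<partial>TM) \<le> ennreal e"
proof -
  define O' where "O' = {x :: real ^ 'n. \<forall>i. 0 < x $ i \<and> x $ i < 2 * pi}"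
  have O'_box: "O' = box 0 (\<chi> i. 2 * pi)" by (auto simp: O'_def mem_box_cart)
  have "0 \<le> B" using B[of 0] by (smt (verit))
  have "H measurable_on UNIV"
    by (subst measurable_on_iff_borel_measurable)
       (auto intro!: measurable_restrict_space1 measurable_completion)
  then obtain N g where N: "negligible N" and g: "\<And>n. continuous_on UNIV (g n)"
    and lim: "\<And>x. x \<notin> N \<Longrightarrow> (\<lambda>n. g n x) \<longlonglongrightarrow> H x"
    unfolding measurable_on_def by auto
  \<comment> \<open>Vanishes off the open cube and equals 1 at distance at least 1/n from its
    complement (n > 0), hence tends to 1 at every point of \<open>O'\<close>.\<close>
  define \<chi>' where "\<chi>' n x = min 1 (real n * infdist x (- O'))" for n x
  define v where "v n x = \<chi>' n x * max (- B) (min B (g n x))" for n :: nat and x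
  have \<chi>'_cont: "continuous_on UNIV (\<chi>' n)" for n
    unfolding \<chi>'_def by (intro continuous_intros)
  have v_cont: "continuous_on UNIV (v n)" for n
    unfolding v_def by (intro continuous_intros \<chi>'_cont g)
  have v_supp: "v n x = 0" if "\<not> (\<forall>i. 0 < x $ i \<and> x $ i < 2 * pi)" for n x
    using that by (simp add: v_def \<chi>'_def O'_def)
  have [measurable]: "v n \<in> borel_measurable borel" for n
    using v_cont by (rule borel_measurable_continuous_onI)
  have v_le: "\<bar>v n x\<bar> \<le> B" for n x
  proof -
    have "0 \<le> \<chi>' n x" "\<chi>' n x \<le> 1" by (auto simp: \<chi>'_def infdist_nonneg)
    moreover have "\<bar>max (- B) (min B (g n x))\<bar> \<le> B" using \<open>0 \<le> B\<close> by auto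
    ultimately show ?thesis unfolding v_def abs_mult
      by (metis abs_of_nonneg abs_ge_zero mult_left_le_one_le order_trans)
  qed
  have v_lim: "(\<lambda>n. v n x) \<longlonglongrightarrow> H x" if "x \<notin> N" "x \<in> O'" for x
  proof -
    have "(\<lambda>n. max (- B) (min B (g n x))) \<longlonglongrightarrow> max (- B) (min B (H x))"
      by (intro tendsto_intros lim that)
    moreover have "max (- B) (min B (H x)) = H x" using B[of x] by auto
    moreover have "(\<lambda>n. \<chi>' n x) \<longlonglongrightarrow> 1"
    proof -
      have "- O' \<noteq> {}"
        unfolding O'_box using bounded_box not_bounded_UNIV by (metis Compl_empty_eq double_complement)
      then have d: "infdist x (- O') > 0"
        using that(2) by (intro infdist_pos_not_in_closed) (auto simp: O'_box open_box)
      obtain n0 where n0: "1 < real n0 * infdist x (- O')" using reals_Archimedean3[OF d] by blast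
      have "\<chi>' n x = 1" if "n \<ge> n0" for n
      proof -
        have "real n0 * infdist x (- O') \<le> real n * infdist x (- O')"
          using that by (intro mult_right_mono) (auto simp: infdist_nonneg)
        then show ?thesis using n0 by (simp add: \<chi>'_def)
      qed
      then show ?thesis by (intro tendsto_eventually) (auto simp: eventually_sequentially)
    qed
    ultimately show ?thesis unfolding v_def using tendsto_mult by fastforce
  qed
  have AE: "AE x in TM. x \<notin> N \<and> x \<in> O'"
  proof (subst AE_restrict_space_iff)
    have "AE x in lebesgue. x \<notin> N"
      using N by (intro AE_not_in) (simp add: negligible_iff_null_sets)
    then have "AE x in lborel. x \<notin> N" by (simp add: AE_completion_iff)
    moreover have "AE x in lborel. x \<notin> cbox 0 (\<chi> i. 2 * pi) - box 0 ((\<chi> i. 2 * pi) :: real ^ 'n)"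
      by (intro AE_not_in null_sets_cbox_Diff_box)
    ultimately show "AE x in lborel. x \<in> cube (2 * pi) \<longrightarrow> x \<notin> N \<and> x \<in> O'"
      by eventually_elim (auto simp: O'_box mem_box_cart cube_def less_imp_le)
  qed simp
  have "(\<lambda>n. \<integral>\<^sup>+x. ennreal ((H x - v n x)\<^sup>2) \<partial>TM) \<longlonglongrightarrow> (\<integral>\<^sup>+x. ennreal ((H x - H x)\<^sup>2) \<partial>TM)"
  proof (rule nn_integral_dominated_convergence[where w="\<lambda>x. ennreal ((2 * B)\<^sup>2)"])
    show "AE x in TM. ennreal ((H x - v j x)\<^sup>2) \<le> ennreal ((2 * B)\<^sup>2)" for j
    proof (intro AE_I2 ennreal_leI)
      fix x show "(H x - v j x)\<^sup>2 \<le> (2 * B)\<^sup>2"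
        using B[of x] v_le[of j x] by (intro power2_le_iff_abs_le[THEN iffD2]) (auto simp: abs_if split: if_splits)
    qed
    show "(\<integral>\<^sup>+x. ennreal ((2 * B)\<^sup>2) \<partial>(TM :: (real ^ 'n) measure)) < \<infinity>"
      using emeasure_TM[where 'n='n] by (simp add: ennreal_mult_less_top space_restrict_space)
    show "AE x in TM. (\<lambda>n. ennreal ((H x - v n x)\<^sup>2)) \<longlonglongrightarrow> ennreal ((H x - H x)\<^sup>2)"
      using AE by eventually_elim (intro tendsto_intros v_lim; simp)
  qed measurable
  then have "\<forall>\<^sub>F n in sequentially. (\<integral>\<^sup>+x. ennreal ((H x - v n x)\<^sup>2) \<partial>TM) < ennreal (e / 4)"
    using \<open>0 < e\<close> by (intro order_tendstoD(2)) auto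
  then obtain n where n: "(\<integral>\<^sup>+x. ennreal ((H x - v n x)\<^sup>2) \<partial>TM) < ennreal (e / 4)"
    by (auto simp: eventually_sequentially)
  define w where "w = (2 * pi) ^ CARD('n)"
  have w: "w > 0" by (simp add: w_def)
  \<comment> \<open>Chosen so that 2 d^2 w = e / 2; the other half of the error comes from the
    choice of n.\<close>
  define d where "d = sqrt (e / (4 * w))"
  have d: "0 < d" "d\<^sup>2 = e / (4 * w)" using \<open>0 < e\<close> w by (auto simp: d_def)
  obtain P where P: "trig_poly P" "\<And>x. x \<in> cube (2 * pi) \<Longrightarrow> cmod (of_real (v n x) - P x) < d"
    using trig_poly_approx_continuous[OF v_cont v_supp d(1), of n] by blast
  have [measurable]: "P \<in> borel_measurable borel" using P(1) by (rule trig_poly_measurable)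
  show ?thesis
  proof (rule that[OF P(1)])
    have "(\<integral>\<^sup>+x. ennreal ((cmod (of_real (H x) - P x))\<^sup>2) \<partial>TM)
      \<le> (\<integral>\<^sup>+x. ennreal 2 * ennreal ((H x - v n x)\<^sup>2) + ennreal (2 * d\<^sup>2) \<partial>TM)"
    proof (rule nn_integral_mono)
      fix x assume "x \<in> space (TM :: (real ^ 'n) measure)"
      then have "cmod (of_real (v n x) - P x) < d" by (intro P(2)) (simp add: space_restrict_space)
      then have "(cmod (of_real (v n x) - P x))\<^sup>2 \<le> d\<^sup>2" by (intro power_mono) auto
      moreover have "(cmod (of_real (H x) - P x))\<^sup>2 \<le> 2 * (H x - v n x)\<^sup>2 + 2 * (cmod (of_real (v n x) - P x))\<^sup>2"
        using norm_add_square_le[of "of_real (H x - v n x)" "of_real (v n x) - P x"]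
        by (simp only: norm_of_real power2_abs) simp
      ultimately have "(cmod (of_real (H x) - P x))\<^sup>2 \<le> 2 * (H x - v n x)\<^sup>2 + 2 * d\<^sup>2" by simp
      then have "ennreal ((cmod (of_real (H x) - P x))\<^sup>2) \<le> ennreal (2 * (H x - v n x)\<^sup>2 + 2 * d\<^sup>2)"
        by (rule ennreal_leI)
      then show "ennreal ((cmod (of_real (H x) - P x))\<^sup>2) \<le> ennreal 2 * ennreal ((H x - v n x)\<^sup>2) + ennreal (2 * d\<^sup>2)"
        by (simp add: ennreal_mult)
    qed
    also have "\<dots> = ennreal 2 * (\<integral>\<^sup>+x. ennreal ((H x - v n x)\<^sup>2) \<partial>TM) + ennreal (2 * d\<^sup>2) * ennreal w"
      using emeasure_TM[where 'n='n] by (simp add: nn_integral_add nn_integral_cmult w_def space_restrict_space)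
    also have "\<dots> \<le> ennreal 2 * ennreal (e / 4) + ennreal (2 * d\<^sup>2) * ennreal w"
      using n by (intro add_mono mult_left_mono) auto
    also have "\<dots> = ennreal e"
    proof -
      have "ennreal 2 * ennreal (e / 4) + ennreal (2 * d\<^sup>2) * ennreal w = ennreal (2 * (e / 4) + (2 * d\<^sup>2) * w)"
        using w \<open>0 < e\<close> by (simp only: ennreal_mult[symmetric] ennreal_plus[symmetric] mult_nonneg_nonneg zero_le_power2 less_imp_le zero_le_numeral divide_nonneg_nonneg)
      also have "2 * (e / 4) + (2 * d\<^sup>2) * w = e" using d w by simp
      finally show ?thesis .
    qed
    finally show "(\<integral>\<^sup>+x. ennreal ((cmod (of_real (H x) - P x))\<^sup>2) \<partial>TM) \<le> ennreal e" .
  qed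
qed


text \<open>Turns the frame sum over (i, j, k) into an integral for counting measure, to which
  Tonelli's theorem applies.\<close>

lemma has_sum_iff_nn_integral:
  fixes f :: "'a \<Rightarrow> real"
  assumes f: "\<And>k. k \<in> A \<Longrightarrow> 0 \<le> f k" and "0 \<le> r"
  shows "(f has_sum r) A \<longleftrightarrow> (\<integral>\<^sup>+k. ennreal (f k) \<partial>count_space A) = ennreal r"
proof -
  have eq: "(\<integral>\<^sup>+k. ennreal (f k) \<partial>count_space A) = ennreal (infsum f A)" if int: "integrable (count_space A) f"
  proof -
    have "infsetsum f A = infsum f A"
      using int by (intro infsetsum_infsum) (simp add: Infinite_Set_Sum.abs_summable_on_def)
    then show ?thesis using nn_integral_eq_integral[OF int] f
      by (simp add: infsetsum_def AE_count_space)
  qed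
  have summable: "f summable_on A \<longleftrightarrow> integrable (count_space A) f"
  proof -
    have "f summable_on A \<longleftrightarrow> (\<lambda>x. norm (f x)) summable_on A"
      using f by (intro summable_on_cong) auto
    then show ?thesis
      using abs_summable_equivalent[of f A] by (simp add: Infinite_Set_Sum.abs_summable_on_def)
  qed
  show ?thesis
  proof
    assume *: "(f has_sum r) A"
    then have "f summable_on A" "infsum f A = r" by (auto simp: infsumI has_sum_imp_summable)
    then show "(\<integral>\<^sup>+k. ennreal (f k) \<partial>count_space A) = ennreal r" using eq summable by simp
  next
    assume *: "(\<integral>\<^sup>+k. ennreal (f k) \<partial>count_space A) = ennreal r"
    then have int: "integrable (count_space A) f"
      using f by (intro integrableI_nonneg) (auto simp: AE_count_space)
    have "infsum f A \<ge> 0" using f by (rule infsum_nonneg)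
    then have "infsum f A = r" using eq[OF int] * \<open>0 \<le> r\<close> by simp
    then show "(f has_sum r) A" using int summable by (auto simp: has_sum_infsum)
  qed
qed

lemma trig_poly_dense_bounded_complex:
  fixes H :: "real ^ 'n \<Rightarrow> complex"
  assumes H [measurable]: "H \<in> borel_measurable borel" and B: "\<And>x. cmod (H x) \<le> B" and "0 < e"
  obtains P where "trig_poly P" "(\<integral>\<^sup>+x. ennreal ((cmod (H x - P x))\<^sup>2) \<partial>TM) \<le> ennreal e"
proof -
  obtain P where P: "trig_poly P" "(\<integral>\<^sup>+x. ennreal ((cmod (of_real (Re (H x)) - P x))\<^sup>2) \<partial>TM) \<le> ennreal (e / 4)"
    by (rule trig_poly_dense_bounded[of "\<lambda>x. Re (H x)" B "e / 4"])
       (use order_trans[OF abs_Re_le_cmod B] \<open>0 < e\<close> in auto)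
  obtain Q where Q: "trig_poly Q" "(\<integral>\<^sup>+x. ennreal ((cmod (of_real (Im (H x)) - Q x))\<^sup>2) \<partial>TM) \<le> ennreal (e / 4)"
    by (rule trig_poly_dense_bounded[of "\<lambda>x. Im (H x)" B "e / 4"])
       (use order_trans[OF abs_Im_le_cmod B] \<open>0 < e\<close> in auto)
  note [measurable] = trig_poly_measurable[OF P(1)] trig_poly_measurable[OF Q(1)]
  show ?thesis
  proof (rule that)
    show "trig_poly (\<lambda>x. P x + \<i> * Q x)"
      by (intro trig_poly_add trig_poly_mult trig_poly_const P Q)
    have "(\<integral>\<^sup>+x. ennreal ((cmod (H x - (P x + \<i> * Q x)))\<^sup>2) \<partial>TM)
      \<le> (\<integral>\<^sup>+x. ennreal 2 * ennreal ((cmod (of_real (Re (H x)) - P x))\<^sup>2) + ennreal 2 * ennreal ((cmod (of_real (Im (H x)) - Q x))\<^sup>2) \<partial>TM)"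
    proof (rule nn_integral_mono)
      fix x
      have "H x - (P x + \<i> * Q x) = (of_real (Re (H x)) - P x) + \<i> * (of_real (Im (H x)) - Q x)"
        by (simp add: complex_eq_iff)
      then have "cmod (H x - (P x + \<i> * Q x)) = cmod ((of_real (Re (H x)) - P x) + \<i> * (of_real (Im (H x)) - Q x))"
        by (rule arg_cong)
      then have "(cmod (H x - (P x + \<i> * Q x)))\<^sup>2 \<le> 2 * (cmod (of_real (Re (H x)) - P x))\<^sup>2 + 2 * (cmod (of_real (Im (H x)) - Q x))\<^sup>2"
        using norm_add_square_le[of "of_real (Re (H x)) - P x" "\<i> * (of_real (Im (H x)) - Q x)"]
        by (simp add: norm_mult)
      then have "ennreal ((cmod (H x - (P x + \<i> * Q x)))\<^sup>2) \<le> ennreal (2 * (cmod (of_real (Re (H x)) - P x))\<^sup>2 + 2 * (cmod (of_real (Im (H x)) - Q x))\<^sup>2)"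
        by (rule ennreal_leI)
      then show "ennreal ((cmod (H x - (P x + \<i> * Q x)))\<^sup>2) \<le> ennreal 2 * ennreal ((cmod (of_real (Re (H x)) - P x))\<^sup>2) + ennreal 2 * ennreal ((cmod (of_real (Im (H x)) - Q x))\<^sup>2)"
        by (simp add: ennreal_mult)
    qed
    also have "\<dots> = ennreal 2 * (\<integral>\<^sup>+x. ennreal ((cmod (of_real (Re (H x)) - P x))\<^sup>2) \<partial>TM) + ennreal 2 * (\<integral>\<^sup>+x. ennreal ((cmod (of_real (Im (H x)) - Q x))\<^sup>2) \<partial>TM)"
      by (simp add: nn_integral_add nn_integral_cmult)
    also have "\<dots> \<le> ennreal 2 * ennreal (e / 4) + ennreal 2 * ennreal (e / 4)"
      using P Q by (intro add_mono mult_left_mono) auto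
    also have "\<dots> = ennreal (2 * (e / 4) + 2 * (e / 4))"
      using \<open>0 < e\<close> by (simp only: ennreal_mult[symmetric] ennreal_plus[symmetric] mult_nonneg_nonneg less_imp_le zero_le_numeral divide_nonneg_nonneg)
    finally show "(\<integral>\<^sup>+x. ennreal ((cmod (H x - (P x + \<i> * Q x)))\<^sup>2) \<partial>TM) \<le> ennreal e" by simp
  qed
qed

lemma trig_poly_dense:
  fixes H :: "real ^ 'n \<Rightarrow> complex"
  assumes H [measurable]: "H \<in> borel_measurable borel"
    and fin: "(\<integral>\<^sup>+x. ennreal ((cmod (H x))\<^sup>2) \<partial>TM) < \<infinity>" and "0 < e"
  obtains P where "trig_poly P" "(\<integral>\<^sup>+x. ennreal ((cmod (H x - P x))\<^sup>2) \<partial>TM) \<le> ennreal e"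
proof -
  \<comment> \<open>Large values are replaced by 0, so the error is dominated by \<open>H\<close>
    and is eventually 0 at each point.\<close>
  define Hm where "Hm m x = (if cmod (H x) \<le> real m then H x else 0)" for m x
  have [measurable]: "Hm m \<in> borel_measurable borel" for m unfolding Hm_def by measurable
  have "(\<lambda>m. \<integral>\<^sup>+x. ennreal ((cmod (H x - Hm m x))\<^sup>2) \<partial>TM) \<longlonglongrightarrow> (\<integral>\<^sup>+x. 0 \<partial>(TM :: (real ^ 'n) measure))"
  proof (rule nn_integral_dominated_convergence[OF _ _ _ _ fin])
    show "AE x in TM. (\<lambda>m. ennreal ((cmod (H x - Hm m x))\<^sup>2)) \<longlonglongrightarrow> 0"
    proof (rule AE_I2)
      fix x
      obtain m0 where "cmod (H x) \<le> real m0" using real_arch_simple by blast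
      then have "Hm m x = H x" if "m \<ge> m0" for m using that by (auto simp: Hm_def)
      then show "(\<lambda>m. ennreal ((cmod (H x - Hm m x))\<^sup>2)) \<longlonglongrightarrow> 0"
        by (intro tendsto_eventually) (auto simp: eventually_sequentially intro!: exI[of _ m0])
    qed
  qed (auto simp: Hm_def intro!: ennreal_leI)
  then have "\<forall>\<^sub>F m in sequentially. (\<integral>\<^sup>+x. ennreal ((cmod (H x - Hm m x))\<^sup>2) \<partial>TM) < ennreal (e / 4)"
    using \<open>0 < e\<close> by (intro order_tendstoD(2)) auto
  then obtain m where m: "(\<integral>\<^sup>+x. ennreal ((cmod (H x - Hm m x))\<^sup>2) \<partial>TM) < ennreal (e / 4)"
    by (auto simp: eventually_sequentially)
  obtain P where P: "trig_poly P" "(\<integral>\<^sup>+x. ennreal ((cmod (Hm m x - P x))\<^sup>2) \<partial>TM) \<le> ennreal (e / 4)"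
    by (rule trig_poly_dense_bounded_complex[of "Hm m" "real m" "e / 4"]) (use \<open>0 < e\<close> in \<open>auto simp: Hm_def\<close>)
  note [measurable] = trig_poly_measurable[OF P(1)]
  show ?thesis
  proof (rule that[OF P(1)])
    have "(\<integral>\<^sup>+x. ennreal ((cmod (H x - P x))\<^sup>2) \<partial>TM)
      \<le> (\<integral>\<^sup>+x. ennreal 2 * ennreal ((cmod (H x - Hm m x))\<^sup>2) + ennreal 2 * ennreal ((cmod (Hm m x - P x))\<^sup>2) \<partial>TM)"
    proof (rule nn_integral_mono)
      fix x
      have "(cmod (H x - P x))\<^sup>2 \<le> 2 * (cmod (H x - Hm m x))\<^sup>2 + 2 * (cmod (Hm m x - P x))\<^sup>2"
        using norm_add_square_le[of "H x - Hm m x" "Hm m x - P x"] by simp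
      then have "ennreal ((cmod (H x - P x))\<^sup>2) \<le> ennreal (2 * (cmod (H x - Hm m x))\<^sup>2 + 2 * (cmod (Hm m x - P x))\<^sup>2)"
        by (rule ennreal_leI)
      then show "ennreal ((cmod (H x - P x))\<^sup>2) \<le> ennreal 2 * ennreal ((cmod (H x - Hm m x))\<^sup>2) + ennreal 2 * ennreal ((cmod (Hm m x - P x))\<^sup>2)"
        by (simp add: ennreal_mult)
    qed
    also have "\<dots> = ennreal 2 * (\<integral>\<^sup>+x. ennreal ((cmod (H x - Hm m x))\<^sup>2) \<partial>TM) + ennreal 2 * (\<integral>\<^sup>+x. ennreal ((cmod (Hm m x - P x))\<^sup>2) \<partial>TM)"
      by (simp add: nn_integral_add nn_integral_cmult)
    also have "\<dots> \<le> ennreal 2 * ennreal (e / 4) + ennreal 2 * ennreal (e / 4)"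
      using P m by (intro add_mono mult_left_mono) auto
    also have "\<dots> = ennreal (2 * (e / 4) + 2 * (e / 4))"
      using \<open>0 < e\<close> by (simp only: ennreal_mult[symmetric] ennreal_plus[symmetric] mult_nonneg_nonneg less_imp_le zero_le_numeral divide_nonneg_nonneg)
    finally show "(\<integral>\<^sup>+x. ennreal ((cmod (H x - P x))\<^sup>2) \<partial>TM) \<le> ennreal e" by simp
  qed
qed

text \<open>Bessel's inequality bounds the finite partial sums from above. Density of trigonometric
  polynomials supplies finite frequency sets whose sums come arbitrarily close to the bound.\<close>

lemma parseval_torus:
  fixes H :: "real ^ 'n \<Rightarrow> complex"
  assumes H [measurable]: "H \<in> borel_measurable borel"
    and fin: "(\<integral>\<^sup>+x. ennreal ((cmod (H x))\<^sup>2) \<partial>TM) < \<infinity>"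
  shows "(\<integral>\<^sup>+k. ennreal ((cmod (\<integral>x. H x * ek k x \<partial>TM))\<^sup>2) \<partial>count_space UNIV)
    = ennreal ((2 * pi) ^ CARD('n)) * (\<integral>\<^sup>+x. ennreal ((cmod (H x))\<^sup>2) \<partial>TM)"
proof -
  define w :: real where "w = (2 * pi) ^ CARD('n)"
  define c where "c k = (\<integral>x. H x * ek k x \<partial>TM)" for k
  define A where "A = (\<integral>x. (cmod (H x))\<^sup>2 \<partial>TM)"
  have w: "w > 0" by (simp add: w_def)
  have A: "(\<integral>\<^sup>+x. ennreal ((cmod (H x))\<^sup>2) \<partial>TM) = ennreal A" "A \<ge> 0"
    unfolding A_def using integrable_TM_square(1)[OF H fin] by (auto simp: nn_integral_eq_integral)
  note bi = bessel_identity[OF H fin, folded w_def c_def A_def]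
  have upper: "(\<Sum>k\<in>K. (cmod (c k))\<^sup>2) \<le> w * A" if K: "finite K" for K
  proof -
    have "0 \<le> (\<integral>x. (cmod (H x - (\<Sum>k\<in>K. c k / of_real w * ek (- k) x)))\<^sup>2 \<partial>TM)" by simp
    also have "\<dots> = A - (\<Sum>k\<in>K. (cmod (c k))\<^sup>2) / w"
      using bi(1)[OF K, of "\<lambda>k. c k / of_real w"] by simp
    finally show ?thesis using w by (simp add: field_simps)
  qed
  have lower: "\<exists>K. finite K \<and> w * (A - e) \<le> (\<Sum>k\<in>K. (cmod (c k))\<^sup>2)" if "0 < e" for e
  proof -
    obtain P where P: "trig_poly P" "(\<integral>\<^sup>+x. ennreal ((cmod (H x - P x))\<^sup>2) \<partial>TM) \<le> ennreal e"
      using trig_poly_dense[OF H fin \<open>0 < e\<close>] .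
    obtain L h where L: "finite L" "P = (\<lambda>x. \<Sum>k\<in>L. h k * ek k x)" using P(1) by (rule trig_polyE)
    \<comment> \<open>Reflected because \<open>bessel_identity\<close> expands in the conjugate
      exponentials \<open>ek (- k)\<close>.\<close>
    define K where "K = uminus ` L"
    have K: "finite K" using L by (simp add: K_def)
    have PK: "P x = (\<Sum>k\<in>K. h (- k) * ek (- k) x)" for x
      unfolding L(2) K_def by (subst sum.reindex) (auto simp: inj_on_def)
    let ?I = "\<integral>x. (cmod (H x - (\<Sum>k\<in>K. h (- k) * ek (- k) x)))\<^sup>2 \<partial>TM"
    have "ennreal ?I \<le> ennreal e"
      using P(2) nn_integral_eq_integral[OF bi(2)[OF K, of "\<lambda>k. h (- k)"]] unfolding PK by simp
    then have "?I \<le> e" using \<open>0 < e\<close> by simp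
    moreover have "A - (\<Sum>k\<in>K. (cmod (c k))\<^sup>2) / w \<le> ?I"
      using w by (subst bi(1)[OF K]) (simp add: sum_nonneg)
    ultimately have "A - e \<le> (\<Sum>k\<in>K. (cmod (c k))\<^sup>2) / w" by simp
    then have "w * (A - e) \<le> (\<Sum>k\<in>K. (cmod (c k))\<^sup>2)" using w by (simp add: field_simps)
    then show ?thesis using K by blast
  qed
  have summable: "(\<lambda>k. (cmod (c k))\<^sup>2) summable_on UNIV"
    by (rule nonneg_bdd_above_summable_on) (auto intro!: bdd_aboveI[of _ "w * A"] upper)
  have "infsum (\<lambda>k. (cmod (c k))\<^sup>2) UNIV = w * A"
  proof (rule antisym)
    show "infsum (\<lambda>k. (cmod (c k))\<^sup>2) UNIV \<le> w * A"
      by (rule infsum_le_finite_sums[OF summable upper])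
    show "w * A \<le> infsum (\<lambda>k. (cmod (c k))\<^sup>2) UNIV"
    proof (rule field_le_epsilon)
      fix e :: real assume "0 < e"
      then obtain K where K: "finite K" "w * (A - e / w) \<le> (\<Sum>k\<in>K. (cmod (c k))\<^sup>2)"
        using lower[of "e / w"] w by auto
      note K(2)
      also have "(\<Sum>k\<in>K. (cmod (c k))\<^sup>2) \<le> infsum (\<lambda>k. (cmod (c k))\<^sup>2) UNIV"
        by (rule finite_sum_le_infsum[OF summable K(1)]) auto
      finally show "w * A \<le> infsum (\<lambda>k. (cmod (c k))\<^sup>2) UNIV + e"
        using w by (simp add: algebra_simps)
    qed
  qed
  then have "((\<lambda>k. (cmod (c k))\<^sup>2) has_sum (w * A)) UNIV"
    using has_sum_infsum[OF summable] by simp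
  then have "(\<integral>\<^sup>+k. ennreal ((cmod (c k))\<^sup>2) \<partial>count_space UNIV) = ennreal (w * A)"
    by (subst (asm) has_sum_iff_nn_integral) (use w A in auto)
  then show ?thesis using w A by (simp add: c_def w_def ennreal_mult)
qed

section \<open>The Fourier transform on square-integrable functions\<close>

text \<open>The squared norm with value infinity allowed, so that inequalities and limits can be
  stated before integrability is known.\<close>

definition N2 :: "(real ^ 'n \<Rightarrow> complex) \<Rightarrow> ennreal" where
  "N2 f = (\<integral>\<^sup>+x. ennreal ((norm (f x))\<^sup>2) \<partial>lborel)"

lemma square_integrable_iff: "square_integrable f \<longleftrightarrow> f \<in> borel_measurable borel \<and> N2 f < \<infinity>"
  unfolding square_integrable_def N2_def by (auto simp: integrable_iff_bounded)

lemma L2_tendsto_iff: "L2_tendsto h f \<longleftrightarrow> (\<lambda>m. N2 (\<lambda>x. h m x - f x)) \<longlonglongrightarrow> 0"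
  unfolding L2_tendsto_def N2_def ..

lemma square_integrable_measurable [measurable_dest]: "square_integrable f \<Longrightarrow> f \<in> borel_measurable borel"
  by (simp add: square_integrable_iff)

lemma square_integrable_finite: "square_integrable f \<Longrightarrow> N2 f < \<infinity>"
  by (simp add: square_integrable_iff)

text \<open>A substitute for the triangle inequality of the norm that works directly with squared
  norms: where the constant must be sharp, e is sent to 0; where a factor 2 is harmless, e =
  1.\<close>

lemma norm_add_weighted:
  fixes a b :: complex
  assumes "0 < e"
  shows "(norm (a + b))\<^sup>2 \<le> (1 + e) * (norm a)\<^sup>2 + (1 + 1 / e) * (norm b)\<^sup>2"
proof -
  have "(norm (a + b))\<^sup>2 \<le> (norm a + norm b)\<^sup>2" by (intro power_mono norm_triangle_ineq) simp
  also have "\<dots> = (norm a)\<^sup>2 + (norm b)\<^sup>2 + 2 * norm a * norm b" by (simp add: power2_sum)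
  also have "2 * norm a * norm b \<le> e * (norm a)\<^sup>2 + (norm b)\<^sup>2 / e"
  proof -
    have "0 \<le> (e * norm a - norm b)\<^sup>2 / e" using \<open>0 < e\<close> by simp
    then show ?thesis using \<open>0 < e\<close> by (simp add: power2_eq_square field_simps)
  qed
  finally show ?thesis by (simp add: algebra_simps)
qed

lemma N2_weighted:
  assumes [measurable]: "f \<in> borel_measurable borel" "g \<in> borel_measurable borel" and "0 < e"
  shows "N2 (\<lambda>x. f x + g x) \<le> ennreal (1 + e) * N2 f + ennreal (1 + 1 / e) * N2 g"
proof -
  from norm_add_weighted[OF \<open>0 < e\<close>]
  have "N2 (\<lambda>x. f x + g x) \<le> (\<integral>\<^sup>+x. ennreal ((1 + e) * (norm (f x))\<^sup>2 + (1 + 1 / e) * (norm (g x))\<^sup>2) \<partial>lborel)"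
    unfolding N2_def by (intro nn_integral_mono ennreal_leI)
  also have "\<dots> = (\<integral>\<^sup>+x. ennreal (1 + e) * ennreal ((norm (f x))\<^sup>2) + ennreal (1 + 1 / e) * ennreal ((norm (g x))\<^sup>2) \<partial>lborel)"
    using \<open>0 < e\<close> by (intro nn_integral_cong) (simp add: ennreal_plus ennreal_mult del: ennreal_1)
  also have "\<dots> = ennreal (1 + e) * N2 f + ennreal (1 + 1 / e) * N2 g"
    unfolding N2_def by (simp add: nn_integral_add nn_integral_cmult)
  finally show ?thesis .
qed

lemma N2_add:
  assumes "f \<in> borel_measurable borel" "g \<in> borel_measurable borel"
  shows "N2 (\<lambda>x. f x + g x) \<le> 2 * N2 f + 2 * N2 g"
  using N2_weighted[OF assms, of 1] by simp

lemma N2_cmult: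
  assumes [measurable]: "f \<in> borel_measurable borel"
  shows "N2 (\<lambda>x. c * f x) = ennreal ((norm c)\<^sup>2) * N2 f"
  unfolding N2_def by (simp add: norm_mult power_mult_distrib ennreal_mult nn_integral_cmult)

lemma N2_minus_commute: "N2 (\<lambda>x. f x - g x) = N2 (\<lambda>x. g x - f x)"
  unfolding N2_def by (simp add: norm_minus_commute)

lemma N2_affine:
  fixes a :: "real ^ 'n"
  assumes [measurable]: "f \<in> borel_measurable borel" and "c \<noteq> 0"
  shows "N2 f = ennreal (\<bar>c\<bar> ^ CARD('n)) * N2 (\<lambda>x. f (a + c *\<^sub>R x))"
  unfolding N2_def using nn_integral_lborel_affine[of "\<lambda>x. ennreal ((cmod (f x))\<^sup>2)" c a] \<open>c \<noteq> 0\<close>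
  by (simp add: DIM_cart)

lemma square_integrable_add:
  assumes "square_integrable f" "square_integrable g"
  shows "square_integrable (\<lambda>x. f x + g x)"
proof -
  have "N2 (\<lambda>x. f x + g x) \<le> 2 * N2 f + 2 * N2 g"
    using assms by (intro N2_add) (auto simp: square_integrable_iff)
  also have "\<dots> < \<infinity>" using assms by (simp add: square_integrable_iff ennreal_mult_less_top)
  finally show ?thesis using assms by (auto simp: square_integrable_iff)
qed

lemma square_integrable_cmult: "square_integrable f \<Longrightarrow> square_integrable (\<lambda>x. c * f x)"
  by (auto simp: square_integrable_iff N2_cmult ennreal_mult_less_top)

lemma square_integrable_diff:
  "square_integrable f \<Longrightarrow> square_integrable g \<Longrightarrow> square_integrable (\<lambda>x. f x - g x)"
  using square_integrable_add[of f "\<lambda>x. - 1 * g x"] square_integrable_cmult[of g "- 1"] by simp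

lemma square_integrable_le:
  assumes "square_integrable f" "g \<in> borel_measurable borel" "\<And>x. norm (g x) \<le> norm (f x)"
  shows "square_integrable g"
proof -
  have "N2 g \<le> N2 f" unfolding N2_def using assms(3) by (intro nn_integral_mono ennreal_leI power_mono) auto
  then show ?thesis using assms by (auto simp: square_integrable_iff)
qed

lemma square_integrable_affine:
  fixes a :: "real ^ 'n"
  assumes "square_integrable f" "c \<noteq> 0"
  shows "square_integrable (\<lambda>x. f (a + c *\<^sub>R x))"
proof -
  have "ennreal (\<bar>c\<bar> ^ CARD('n)) * N2 (\<lambda>x. f (a + c *\<^sub>R x)) < \<infinity>"
    using N2_affine[of f c a] assms by (simp add: square_integrable_iff)
  then have "N2 (\<lambda>x. f (a + c *\<^sub>R x)) < \<infinity>"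
    using \<open>c \<noteq> 0\<close> by (auto simp: ennreal_mult_less_top)
  then show ?thesis using assms by (auto simp: square_integrable_iff)
qed

text \<open>Norm bounds pass to mean-square limits with the same constant: the weighted inequality
  is applied to both sequences at the cost of (1 + e)^2, and e tends to 0. Used in both directions
  it transports Plancherel's identity.\<close>

lemma N2_limit_le:
  assumes m: "\<And>m. h m \<in> borel_measurable borel" "\<And>m. h' m \<in> borel_measurable borel"
      "f \<in> borel_measurable borel" "f' \<in> borel_measurable borel"
    and lim: "L2_tendsto h f" "L2_tendsto h' f'"
    and le: "\<And>m. N2 (h' m) \<le> ennreal C * N2 (h m)" and "N2 f < \<infinity>" "0 \<le> C"
  shows "N2 f' \<le> ennreal C * N2 f"
proof -
  obtain a where a: "N2 f = ennreal a" "0 \<le> a" using \<open>N2 f < \<infinity>\<close> by (cases "N2 f") auto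
  have "N2 f' \<le> ennreal ((1 + e)\<^sup>2 * (C * a))" if "0 < e" for e
  proof -
    have step: "N2 f' \<le> ennreal (1 + e) * (ennreal C * (ennreal (1 + e) * N2 f + ennreal (1 + 1 / e) * N2 (\<lambda>x. h m x - f x)))
        + ennreal (1 + 1 / e) * N2 (\<lambda>x. h' m x - f' x)" for m
    proof -
      have "N2 f' \<le> ennreal (1 + e) * N2 (h' m) + ennreal (1 + 1 / e) * N2 (\<lambda>x. f' x - h' m x)"
        using N2_weighted[of "h' m" "\<lambda>x. f' x - h' m x" e] m \<open>0 < e\<close> by simp
      also have "N2 (h' m) \<le> ennreal C * N2 (h m)" by (rule le)
      also have "N2 (h m) \<le> ennreal (1 + e) * N2 f + ennreal (1 + 1 / e) * N2 (\<lambda>x. h m x - f x)"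
        using N2_weighted[of f "\<lambda>x. h m x - f x" e] m \<open>0 < e\<close> by simp
      finally show ?thesis
        by (simp add: N2_minus_commute mult_left_mono add_mono)
    qed
    have "(\<lambda>m. ennreal (1 + e) * (ennreal C * (ennreal (1 + e) * N2 f + ennreal (1 + 1 / e) * N2 (\<lambda>x. h m x - f x)))
        + ennreal (1 + 1 / e) * N2 (\<lambda>x. h' m x - f' x))
      \<longlonglongrightarrow> ennreal (1 + e) * (ennreal C * (ennreal (1 + e) * N2 f + ennreal (1 + 1 / e) * 0)) + ennreal (1 + 1 / e) * 0"
      using lim unfolding L2_tendsto_iff
      by (intro tendsto_add tendsto_const ennreal_tendsto_cmult) auto
    then have "N2 f' \<le> ennreal (1 + e) * (ennreal C * (ennreal (1 + e) * N2 f + ennreal (1 + 1 / e) * 0)) + ennreal (1 + 1 / e) * 0"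
      by (rule LIMSEQ_le_const) (use step in blast)
    also have "\<dots> = ennreal ((1 + e)\<^sup>2 * (C * a))"
    proof -
      have "ennreal b * (ennreal C * (ennreal b * ennreal a)) = ennreal (b\<^sup>2 * (C * a))" if "0 \<le> b" for b
        using that \<open>0 \<le> C\<close> a(2) by (simp add: ennreal_mult[symmetric] power2_eq_square mult_ac)
      from this[of "1 + e"] show ?thesis using \<open>0 < e\<close> a(1) by (simp del: ennreal_plus)
    qed
    finally show ?thesis .
  qed note bound = this
  have "N2 f' \<le> ennreal (1\<^sup>2 * (C * a))"
  proof (rule LIMSEQ_le_const)
    have "(\<lambda>n. (1 + 1 / real (Suc n))\<^sup>2 * (C * a)) \<longlonglongrightarrow> (1 + 0)\<^sup>2 * (C * a)"
      by (intro tendsto_intros LIMSEQ_Suc lim_1_over_n)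
    then show "(\<lambda>n. ennreal ((1 + 1 / real (Suc n))\<^sup>2 * (C * a))) \<longlonglongrightarrow> ennreal (1\<^sup>2 * (C * a))"
      by (intro tendsto_ennrealI) simp
    show "\<exists>N. \<forall>n\<ge>N. N2 f' \<le> ennreal ((1 + 1 / real (Suc n))\<^sup>2 * (C * a))"
      using bound by (intro exI[of _ 0] allI impI) simp
  qed
  then show ?thesis using a \<open>0 \<le> C\<close> by (simp add: ennreal_mult)
qed

section \<open>Completeness of the space of square-integrable functions\<close>

lemma L2_tendsto_Cauchy:
  assumes m: "\<And>m. h m \<in> borel_measurable borel" "f \<in> borel_measurable borel"
    and lim: "L2_tendsto h f" and "0 < e"
  shows "\<exists>M. \<forall>m\<ge>M. \<forall>n\<ge>M. N2 (\<lambda>x. h m x - h n x) \<le> ennreal e"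
proof -
  have "\<forall>\<^sub>F m in sequentially. N2 (\<lambda>x. h m x - f x) < ennreal (e / 4)"
    using lim \<open>0 < e\<close> unfolding L2_tendsto_iff by (intro order_tendstoD(2)) auto
  then obtain M where M: "\<And>m. m \<ge> M \<Longrightarrow> N2 (\<lambda>x. h m x - f x) < ennreal (e / 4)"
    by (auto simp: eventually_sequentially)
  have "N2 (\<lambda>x. h m x - h n x) \<le> ennreal e" if "m \<ge> M" "n \<ge> M" for m n
  proof -
    have "N2 (\<lambda>x. h m x - h n x) \<le> 2 * N2 (\<lambda>x. h m x - f x) + 2 * N2 (\<lambda>x. f x - h n x)"
      using N2_add[of "\<lambda>x. h m x - f x" "\<lambda>x. f x - h n x"] m by simp
    also have "\<dots> \<le> 2 * ennreal (e / 4) + 2 * ennreal (e / 4)"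
      using M[OF that(1)] M[OF that(2)] by (intro add_mono mult_left_mono) (auto simp: N2_minus_commute)
    also have "\<dots> = ennreal 2 * ennreal (e / 4) + ennreal 2 * ennreal (e / 4)" by simp
    also have "\<dots> = ennreal (2 * (e / 4) + 2 * (e / 4))"
      using \<open>0 < e\<close> by (simp only: ennreal_mult[symmetric] ennreal_plus[symmetric] mult_nonneg_nonneg less_imp_le zero_le_numeral divide_nonneg_nonneg)
    finally show ?thesis by simp
  qed
  then show ?thesis by blast
qed

lemma ennreal_finiteE:
  assumes "x \<noteq> \<infinity>"
  obtains C where "x = ennreal C" "0 \<le> C"
  using assms by (cases x) auto

lemma ennreal_le_suminf: "f k \<le> (\<Sum>k. f k :: ennreal)"
  using sum_le_suminf[of f "{k}"] by simp

text \<open>Riesz-Fischer. Along a subsequence the squared norms of the increments are at most 4^-k.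
  The weights 2^k keep the weighted sum of squares integrable, so almost everywhere the increments
  are bounded by a multiple of 2^(-k/2) and the subsequence converges pointwise.\<close>

lemma L2_complete:
  fixes h :: "nat \<Rightarrow> real ^ 'n \<Rightarrow> complex"
  assumes h: "\<And>m. square_integrable (h m)"
    and Cauchy: "\<And>e. 0 < e \<Longrightarrow> \<exists>M. \<forall>m\<ge>M. \<forall>n\<ge>M. N2 (\<lambda>x. h m x - h n x) \<le> ennreal e"
  obtains f where "square_integrable f" "L2_tendsto h f"
proof -
  note [measurable] = square_integrable_measurable[OF h]
  have "\<exists>M. \<forall>k. \<forall>m\<ge>M k. \<forall>n\<ge>M k. N2 (\<lambda>x. h m x - h n x) \<le> ennreal ((1 / 4) ^ k)"
    by (intro choice allI Cauchy) simp
  then obtain M where M: "\<And>k m n. m \<ge> M k \<Longrightarrow> n \<ge> M k \<Longrightarrow> N2 (\<lambda>x. h m x - h n x) \<le> ennreal ((1 / 4) ^ k)"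
    by blast
  \<comment> \<open>The partial sums make r nondecreasing with r k \<ge> \<open>M k\<close>; the
    added k sends it to infinity.\<close>
  define r where "r k = k + (\<Sum>i\<le>k. M i)" for k
  have r_ge: "M k \<le> r k" "k \<le> r k" "r k \<le> r (Suc k)" for k
    unfolding r_def using member_le_sum[of k "{..k}" M] by auto
  define d where "d k x = h (r (Suc k)) x - h (r k) x" for k x
  have N2_d: "N2 (d k) \<le> ennreal ((1 / 4) ^ k)" for k
    unfolding d_def using r_ge[of k] by (intro M) auto
  have [measurable]: "d k \<in> borel_measurable borel" for k unfolding d_def by measurable
  have "(\<integral>\<^sup>+x. (\<Sum>k. ennreal (2 ^ k * (cmod (d k x))\<^sup>2)) \<partial>lborel) = (\<Sum>k. ennreal (2 ^ k) * N2 (d k))"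
    unfolding N2_def by (simp add: nn_integral_suminf ennreal_mult nn_integral_cmult)
  also have "\<dots> \<le> (\<Sum>k. ennreal (2 ^ k) * ennreal ((1 / 4) ^ k))"
    by (intro suminf_le mult_left_mono N2_d) auto
  also have "\<dots> = (\<Sum>k. ennreal ((1 / 2) ^ k))"
    by (intro suminf_cong) (simp add: ennreal_mult[symmetric] power_mult_distrib[symmetric] del: ennreal_power)
  also have "\<dots> < \<infinity>"
    by (subst suminf_ennreal2) auto
  finally have fin: "(\<integral>\<^sup>+x. (\<Sum>k. ennreal (2 ^ k * (cmod (d k x))\<^sup>2)) \<partial>lborel) < \<infinity>" .
  have "AE x in lborel. (\<Sum>k. ennreal (2 ^ k * (cmod (d k x))\<^sup>2)) \<noteq> \<infinity>"
  proof (rule nn_integral_PInf_AE)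
    show "(\<lambda>x. \<Sum>k. ennreal (2 ^ k * (cmod (d k x))\<^sup>2)) \<in> borel_measurable lborel" by measurable
    show "(\<integral>\<^sup>+x. (\<Sum>k. ennreal (2 ^ k * (cmod (d k x))\<^sup>2)) \<partial>lborel) \<noteq> \<infinity>"
      using fin by (rule less_imp_neq)
  qed
  then have conv: "AE x in lborel. convergent (\<lambda>k. h (r k) x)"
  proof eventually_elim
    case (elim x)
    then obtain C where C: "(\<Sum>k. ennreal (2 ^ k * (cmod (d k x))\<^sup>2)) = ennreal C" "0 \<le> C"
      by (rule ennreal_finiteE)
    have "cmod (d k x) \<le> sqrt C * (1 / sqrt 2) ^ k" for k
    proof -
      have "ennreal (2 ^ k * (cmod (d k x))\<^sup>2) \<le> ennreal C"
        unfolding C(1)[symmetric] by (rule ennreal_le_suminf)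
      then have "2 ^ k * (cmod (d k x))\<^sup>2 \<le> C" using C(2) by simp
      then have "(cmod (d k x))\<^sup>2 \<le> C * (1 / 2) ^ k" by (simp add: field_simps power_divide)
      also have "\<dots> = (sqrt C * (1 / sqrt 2) ^ k)\<^sup>2"
      proof -
        have "((1 / sqrt 2) ^ k)\<^sup>2 = ((1 / sqrt 2)\<^sup>2) ^ k"
          by (simp only: power2_eq_square power_mult_distrib)
        moreover have "(1 / sqrt 2)\<^sup>2 = 1 / 2" by (simp add: power2_eq_square)
        moreover have "(sqrt C)\<^sup>2 = C" using C(2) by simp
        ultimately show ?thesis by (simp only: power_mult_distrib[of "sqrt C"])
      qed
      finally show ?thesis by (rule power2_le_imp_le) (use C(2) in simp)
    qed
    moreover have "summable (\<lambda>k. sqrt C * (1 / sqrt 2) ^ k)"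
    proof (rule summable_mult[OF summable_geometric])
      have "0 < sqrt (2::real)" "1 < sqrt (2::real)" by simp_all
      then show "norm (1 / sqrt 2) < 1" unfolding real_norm_def abs_divide by (simp only: abs_of_pos divide_less_eq_1_pos abs_one)
    qed
    ultimately have "summable (\<lambda>k. d k x)"
      using summable_comparison_test'[of "\<lambda>k. sqrt C * (1 / sqrt 2) ^ k" 0 "\<lambda>k. d k x"] by blast
    then have "convergent (\<lambda>n. \<Sum>k<n. d k x)" by (simp add: summable_iff_convergent)
    then have "convergent (\<lambda>n. h (r 0) x + (\<Sum>k<n. d k x))" by (intro convergent_add convergent_const)
    moreover have "h (r 0) x + (\<Sum>k<n. d k x) = h (r n) x" for n
    proof (induction n)
      case (Suc n)
      have "h (r 0) x + (\<Sum>k<Suc n. d k x) = (h (r 0) x + (\<Sum>k<n. d k x)) + d n x" by simp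
      also have "\<dots> = h (r (Suc n)) x" unfolding Suc by (simp add: d_def)
      finally show ?case .
    qed simp
    ultimately show ?case by simp
  qed
  define f where "f x = lim (\<lambda>k. h (r k) x)" for x
  have [measurable]: "f \<in> borel_measurable borel" unfolding f_def by measurable
  have AE_lim: "AE x in lborel. (\<lambda>k. h (r k) x) \<longlonglongrightarrow> f x"
    using conv by eventually_elim (simp add: f_def convergent_LIMSEQ_iff)
  have bound: "\<exists>M. \<forall>m\<ge>M. N2 (\<lambda>x. h m x - f x) \<le> ennreal e" if "0 < e" for e
  proof -
    obtain M0 where M0: "\<And>m n. m \<ge> M0 \<Longrightarrow> n \<ge> M0 \<Longrightarrow> N2 (\<lambda>x. h m x - h n x) \<le> ennreal e"
      using Cauchy[OF \<open>0 < e\<close>] by blast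
    have "N2 (\<lambda>x. h m x - f x) \<le> ennreal e" if "m \<ge> M0" for m
    proof -
      \<comment> \<open>Fatou's lemma along the subsequence turns the Cauchy bound into a bound on h
        m - f, for the full sequence.\<close>
      have "N2 (\<lambda>x. h m x - f x) = (\<integral>\<^sup>+x. liminf (\<lambda>k. ennreal ((cmod (h m x - h (r k) x))\<^sup>2)) \<partial>lborel)"
        unfolding N2_def
      proof (rule nn_integral_cong_AE, use AE_lim in eventually_elim)
        case (elim x)
        have "(\<lambda>k. ennreal ((cmod (h m x - h (r k) x))\<^sup>2)) \<longlonglongrightarrow> ennreal ((cmod (h m x - f x))\<^sup>2)"
          by (intro tendsto_intros elim)
        from lim_imp_Liminf[OF _ this] show ?case by simp
      qed
      also have "\<dots> \<le> liminf (\<lambda>k. N2 (\<lambda>x. h m x - h (r k) x))"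
        unfolding N2_def by (rule nn_integral_liminf) measurable
      also have "\<dots> \<le> ennreal e"
      proof (rule Liminf_le)
        show "sequentially \<noteq> bot" by simp
        show "\<forall>\<^sub>F k in sequentially. N2 (\<lambda>x. h m x - h (r k) x) \<le> ennreal e"
          unfolding eventually_sequentially
          using M0[OF that] r_ge(2) by (meson le_trans)
      qed
      finally show ?thesis .
    qed
    then show ?thesis by blast
  qed
  have "L2_tendsto h f"
    unfolding L2_tendsto_iff
  proof (rule order_tendstoI)
    fix e :: ennreal assume "0 < e"
    then obtain y where "0 < y" "y < e" using dense[OF \<open>0 < e\<close>] by blast
    then obtain e' where e': "0 < e'" "ennreal e' < e" by (cases y) auto
    show "\<forall>\<^sub>F m in sequentially. N2 (\<lambda>x. h m x - f x) < e"
    proof -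
      obtain M1 where "\<And>m. m \<ge> M1 \<Longrightarrow> N2 (\<lambda>x. h m x - f x) \<le> ennreal e'"
        using bound[OF e'(1)] by blast
      then show ?thesis unfolding eventually_sequentially
        using le_less_trans[OF _ e'(2)] by blast
    qed
  qed (use not_less_zero in blast)
  moreover have "square_integrable f"
  proof -
    obtain M1 where "N2 (\<lambda>x. h M1 x - f x) \<le> ennreal 1" using bound[of 1] by auto
    then have "N2 (\<lambda>x. h M1 x - f x) < \<infinity>" by (rule le_less_trans) simp
    moreover have "(\<lambda>x. h M1 x - f x) \<in> borel_measurable borel" by measurable
    ultimately have "square_integrable (\<lambda>x. h M1 x - f x)"
      unfolding square_integrable_iff by blast
    from square_integrable_diff[OF h[of M1] this] show ?thesis by simp
  qed
  ultimately show ?thesis using that by blast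
qed

section \<open>Plancherel's identity for functions that are integrable and square integrable\<close>

lemma fourier_kernel_measurable [measurable]:
  "(\<lambda>z. cis (- (fst z \<bullet> snd z))) \<in> borel_measurable (borel \<Otimes>\<^sub>M borel :: ((real ^ 'n) \<times> (real ^ 'n)) measure)"
  unfolding borel_prod
  by (intro borel_measurable_continuous_onI continuous_intros continuous_on_compose2[OF continuous_on_cis[OF continuous_on_id]]) auto

lemma cnj_measurable [measurable (raw)]:
  "f \<in> borel_measurable M \<Longrightarrow> (\<lambda>x. cnj (f x)) \<in> borel_measurable M"
  by (rule measurable_compose[where g=cnj]) (auto intro: borel_measurable_continuous_onI continuous_on_cnj continuous_on_id)

lemma cis_inner_measurable [measurable]:
  fixes f g :: "'a \<Rightarrow> real ^ 'n"
  assumes [measurable]: "f \<in> borel_measurable M" "g \<in> borel_measurable M"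
  shows "(\<lambda>x. cis (- (f x \<bullet> g x))) \<in> borel_measurable M" "(\<lambda>x. cis (f x \<bullet> g x)) \<in> borel_measurable M"
proof -
  have 1: "(\<lambda>x. cis (- (f x \<bullet> g x))) \<in> borel_measurable M" if [measurable]: "f \<in> borel_measurable M" for f
    using measurable_compose[OF measurable_Pair[of f M borel g borel] fourier_kernel_measurable] by simp
  show "(\<lambda>x. cis (- (f x \<bullet> g x))) \<in> borel_measurable M" by (rule 1) measurable
  show "(\<lambda>x. cis (f x \<bullet> g x)) \<in> borel_measurable M"
    using 1[of "\<lambda>x. - f x"] by simp
qed

lemma fourier_integral_measurable [measurable]:
  fixes f :: "real ^ 'n \<Rightarrow> complex"
  assumes [measurable]: "f \<in> borel_measurable borel"
  shows "fourier_integral f \<in> borel_measurable borel"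
  unfolding fourier_integral_def by measurable

lemma integrable_mult_cis:
  fixes f :: "real ^ 'n \<Rightarrow> complex"
  assumes "integrable lborel f"
  shows "integrable lborel (\<lambda>x. f x * cis (- (x \<bullet> \<xi>)))"
proof -
  have [measurable]: "f \<in> borel_measurable borel" using assms by auto
  show ?thesis by (rule Bochner_Integration.integrable_bound[OF assms]) (auto simp: norm_mult)
qed

lemma fourier_integral_diff:
  assumes "integrable lborel f" "integrable lborel g"
  shows "fourier_integral (\<lambda>x. f x - g x) \<xi> = fourier_integral f \<xi> - fourier_integral g \<xi>"
  unfolding fourier_integral_def
  by (simp add: left_diff_distrib Bochner_Integration.integral_diff integrable_mult_cis assms)

lemma fourier_integral_add_cmult:
  assumes "integrable lborel f" "integrable lborel g"
  shows "fourier_integral (\<lambda>x. f x + c * g x) \<xi> = fourier_integral f \<xi> + c * fourier_integral g \<xi>"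
  unfolding fourier_integral_def
  by (simp add: distrib_right mult.assoc Bochner_Integration.integral_add integrable_mult_cis assms)

lemma fourier_integral_affine:
  fixes f :: "real ^ 'n \<Rightarrow> complex"
  assumes [measurable]: "f \<in> borel_measurable borel" and c: "c \<noteq> 0"
  shows "fourier_integral (\<lambda>x. f (a + c *\<^sub>R x)) \<xi>
    = of_real (1 / \<bar>c\<bar> ^ CARD('n)) * cis ((a \<bullet> \<xi>) / c) * fourier_integral f ((1 / c) *\<^sub>R \<xi>)"
proof -
  have "fourier_integral f ((1 / c) *\<^sub>R \<xi>) = of_real (\<bar>c\<bar> ^ DIM(real ^ 'n)) *
      (\<integral>x. f (a + c *\<^sub>R x) * cis (- ((a + c *\<^sub>R x) \<bullet> ((1 / c) *\<^sub>R \<xi>))) \<partial>lborel)"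
    unfolding fourier_integral_def by (rule integral_lborel_affine[OF _ c]) measurable
  also have "(\<lambda>x. f (a + c *\<^sub>R x) * cis (- ((a + c *\<^sub>R x) \<bullet> ((1 / c) *\<^sub>R \<xi>))))
      = (\<lambda>x. cis (- ((a \<bullet> \<xi>) / c)) * (f (a + c *\<^sub>R x) * cis (- (x \<bullet> \<xi>))))"
    using c by (auto simp: fun_eq_iff inner_add_left cis_mult add_divide_distrib)
  also have "(\<integral>x. cis (- ((a \<bullet> \<xi>) / c)) * (f (a + c *\<^sub>R x) * cis (- (x \<bullet> \<xi>))) \<partial>lborel)
     = cis (- ((a \<bullet> \<xi>) / c)) * fourier_integral (\<lambda>x. f (a + c *\<^sub>R x)) \<xi>"
    by (simp add: fourier_integral_def)
  finally have "fourier_integral f ((1 / c) *\<^sub>R \<xi>) = of_real (\<bar>c\<bar> ^ CARD('n)) *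
      (cis (- ((a \<bullet> \<xi>) / c)) * fourier_integral (\<lambda>x. f (a + c *\<^sub>R x)) \<xi>)"
    by (simp add: DIM_cart)
  moreover have "cis ((a \<bullet> \<xi>) / c) * cis (- ((a \<bullet> \<xi>) / c)) = 1" by (simp add: cis_mult)
  ultimately show ?thesis using c by (simp add: field_simps)
qed

text \<open>For functions supported in the cube, the values of the transform along a translate of the
  integer lattice are Fourier coefficients; averaging over all translates gives Plancherel's
  identity.\<close>

lemma plancherel_cube:
  fixes f :: "real ^ 'n \<Rightarrow> complex"
  assumes f: "square_integrable f" and supp: "\<And>x. x \<notin> cube (2 * pi) \<Longrightarrow> f x = 0"
  shows "N2 (fourier_integral f) = ennreal ((2 * pi) ^ CARD('n)) * N2 f"
proof -
  note [measurable] = square_integrable_measurable[OF f]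
  let ?g = "\<lambda>\<theta> x. f x * cis (- (x \<bullet> \<theta>))"
  have N2: "(\<integral>\<^sup>+x. ennreal ((cmod (?g \<theta> x))\<^sup>2) \<partial>TM) = N2 f" for \<theta>
    unfolding N2_def nn_integral_TM
    by (intro nn_integral_cong) (use supp in \<open>auto simp: norm_mult indicator_def\<close>)
  have shift: "fourier_integral f (\<theta> + 1 *\<^sub>R int_vec k) = (\<integral>x. ?g \<theta> x * ek k x \<partial>TM)" for \<theta> k
    unfolding fourier_integral_def integral_TM
    by (intro Bochner_Integration.integral_cong)
       (use supp in \<open>auto simp: indicator_def ek_def cis_mult inner_add_right inner_commute\<close>)
  have "N2 (fourier_integral f) = (\<integral>\<^sup>+\<theta>\<in>cube 1. (\<integral>\<^sup>+k. ennreal ((cmod (fourier_integral f (\<theta> + 1 *\<^sub>R int_vec k)))\<^sup>2) \<partial>count_space UNIV) \<partial>lborel)"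
    unfolding N2_def by (rule nn_integral_tile[OF fundamental_domain_cube0]) simp_all
  also have "\<dots> = (\<integral>\<^sup>+\<theta>\<in>cube 1. (ennreal ((2 * pi) ^ CARD('n)) * N2 f) \<partial>(lborel :: (real ^ 'n) measure))"
  proof (intro nn_integral_cong)
    fix \<theta> :: "real ^ 'n"
    have "(\<integral>\<^sup>+k. ennreal ((cmod (\<integral>x. ?g \<theta> x * ek k x \<partial>TM))\<^sup>2) \<partial>count_space UNIV) = ennreal ((2 * pi) ^ CARD('n)) * N2 f"
      using parseval_torus[of "?g \<theta>"] N2[of \<theta>] square_integrable_finite[OF f] by simp
    then show "(\<integral>\<^sup>+k. ennreal ((cmod (fourier_integral f (\<theta> + 1 *\<^sub>R int_vec k)))\<^sup>2) \<partial>count_space UNIV) * indicator (cube 1) \<theta>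
      = ennreal ((2 * pi) ^ CARD('n)) * N2 f * indicator (cube 1) \<theta>"
      by (simp only: shift)
  qed
  also have "\<dots> = ennreal ((2 * pi) ^ CARD('n)) * N2 f"
    by (simp add: nn_integral_cmult_indicator emeasure_cube)
  finally show ?thesis .
qed

lemma plancherel_bounded_support:
  fixes f :: "real ^ 'n \<Rightarrow> complex"
  assumes f: "square_integrable f" and supp: "\<And>x. norm x > R \<Longrightarrow> f x = 0" and "0 \<le> R"
  shows "N2 (fourier_integral f) = ennreal ((2 * pi) ^ CARD('n)) * N2 f"
proof -
  note [measurable] = square_integrable_measurable[OF f]
  \<comment> \<open>The map x to a + c x carries the cube of side 2 pi onto the cube with corner
    (-R, ..., -R) and side 2 R + 2, which contains the ball of radius R; the added 1 keeps the ball
    off the missing upper faces.\<close>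
  define c where "c = (R + 1) / pi"
  define a :: "real ^ 'n" where "a = (\<chi> i. - R)"
  have c: "c > 0" using \<open>0 \<le> R\<close> by (simp add: c_def)
  let ?n = "CARD('n)"
  define g where "g x = f (a + c *\<^sub>R x)" for x
  have g: "square_integrable g" unfolding g_def using f c by (intro square_integrable_affine) auto
  note [measurable] = square_integrable_measurable[OF g]
  have "N2 (fourier_integral g) = ennreal ((2 * pi) ^ ?n) * N2 g"
  proof (rule plancherel_cube[OF g])
    fix x :: "real ^ 'n" assume x: "x \<notin> cube (2 * pi)"
    show "g x = 0" unfolding g_def
    proof (rule supp, rule ccontr)
      assume "\<not> norm (a + c *\<^sub>R x) > R"
      then have "\<bar>(a + c *\<^sub>R x) $ i\<bar> \<le> R" for i
        using component_le_norm_cart[of "a + c *\<^sub>R x" i] by linarith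
      then have *: "0 \<le> c * x $ i" "c * x $ i \<le> 2 * R" for i
        by (auto simp: a_def abs_le_iff dest: spec[of _ i] intro: minus_le_iff[THEN iffD1])
      have "0 \<le> x $ i" "x $ i < 2 * pi" for i
      proof -
        show "0 \<le> x $ i" using *(1)[of i] c by (simp add: zero_le_mult_iff)
        have "c * x $ i < c * (2 * pi)" using *(2)[of i] by (simp add: c_def)
        then show "x $ i < 2 * pi" using c by simp
      qed
      then show False using x by (simp add: cube_def)
    qed
  qed
  moreover have "N2 f = ennreal (c ^ ?n) * N2 g"
    unfolding g_def using N2_affine[of f c a] c by simp
  moreover have "N2 (fourier_integral f) = ennreal (c ^ ?n) * N2 (fourier_integral g)"
  proof -
    have "fourier_integral g = (\<lambda>\<xi>. of_real (1 / c ^ ?n) * cis ((a \<bullet> \<xi>) / c) * fourier_integral f ((1 / c) *\<^sub>R \<xi>))"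
      unfolding g_def using c by (intro ext) (subst fourier_integral_affine, auto)
    then have "N2 (fourier_integral g) = N2 (\<lambda>\<xi>. of_real (1 / c ^ ?n) * fourier_integral f (0 + (1 / c) *\<^sub>R \<xi>))"
      unfolding N2_def by (simp add: norm_mult norm_divide)
    also have "\<dots> = ennreal ((1 / c ^ ?n)\<^sup>2) * N2 (\<lambda>\<xi>. fourier_integral f (0 + (1 / c) *\<^sub>R \<xi>))"
      using c by (subst N2_cmult) (simp_all add: norm_divide norm_power)
    finally have 1: "N2 (fourier_integral g) = ennreal ((1 / c ^ ?n)\<^sup>2) * N2 (\<lambda>\<xi>. fourier_integral f (0 + (1 / c) *\<^sub>R \<xi>))" .
    have "N2 (fourier_integral f) = ennreal ((1 / c) ^ ?n) * N2 (\<lambda>\<xi>. fourier_integral f (0 + (1 / c) *\<^sub>R \<xi>))"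
      using N2_affine[of "fourier_integral f" "1 / c" 0] c by simp
    also have "ennreal ((1 / c) ^ ?n) = ennreal (c ^ ?n) * ennreal ((1 / c ^ ?n)\<^sup>2)"
      using c by (subst ennreal_mult[symmetric]) (auto simp: power2_eq_square power_divide)
    finally show ?thesis by (simp add: 1 mult.assoc)
  qed
  ultimately show ?thesis by (simp add: mult_ac)
qed

definition trunc :: "real \<Rightarrow> (real ^ 'n \<Rightarrow> complex) \<Rightarrow> real ^ 'n \<Rightarrow> complex" where
  "trunc R f x = (if norm x \<le> R then f x else 0)"

lemma trunc_eventually: "\<forall>\<^sub>F m in sequentially. trunc (real m) f x = f x"
proof -
  obtain m0 where "norm x \<le> real m0" using real_arch_simple by blast
  then show ?thesis
    by (auto simp: eventually_sequentially trunc_def intro!: exI[of _ m0])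
qed

lemma trunc_measurable [measurable]:
  assumes [measurable]: "f \<in> borel_measurable borel"
  shows "trunc R f \<in> borel_measurable borel"
  unfolding trunc_def[abs_def] by measurable

lemma norm_trunc_le: "norm (trunc R f x) \<le> norm (f x)"
  by (simp add: trunc_def)

lemma square_integrable_trunc: "square_integrable f \<Longrightarrow> square_integrable (trunc R f)"
  using square_integrable_le[OF _ trunc_measurable[OF square_integrable_measurable] norm_trunc_le] by blast

lemma integrable_trunc:
  fixes f :: "real ^ 'n \<Rightarrow> complex"
  assumes f: "square_integrable f"
  shows "integrable lborel (trunc R f)"
proof -
  note [measurable] = square_integrable_measurable[OF f]
  have "integrable lborel (\<lambda>x. indicator (cball 0 R) x + (norm (f x))\<^sup>2 :: real)"
    using f emeasure_lborel_cball_finite[of "0 :: real ^ 'n" R] unfolding square_integrable_def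
    by (intro Bochner_Integration.integrable_add integrable_real_indicator) auto
  then show ?thesis
  proof (rule Bochner_Integration.integrable_bound)
    have "t \<le> 1 + t\<^sup>2" for t :: real
      using zero_le_power2[of "t - 1 / 2"] by (simp add: power2_eq_square field_simps)
    then show "AE x in lborel. norm (trunc R f x) \<le> norm (indicator (cball 0 R) x + (norm (f x))\<^sup>2 :: real)"
      by (auto simp: trunc_def)
  qed measurable
qed

lemma L2_tendsto_trunc:
  fixes f :: "real ^ 'n \<Rightarrow> complex"
  assumes f: "square_integrable f"
  shows "L2_tendsto (\<lambda>m. trunc (real m) f) f"
proof -
  note [measurable] = square_integrable_measurable[OF f]
  have "(\<lambda>m. \<integral>\<^sup>+x. ennreal ((cmod (trunc (real m) f x - f x))\<^sup>2) \<partial>lborel) \<longlonglongrightarrow> (\<integral>\<^sup>+x. 0 \<partial>(lborel :: (real ^ 'n) measure))"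
  proof (rule nn_integral_dominated_convergence)
    show "(\<integral>\<^sup>+x. ennreal ((cmod (f x))\<^sup>2) \<partial>lborel) < \<infinity>"
      using square_integrable_finite[OF f] by (simp add: N2_def)
    show "AE x in lborel. (\<lambda>m. ennreal ((cmod (trunc (real m) f x - f x))\<^sup>2)) \<longlonglongrightarrow> 0"
      by (intro AE_I2 tendsto_eventually eventually_mono[OF trunc_eventually]) simp
  qed (auto simp: trunc_def intro!: ennreal_leI)
  then show ?thesis by (simp add: L2_tendsto_iff N2_def)
qed

text \<open>The difference of two truncations has bounded support, so Plancherel is already
  available for it. Hence the transforms of the truncations form a Cauchy sequence.\<close>

lemma N2_fourier_trunc_diff:
  fixes f :: "real ^ 'n \<Rightarrow> complex"
  assumes f: "square_integrable f"
  shows "N2 (\<lambda>\<xi>. fourier_integral (trunc (real m) f) \<xi> - fourier_integral (trunc (real k) f) \<xi>)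
    = ennreal ((2 * pi) ^ CARD('n)) * N2 (\<lambda>x. trunc (real m) f x - trunc (real k) f x)"
proof -
  have "N2 (fourier_integral (\<lambda>x. trunc (real m) f x - trunc (real k) f x))
    = ennreal ((2 * pi) ^ CARD('n)) * N2 (\<lambda>x. trunc (real m) f x - trunc (real k) f x)"
    by (rule plancherel_bounded_support[OF square_integrable_diff[OF square_integrable_trunc[OF f] square_integrable_trunc[OF f]], where R="max (real m) (real k)"])
       (auto simp: trunc_def)
  moreover have "fourier_integral (\<lambda>x. trunc (real m) f x - trunc (real k) f x)
    = (\<lambda>\<xi>. fourier_integral (trunc (real m) f) \<xi> - fourier_integral (trunc (real k) f) \<xi>)"
    using integrable_trunc[OF f] by (intro ext fourier_integral_diff)
  ultimately show ?thesis by simp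
qed

text \<open>Integrability makes the transforms of the truncations converge pointwise. Fatou's lemma
  and the isometry on truncations upgrade this to mean-square convergence, and the norm identity
  passes to the limit.\<close>

lemma plancherel_fourier_integral:
  fixes f :: "real ^ 'n \<Rightarrow> complex"
  assumes f: "square_integrable f" and int: "integrable lborel f"
  shows "N2 (fourier_integral f) = ennreal ((2 * pi) ^ CARD('n)) * N2 f"
    and "L2_tendsto (\<lambda>m. fourier_integral (trunc (real m) f)) (fourier_integral f)"
proof -
  note [measurable] = square_integrable_measurable[OF f]
  let ?w = "ennreal ((2 * pi) ^ CARD('n))"
  have pointwise: "(\<lambda>m. fourier_integral (trunc (real m) f) \<xi>) \<longlonglongrightarrow> fourier_integral f \<xi>" for \<xi>
    unfolding fourier_integral_def
  proof (rule integral_dominated_convergence)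
    show "integrable lborel (\<lambda>x. norm (f x))" using int by simp
    show "AE x in lborel. (\<lambda>m. trunc (real m) f x * cis (- (x \<bullet> \<xi>))) \<longlonglongrightarrow> f x * cis (- (x \<bullet> \<xi>))"
      by (intro AE_I2 tendsto_eventually eventually_mono[OF trunc_eventually]) simp
  qed (auto simp: norm_mult norm_trunc_le)
  have le: "N2 (\<lambda>\<xi>. fourier_integral (trunc (real m) f) \<xi> - fourier_integral f \<xi>) \<le> ?w * N2 (\<lambda>x. trunc (real m) f x - f x)" for m
  proof -
    have "N2 (\<lambda>\<xi>. fourier_integral (trunc (real m) f) \<xi> - fourier_integral f \<xi>)
      = (\<integral>\<^sup>+\<xi>. liminf (\<lambda>k. ennreal ((cmod (fourier_integral (trunc (real m) f) \<xi> - fourier_integral (trunc (real k) f) \<xi>))\<^sup>2)) \<partial>lborel)"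
      unfolding N2_def
    proof (rule nn_integral_cong)
      fix \<xi> :: "real ^ 'n"
      have "(\<lambda>k. ennreal ((cmod (fourier_integral (trunc (real m) f) \<xi> - fourier_integral (trunc (real k) f) \<xi>))\<^sup>2))
        \<longlonglongrightarrow> ennreal ((cmod (fourier_integral (trunc (real m) f) \<xi> - fourier_integral f \<xi>))\<^sup>2)"
        by (intro tendsto_intros pointwise)
      from lim_imp_Liminf[OF _ this]
      show "ennreal ((cmod (fourier_integral (trunc (real m) f) \<xi> - fourier_integral f \<xi>))\<^sup>2)
        = liminf (\<lambda>k. ennreal ((cmod (fourier_integral (trunc (real m) f) \<xi> - fourier_integral (trunc (real k) f) \<xi>))\<^sup>2))"
        by simp
    qed
    also have "\<dots> \<le> liminf (\<lambda>k. N2 (\<lambda>\<xi>. fourier_integral (trunc (real m) f) \<xi> - fourier_integral (trunc (real k) f) \<xi>))"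
      unfolding N2_def by (rule nn_integral_liminf) measurable
    also have "\<dots> \<le> ?w * N2 (\<lambda>x. trunc (real m) f x - f x)"
    proof (rule Liminf_le)
      show "sequentially \<noteq> bot" by simp
      \<comment> \<open>For k \<ge> m the two truncations differ only on a shell, where the
        difference is that of \<open>trunc m f\<close> and f or 0.\<close>
      have "N2 (\<lambda>\<xi>. fourier_integral (trunc (real m) f) \<xi> - fourier_integral (trunc (real k) f) \<xi>)
        \<le> ?w * N2 (\<lambda>x. trunc (real m) f x - f x)" if "k \<ge> m" for k
        unfolding N2_fourier_trunc_diff[OF f] N2_def
        using that by (intro mult_left_mono nn_integral_mono ennreal_leI power_mono) (auto simp: trunc_def)
      then show "\<forall>\<^sub>F k in sequentially. N2 (\<lambda>\<xi>. fourier_integral (trunc (real m) f) \<xi> - fourier_integral (trunc (real k) f) \<xi>)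
        \<le> ?w * N2 (\<lambda>x. trunc (real m) f x - f x)"
        unfolding eventually_sequentially by blast
    qed
    finally show ?thesis .
  qed
  show lim: "L2_tendsto (\<lambda>m. fourier_integral (trunc (real m) f)) (fourier_integral f)"
    unfolding L2_tendsto_iff
  proof (rule tendsto_sandwich[OF _ _ tendsto_const])
    have "(\<lambda>m. ?w * N2 (\<lambda>x. trunc (real m) f x - f x)) \<longlonglongrightarrow> ?w * 0"
      using L2_tendsto_trunc[OF f] unfolding L2_tendsto_iff by (intro ennreal_tendsto_cmult) auto
    then show "(\<lambda>m. ?w * N2 (\<lambda>x. trunc (real m) f x - f x)) \<longlonglongrightarrow> 0" by simp
  qed (use le in auto)
  have eq: "N2 (fourier_integral (trunc (real m) f)) = ?w * N2 (trunc (real m) f)" for m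
    by (rule plancherel_bounded_support[OF square_integrable_trunc[OF f], where R="real m"])
       (auto simp: trunc_def)
  show "N2 (fourier_integral f) = ?w * N2 f"
  proof (rule antisym)
    show le1: "N2 (fourier_integral f) \<le> ?w * N2 f"
      by (rule N2_limit_le[OF _ _ _ _ L2_tendsto_trunc[OF f] lim])
         (use eq square_integrable_finite[OF f] in auto)
    have fin: "N2 (fourier_integral f) < \<infinity>"
      using le1 by (rule le_less_trans) (use square_integrable_finite[OF f] in \<open>simp add: ennreal_mult_less_top\<close>)
    have w: "ennreal (1 / (2 * pi) ^ CARD('n)) * (?w * x) = x" for x
      by (simp add: mult.assoc[symmetric] ennreal_mult[symmetric])
    have "N2 f \<le> ennreal (1 / (2 * pi) ^ CARD('n)) * N2 (fourier_integral f)"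
      by (rule N2_limit_le[OF _ _ _ _ lim L2_tendsto_trunc[OF f]])
         (use eq fin w in auto)
    then have "?w * N2 f \<le> ?w * (ennreal (1 / (2 * pi) ^ CARD('n)) * N2 (fourier_integral f))"
      by (intro mult_left_mono) auto
    also have "\<dots> = N2 (fourier_integral f)"
      using w by (simp add: mult.left_commute)
    finally show "?w * N2 f \<le> N2 (fourier_integral f)" .
  qed
qed

section \<open>Norms, linearity and inner products under the extended transform\<close>

lemma has_fourier_L2_norm:
  fixes f :: "real ^ 'n \<Rightarrow> complex"
  assumes "has_fourier_L2 f F"
  shows "N2 F = ennreal ((2 * pi) ^ CARD('n)) * N2 f"
proof -
  obtain h where f: "square_integrable f" and F: "square_integrable F"
    and h: "\<And>m. integrable lborel (h m)" "\<And>m. square_integrable (h m)"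
    and lim: "L2_tendsto h f" "L2_tendsto (\<lambda>m. fourier_integral (h m)) F"
    using assms unfolding has_fourier_L2_def by blast
  note [measurable] = square_integrable_measurable[OF f] square_integrable_measurable[OF F] square_integrable_measurable[OF h(2)]
  let ?w = "ennreal ((2 * pi) ^ CARD('n))"
  note eq = plancherel_fourier_integral(1)[OF h(2) h(1)]
  have w: "ennreal (1 / (2 * pi) ^ CARD('n)) * (?w * x) = x" for x
    by (simp add: mult.assoc[symmetric] ennreal_mult[symmetric])
  show ?thesis
  proof (rule antisym)
    show "N2 F \<le> ?w * N2 f"
      by (rule N2_limit_le[OF _ _ _ _ lim]) (use eq square_integrable_finite[OF f] in auto)
    \<comment> \<open>The same limit argument with the two sequences exchanged gives the reverse
      inequality.\<close>
    have "N2 f \<le> ennreal (1 / (2 * pi) ^ CARD('n)) * N2 F"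
      by (rule N2_limit_le[OF _ _ _ _ lim(2,1)]) (use eq square_integrable_finite[OF F] w in auto)
    then have "?w * N2 f \<le> ?w * (ennreal (1 / (2 * pi) ^ CARD('n)) * N2 F)"
      by (intro mult_left_mono) auto
    also have "\<dots> = N2 F" using w by (simp add: mult.left_commute)
    finally show "?w * N2 f \<le> N2 F" .
  qed
qed

lemma has_fourier_L2_add_cmult:
  fixes f :: "real ^ 'n \<Rightarrow> complex"
  assumes "has_fourier_L2 f F" "has_fourier_L2 g G"
  shows "has_fourier_L2 (\<lambda>x. f x + c * g x) (\<lambda>x. F x + c * G x)"
proof -
  obtain h where f: "square_integrable f" "square_integrable F"
    and h: "\<And>m. integrable lborel (h m)" "\<And>m. square_integrable (h m)"
    and lim: "L2_tendsto h f" "L2_tendsto (\<lambda>m. fourier_integral (h m)) F"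
    using assms(1) unfolding has_fourier_L2_def by blast
  obtain h' where g: "square_integrable g" "square_integrable G"
    and h': "\<And>m. integrable lborel (h' m)" "\<And>m. square_integrable (h' m)"
    and lim': "L2_tendsto h' g" "L2_tendsto (\<lambda>m. fourier_integral (h' m)) G"
    using assms(2) unfolding has_fourier_L2_def by blast
  note [measurable] = square_integrable_measurable[OF f(1)] square_integrable_measurable[OF f(2)]
    square_integrable_measurable[OF g(1)] square_integrable_measurable[OF g(2)]
    square_integrable_measurable[OF h(2)] square_integrable_measurable[OF h'(2)]
  have L2_add: "L2_tendsto (\<lambda>m x. u m x + c * v m x) (\<lambda>x. U x + c * V x)"
    if "L2_tendsto u U" "L2_tendsto v V"
    and [measurable]: "\<And>m. u m \<in> borel_measurable borel" "\<And>m. v m \<in> borel_measurable borel"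
      "U \<in> borel_measurable borel" "V \<in> borel_measurable borel"
    for u v and U V :: "real ^ 'n \<Rightarrow> complex"
    unfolding L2_tendsto_iff
  proof (rule tendsto_sandwich[OF _ _ tendsto_const])
    have "(\<lambda>m. 2 * N2 (\<lambda>x. u m x - U x) + 2 * (ennreal ((cmod c)\<^sup>2) * N2 (\<lambda>x. v m x - V x))) \<longlonglongrightarrow> 2 * 0 + 2 * (ennreal ((cmod c)\<^sup>2) * 0)"
      using that(1,2) unfolding L2_tendsto_iff by (intro tendsto_add ennreal_tendsto_cmult) auto
    then show "(\<lambda>m. 2 * N2 (\<lambda>x. u m x - U x) + 2 * (ennreal ((cmod c)\<^sup>2) * N2 (\<lambda>x. v m x - V x))) \<longlonglongrightarrow> 0" by simp
    have "N2 (\<lambda>x. (u m x + c * v m x) - (U x + c * V x)) \<le> 2 * N2 (\<lambda>x. u m x - U x) + 2 * (ennreal ((cmod c)\<^sup>2) * N2 (\<lambda>x. v m x - V x))" for m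
    proof -
      have "(\<lambda>x. (u m x + c * v m x) - (U x + c * V x)) = (\<lambda>x. (u m x - U x) + c * (v m x - V x))"
        by (simp add: fun_eq_iff algebra_simps)
      then have "N2 (\<lambda>x. (u m x + c * v m x) - (U x + c * V x)) = N2 (\<lambda>x. (u m x - U x) + c * (v m x - V x))"
        by (rule arg_cong)
      also have "\<dots> \<le> 2 * N2 (\<lambda>x. u m x - U x) + 2 * N2 (\<lambda>x. c * (v m x - V x))"
        by (rule N2_add) measurable
      also have "N2 (\<lambda>x. c * (v m x - V x)) = ennreal ((cmod c)\<^sup>2) * N2 (\<lambda>x. v m x - V x)"
        by (rule N2_cmult) measurable
      finally show ?thesis .
    qed
    then show "\<forall>\<^sub>F m in sequentially. N2 (\<lambda>x. (u m x + c * v m x) - (U x + c * V x)) \<le> 2 * N2 (\<lambda>x. u m x - U x) + 2 * (ennreal ((cmod c)\<^sup>2) * N2 (\<lambda>x. v m x - V x))"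
      by (rule always_eventually[OF allI])
  qed auto
  have "L2_tendsto (\<lambda>m. fourier_integral (\<lambda>x. h m x + c * h' m x)) (\<lambda>x. F x + c * G x)"
    using L2_add[OF lim(2) lim'(2)] by (simp add: fourier_integral_add_cmult[OF h(1) h'(1), abs_def])
  then show ?thesis
    unfolding has_fourier_L2_def using f g h h' L2_add[OF lim(1) lim'(1)]
    by (intro conjI exI[of _ "\<lambda>m x. h m x + c * h' m x"])
       (auto intro!: square_integrable_add square_integrable_cmult)
qed


lemma integrable_inner_square:
  fixes f g :: "real ^ 'n \<Rightarrow> complex"
  assumes "square_integrable f" "square_integrable g"
  shows "integrable lborel (\<lambda>x. f x * cnj (g x))"
proof -
  note [measurable] = square_integrable_measurable[OF assms(1)] square_integrable_measurable[OF assms(2)]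
  have "integrable lborel (\<lambda>x. (norm (f x))\<^sup>2 + (norm (g x))\<^sup>2)"
    using assms unfolding square_integrable_def by simp
  then show ?thesis
  proof (rule Bochner_Integration.integrable_bound)
    have "s * t \<le> s\<^sup>2 + t\<^sup>2" for s t :: real
      using sum_squares_bound[of s t] zero_le_power2[of s] zero_le_power2[of t] by linarith
    then show "AE x in lborel. norm (f x * cnj (g x)) \<le> norm ((norm (f x))\<^sup>2 + (norm (g x))\<^sup>2)"
      by (auto simp: norm_mult)
  qed measurable
qed

lemma integral_norm_square:
  assumes "square_integrable f"
  shows "N2 f = ennreal (\<integral>x. (norm (f x))\<^sup>2 \<partial>lborel)"
  unfolding N2_def using assms by (intro nn_integral_eq_integral) (auto simp: square_integrable_def)

text \<open>All four terms have the shape f + c g, the one for which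
  \<open>has_fourier_L2_add_cmult\<close> provides the transform; so the norm identity yields the
  inner product identity term by term.\<close>

lemma L2_inner_polarization:
  fixes f g :: "real ^ 'n \<Rightarrow> complex"
  assumes f: "square_integrable f" and g: "square_integrable g"
  defines "n2 \<equiv> \<lambda>f :: real ^ 'n \<Rightarrow> complex. complex_of_real (\<integral>x. (norm (f x))\<^sup>2 \<partial>lborel)"
  shows "4 * L2_inner f g = n2 (\<lambda>x. f x + 1 * g x) - n2 (\<lambda>x. f x + (- 1) * g x)
     + \<i> * n2 (\<lambda>x. f x + \<i> * g x) - \<i> * n2 (\<lambda>x. f x + (- \<i>) * g x)"
proof -
  have sq: "square_integrable (\<lambda>x. f x + c * g x)" for c
    by (intro square_integrable_add square_integrable_cmult f g)
  have int: "integrable lborel (\<lambda>x. complex_of_real ((norm (f x + c * g x))\<^sup>2))" for c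
    using sq[of c] unfolding square_integrable_def by (intro integrable_of_real) auto
  have n2: "n2 (\<lambda>x. f x + c * g x) = (\<integral>x. complex_of_real ((norm (f x + c * g x))\<^sup>2) \<partial>lborel)" for c
    unfolding n2_def by (rule integral_complex_of_real[symmetric])
  have pt: "4 * (a * cnj b) = of_real ((norm (a + 1 * b))\<^sup>2) - of_real ((norm (a + (- 1) * b))\<^sup>2)
     + \<i> * of_real ((norm (a + \<i> * b))\<^sup>2) - \<i> * of_real ((norm (a + (- \<i>) * b))\<^sup>2)" for a b
    unfolding complex_norm_square by (simp add: algebra_simps)
  have "4 * L2_inner f g = (\<integral>x. 4 * (f x * cnj (g x)) \<partial>lborel)"
    unfolding L2_inner_def by simp
  also have "\<dots> = n2 (\<lambda>x. f x + 1 * g x) - n2 (\<lambda>x. f x + (- 1) * g x)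
     + \<i> * n2 (\<lambda>x. f x + \<i> * g x) - \<i> * n2 (\<lambda>x. f x + (- \<i>) * g x)"
    unfolding pt n2 using int
    by (subst Bochner_Integration.integral_diff Bochner_Integration.integral_add;
        (intro Bochner_Integration.integrable_diff Bochner_Integration.integrable_add integrable_mult_right int)?)+ simp
  finally show ?thesis .
qed

lemma has_fourier_L2_square_integrable:
  assumes "has_fourier_L2 f F"
  shows "square_integrable f" "square_integrable F"
  using assms unfolding has_fourier_L2_def by auto

lemma has_fourier_L2_inner:
  fixes f :: "real ^ 'n \<Rightarrow> complex"
  assumes "has_fourier_L2 f F" "has_fourier_L2 g G"
  shows "L2_inner F G = of_real ((2 * pi) ^ CARD('n)) * L2_inner f g"
proof -
  let ?w = "(2 * pi) ^ CARD('n)"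
  have n2: "(\<integral>x. (norm (F x + c * G x))\<^sup>2 \<partial>lborel) = ?w * (\<integral>x. (norm (f x + c * g x))\<^sup>2 \<partial>lborel)" for c
  proof -
    note hf = has_fourier_L2_add_cmult[OF assms, of c]
    show ?thesis
      using has_fourier_L2_norm[OF hf] integral_norm_square[OF has_fourier_L2_square_integrable(1)[OF hf]]
        integral_norm_square[OF has_fourier_L2_square_integrable(2)[OF hf]]
      by (simp add: ennreal_mult[symmetric])
  qed
  note sq = has_fourier_L2_square_integrable[OF assms(1)] has_fourier_L2_square_integrable[OF assms(2)]
  have "4 * L2_inner F G = of_real ?w * (4 * L2_inner f g)"
    unfolding L2_inner_polarization[OF sq(2,4)] L2_inner_polarization[OF sq(1,3)] n2
    by (simp add: algebra_simps)
  then show ?thesis by simp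
qed

section \<open>Existence of transforms and of functions with a given transform\<close>

lemma has_fourier_L2_exists:
  fixes f :: "real ^ 'n \<Rightarrow> complex"
  assumes f: "square_integrable f"
  obtains F where "has_fourier_L2 f F"
proof -
  note [measurable] = square_integrable_measurable[OF f]
  let ?w = "(2 * pi) ^ CARD('n)"
  let ?h = "\<lambda>m. trunc (real m) f"
  have sqh: "square_integrable (fourier_integral (?h m))" for m
    using plancherel_fourier_integral(1)[OF square_integrable_trunc[OF f] integrable_trunc[OF f], of m]
      square_integrable_finite[OF square_integrable_trunc[OF f, of m]]
    by (auto simp: square_integrable_iff ennreal_mult_less_top)
  have "\<exists>M. \<forall>m\<ge>M. \<forall>k\<ge>M. N2 (\<lambda>\<xi>. fourier_integral (?h m) \<xi> - fourier_integral (?h k) \<xi>) \<le> ennreal e" if "0 < e" for e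
  proof -
    obtain M where M: "\<And>m k. m \<ge> M \<Longrightarrow> k \<ge> M \<Longrightarrow> N2 (\<lambda>x. ?h m x - ?h k x) \<le> ennreal (e / ?w)"
      using L2_tendsto_Cauchy[OF _ _ L2_tendsto_trunc[OF f], of "e / ?w"] \<open>0 < e\<close> by auto
    have "N2 (\<lambda>\<xi>. fourier_integral (?h m) \<xi> - fourier_integral (?h k) \<xi>) \<le> ennreal e" if "m \<ge> M" "k \<ge> M" for m k
    proof -
      have "N2 (\<lambda>\<xi>. fourier_integral (?h m) \<xi> - fourier_integral (?h k) \<xi>) \<le> ennreal ?w * ennreal (e / ?w)"
        unfolding N2_fourier_trunc_diff[OF f] using M[OF that] by (intro mult_left_mono) auto
      also have "\<dots> = ennreal e" using \<open>0 < e\<close> by (simp add: ennreal_mult[symmetric])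
      finally show ?thesis .
    qed
    then show ?thesis by blast
  qed
  then obtain F where "square_integrable F" "L2_tendsto (\<lambda>m. fourier_integral (?h m)) F"
    using L2_complete[of "\<lambda>m. fourier_integral (?h m)", OF sqh] by blast
  then have "has_fourier_L2 f F"
    unfolding has_fourier_L2_def
    using f integrable_trunc[OF f] square_integrable_trunc[OF f] L2_tendsto_trunc[OF f]
    by (intro conjI exI[of _ ?h]) auto
  then show ?thesis by (rule that)
qed

text \<open>The error of the truncated inversion formula is
  $\|\widehat{h_R}-g\|^2=\|g\|^2-(2\pi)^n\|h_R\|^2$ because
  $\langle\widehat{h_R},g\rangle=(2\pi)^n\|h_R\|^2$ by Fubini.\<close>

lemma fourier_inversion_trunc:
  fixes g :: "real ^ 'n \<Rightarrow> complex"
  assumes g: "square_integrable g" and int: "integrable lborel g"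
  defines "u \<equiv> \<lambda>x. of_real (1 / (2 * pi) ^ CARD('n)) * fourier_integral g (- x)"
  shows "square_integrable u" "N2 g = ennreal ((2 * pi) ^ CARD('n)) * N2 u"
    and "L2_tendsto (\<lambda>m. fourier_integral (trunc (real m) u)) g"
proof -
  note [measurable] = square_integrable_measurable[OF g]
  let ?w = "(2 * pi) ^ CARD('n)"
  have [measurable]: "u \<in> borel_measurable borel" unfolding u_def by measurable
  have "N2 u = ennreal ((1 / ?w)\<^sup>2) * N2 (\<lambda>x. fourier_integral g (- x))"
    unfolding u_def by (subst N2_cmult) (simp_all add: norm_divide norm_mult norm_power)
  also have "N2 (\<lambda>x. fourier_integral g (- x)) = N2 (fourier_integral g)"
    using N2_affine[of "fourier_integral g" "- 1" 0] by simp
  also have "\<dots> = ennreal ?w * N2 g" by (rule plancherel_fourier_integral(1)[OF g int])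
  finally have N2u: "N2 u = ennreal ((1 / ?w)\<^sup>2) * (ennreal ?w * N2 g)" .
  then show "N2 g = ennreal ?w * N2 u"
    by (simp add: mult.assoc[symmetric] ennreal_mult[symmetric] power2_eq_square)
  show u: "square_integrable u"
    using N2u square_integrable_finite[OF g] by (simp add: square_integrable_iff ennreal_mult_less_top)
  define h where "h m = trunc (real m) u" for m
  have h: "square_integrable (h m)" "integrable lborel (h m)" for m
    unfolding h_def by (intro square_integrable_trunc integrable_trunc u)+
  have fh: "square_integrable (fourier_integral (h m))" for m
    using plancherel_fourier_integral(1)[OF h] square_integrable_finite[OF h(1)[of m]] square_integrable_measurable[OF h(1)[of m]]
    by (auto simp: square_integrable_iff ennreal_mult_less_top)
  note [measurable] = square_integrable_measurable[OF h(1)]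
  let ?n2 = "\<lambda>f :: real ^ 'n \<Rightarrow> complex. \<integral>x. (norm (f x))\<^sup>2 \<partial>lborel"
  have cross: "(\<integral>\<xi>. fourier_integral (h m) \<xi> * cnj (g \<xi>) \<partial>lborel) = of_real (?w * ?n2 (h m))" for m
  proof -
    \<comment> \<open>Both \<open>h m\<close> and g are integrable, so the double integral converges
      absolutely and the order may be exchanged.\<close>
    let ?K = "\<lambda>\<xi> x. h m x * cis (- (x \<bullet> \<xi>)) * cnj (g \<xi>)"
    have K: "integrable (lborel \<Otimes>\<^sub>M lborel) (\<lambda>(\<xi>, x). ?K \<xi> x)"
    proof (rule lborel_pair.Fubini_integrable)
      show "integrable lborel (\<lambda>\<xi>. \<integral>x. norm (case (\<xi>, x) of (\<xi>, x) \<Rightarrow> ?K \<xi> x) \<partial>lborel)"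
        using int by (simp add: norm_mult)
      show "AE \<xi> in lborel. integrable lborel (\<lambda>x. case (\<xi>, x) of (\<xi>, x) \<Rightarrow> ?K \<xi> x)"
        using integrable_mult_cis[OF h(2)] by simp
    qed measurable
    have "(\<integral>\<xi>. fourier_integral (h m) \<xi> * cnj (g \<xi>) \<partial>lborel) = (\<integral>\<xi>. (\<integral>x. ?K \<xi> x \<partial>lborel) \<partial>lborel)"
      unfolding fourier_integral_def by simp
    also have "\<dots> = (\<integral>x. (\<integral>\<xi>. ?K \<xi> x \<partial>lborel) \<partial>lborel)"
      by (rule lborel_pair.Fubini_integral[OF K, symmetric])
    also have "\<dots> = (\<integral>x. of_real ?w * of_real ((norm (h m x))\<^sup>2) \<partial>lborel)"
    proof (rule Bochner_Integration.integral_cong[OF refl])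
      fix x :: "real ^ 'n"
      have "(\<integral>\<xi>. ?K \<xi> x \<partial>lborel) = (\<integral>\<xi>. h m x * cnj (g \<xi> * cis (- (\<xi> \<bullet> (- x)))) \<partial>lborel)"
        by (intro Bochner_Integration.integral_cong) (auto simp: cis_cnj inner_commute)
      also have "\<dots> = h m x * cnj (fourier_integral g (- x))"
        unfolding fourier_integral_def
        by (subst integral_mult_right_zero, subst integral_bounded_linear[OF bounded_linear_cnj integrable_mult_cis[OF int]]) simp
      \<comment> \<open>Where the truncation \<open>h m\<close> is nonzero it agrees with u, that
        is, with the inverse integral of g divided by w.\<close>
      also have "\<dots> = of_real ?w * of_real ((norm (h m x))\<^sup>2)"
        unfolding complex_norm_square by (simp add: h_def trunc_def u_def)
      finally show "(\<integral>\<xi>. ?K \<xi> x \<partial>lborel) = of_real ?w * of_real ((norm (h m x))\<^sup>2)" .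
    qed
    also have "\<dots> = of_real (?w * ?n2 (h m))"
      by (simp only: integral_mult_right_zero integral_complex_of_real of_real_mult)
    finally show ?thesis .
  qed
  have diff: "N2 (\<lambda>\<xi>. fourier_integral (h m) \<xi> - g \<xi>) = ennreal (?n2 g - ?w * ?n2 (h m))" for m
  proof -
    let ?f = "fourier_integral (h m)"
    have d: "square_integrable (\<lambda>\<xi>. ?f \<xi> - g \<xi>)" by (intro square_integrable_diff fh g)
    have n2f: "?n2 ?f = ?w * ?n2 (h m)"
      using plancherel_fourier_integral(1)[OF h] integral_norm_square[OF fh[of m]] integral_norm_square[OF h(1)[of m]]
      by (simp add: ennreal_mult[symmetric])
    have "complex_of_real (?n2 (\<lambda>\<xi>. ?f \<xi> - g \<xi>)) = (\<integral>\<xi>. complex_of_real ((norm (?f \<xi> - g \<xi>))\<^sup>2) \<partial>lborel)"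
      by (rule integral_complex_of_real[symmetric])
    also have "\<dots> = (\<integral>\<xi>. of_real ((norm (?f \<xi>))\<^sup>2) + of_real ((norm (g \<xi>))\<^sup>2) - ?f \<xi> * cnj (g \<xi>) - cnj (?f \<xi> * cnj (g \<xi>)) \<partial>lborel)"
      by (intro Bochner_Integration.integral_cong refl) (unfold complex_norm_square, simp add: algebra_simps)
    also have "\<dots> = of_real (?n2 ?f) + of_real (?n2 g) - of_real (?w * ?n2 (h m)) - cnj (of_real (?w * ?n2 (h m)))"
    proof -
      have i1: "integrable lborel (\<lambda>\<xi>. complex_of_real ((norm (?f \<xi>))\<^sup>2))" "integrable lborel (\<lambda>\<xi>. complex_of_real ((norm (g \<xi>))\<^sup>2))"
        using fh[of m] g unfolding square_integrable_def by (auto intro!: integrable_of_real simp del: of_real_power)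
      have i2: "integrable lborel (\<lambda>\<xi>. ?f \<xi> * cnj (g \<xi>))" by (rule integrable_inner_square[OF fh g])
      have i3: "integrable lborel (\<lambda>\<xi>. cnj (?f \<xi> * cnj (g \<xi>)))" by (rule integrable_cnj[OF i2])
      have "(\<integral>\<xi>. cnj (?f \<xi> * cnj (g \<xi>)) \<partial>lborel) = cnj (of_real (?w * ?n2 (h m)))"
        by (subst integral_bounded_linear[OF bounded_linear_cnj i2]) (simp only: cross)
      then show ?thesis
        by (simp only: Bochner_Integration.integral_diff Bochner_Integration.integral_add
            Bochner_Integration.integrable_diff Bochner_Integration.integrable_add i1 i2 i3 integral_complex_of_real cross)
    qed
    also have "\<dots> = of_real (?n2 g - ?w * ?n2 (h m))" by (simp add: n2f)
    finally have "?n2 (\<lambda>\<xi>. ?f \<xi> - g \<xi>) = ?n2 g - ?w * ?n2 (h m)" by (simp only: of_real_eq_iff)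
    then show ?thesis using integral_norm_square[OF d] by simp
  qed
  have "(\<lambda>m. ?n2 (h m)) \<longlonglongrightarrow> ?n2 u"
  proof (rule integral_dominated_convergence)
    show "integrable lborel (\<lambda>x. (norm (u x))\<^sup>2)" using u unfolding square_integrable_def by simp
    show "AE x in lborel. (\<lambda>m. (norm (h m x))\<^sup>2) \<longlonglongrightarrow> (norm (u x))\<^sup>2"
      unfolding h_def
      by (intro AE_I2 tendsto_eventually, rule eventually_mono[OF trunc_eventually[of u]], erule ssubst, rule refl)
    show "AE x in lborel. norm ((norm (h m x))\<^sup>2) \<le> (norm (u x))\<^sup>2" for m
      by (auto simp: h_def trunc_def)
  qed measurable
  then have "(\<lambda>m. ennreal (?n2 g - ?w * ?n2 (h m))) \<longlonglongrightarrow> ennreal (?n2 g - ?w * ?n2 u)"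
    by (intro tendsto_intros)
  moreover have "?n2 g = ?w * ?n2 u"
    using \<open>N2 g = ennreal ?w * N2 u\<close> integral_norm_square[OF u] integral_norm_square[OF g]
    by (simp add: ennreal_mult[symmetric])
  ultimately show "L2_tendsto (\<lambda>m. fourier_integral (trunc (real m) u)) g"
    unfolding L2_tendsto_iff h_def[symmetric] diff by simp
qed

lemma L2_tendsto_perturb:
  assumes [measurable]: "\<And>m. h m \<in> borel_measurable borel" "\<And>m. u m \<in> borel_measurable borel" "f \<in> borel_measurable borel"
    and lim: "L2_tendsto u f" and close: "\<And>m. N2 (\<lambda>x. h m x - u m x) \<le> ennreal (1 / real (Suc m))"
  shows "L2_tendsto h f"
  unfolding L2_tendsto_iff
proof (rule tendsto_sandwich[OF _ _ tendsto_const])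
  have "(\<lambda>m. ennreal (1 / real (Suc m))) \<longlonglongrightarrow> ennreal 0"
    by (intro tendsto_ennrealI LIMSEQ_Suc lim_1_over_n)
  then have "(\<lambda>m. 2 * ennreal (1 / real (Suc m)) + 2 * N2 (\<lambda>x. u m x - f x)) \<longlonglongrightarrow> 2 * ennreal 0 + 2 * 0"
    using lim unfolding L2_tendsto_iff by (intro tendsto_add ennreal_tendsto_cmult) auto
  then show "(\<lambda>m. 2 * ennreal (1 / real (Suc m)) + 2 * N2 (\<lambda>x. u m x - f x)) \<longlonglongrightarrow> 0" by simp
  have "N2 (\<lambda>x. h m x - f x) \<le> 2 * ennreal (1 / real (Suc m)) + 2 * N2 (\<lambda>x. u m x - f x)" for m
  proof -
    have "N2 (\<lambda>x. h m x - f x) \<le> 2 * N2 (\<lambda>x. h m x - u m x) + 2 * N2 (\<lambda>x. u m x - f x)"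
      using N2_add[of "\<lambda>x. h m x - u m x" "\<lambda>x. u m x - f x"] by simp
    also have "\<dots> \<le> 2 * ennreal (1 / real (Suc m)) + 2 * N2 (\<lambda>x. u m x - f x)"
      using close[of m] by (intro add_mono mult_left_mono) auto
    finally show ?thesis .
  qed
  then show "\<forall>\<^sub>F m in sequentially. N2 (\<lambda>x. h m x - f x) \<le> 2 * ennreal (1 / real (Suc m)) + 2 * N2 (\<lambda>x. u m x - f x)"
    by (rule always_eventually[OF allI])
qed auto

text \<open>Provides the mother wavelets. The inverse integrals u_m of the truncations of
  \<open>G\<close> form a Cauchy sequence with limit \<psi>. Each u_m is truncated at a radius r m
  so large that both it and its transform move by at most 1/(m+1) in squared norm; the diagonal
  sequence then witnesses \<open>has_fourier_L2\<close>.\<close>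

lemma has_fourier_L2_surj:
  fixes G :: "real ^ 'n \<Rightarrow> complex"
  assumes G: "square_integrable G"
  obtains \<psi> where "has_fourier_L2 \<psi> G"
proof -
  let ?w = "(2 * pi) ^ CARD('n)"
  define I where "I g x = of_real (1 / ?w) * fourier_integral g (- x)" for g and x :: "real ^ 'n"
  define Gm where "Gm m = trunc (real m) G" for m
  have Gm: "square_integrable (Gm m)" "integrable lborel (Gm m)" for m
    unfolding Gm_def by (intro square_integrable_trunc integrable_trunc G)+
  have I_eq: "(\<lambda>x. of_real (1 / ?w) * fourier_integral g (- x)) = I g" for g :: "real ^ 'n \<Rightarrow> complex"
    by (simp add: I_def fun_eq_iff)
  note inv = fourier_inversion_trunc[where 'n='n, unfolded I_eq]
  define u where "u m = I (Gm m)" for m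
  have u: "square_integrable (u m)" for m unfolding u_def by (rule inv[OF Gm])
  note [measurable] = square_integrable_measurable[OF u] square_integrable_measurable[OF Gm(1)] square_integrable_measurable[OF G]
  have u_diff: "N2 (\<lambda>x. Gm m x - Gm k x) = ennreal ?w * N2 (\<lambda>x. u m x - u k x)" for m k
  proof -
    have "(\<lambda>x. u m x - u k x) = I (\<lambda>x. Gm m x - Gm k x)"
      by (intro ext) (simp only: u_def I_def fourier_integral_diff[OF Gm(2) Gm(2)] right_diff_distrib)
    then show ?thesis
      using inv(2)[of "\<lambda>x. Gm m x - Gm k x"] Gm square_integrable_diff[OF Gm(1) Gm(1)] by simp
  qed
  have "\<exists>M. \<forall>m\<ge>M. \<forall>k\<ge>M. N2 (\<lambda>x. u m x - u k x) \<le> ennreal e" if "0 < e" for e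
  proof -
    obtain M where M: "\<And>m k. m \<ge> M \<Longrightarrow> k \<ge> M \<Longrightarrow> N2 (\<lambda>x. Gm m x - Gm k x) \<le> ennreal (?w * e)"
      using L2_tendsto_Cauchy[OF _ _ L2_tendsto_trunc[OF G], of "?w * e"] \<open>0 < e\<close> by (auto simp: Gm_def)
    have "N2 (\<lambda>x. u m x - u k x) \<le> ennreal e" if "m \<ge> M" "k \<ge> M" for m k
    proof -
      have "N2 (\<lambda>x. u m x - u k x) = ennreal (1 / ?w) * N2 (\<lambda>x. Gm m x - Gm k x)"
        unfolding u_diff by (simp add: mult.assoc[symmetric] ennreal_mult[symmetric])
      also have "\<dots> \<le> ennreal (1 / ?w) * ennreal (?w * e)" using M[OF that] by (intro mult_left_mono) auto
      also have "\<dots> = ennreal e" using \<open>0 < e\<close> by (simp add: ennreal_mult[symmetric])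
      finally show ?thesis .
    qed
    then show ?thesis by blast
  qed
  then obtain \<psi> where \<psi>: "square_integrable \<psi>" "L2_tendsto u \<psi>"
    using L2_complete[of u, OF u] by blast
  note [measurable] = square_integrable_measurable[OF \<psi>(1)]
  have "\<exists>r :: nat. N2 (\<lambda>x. trunc (real r) (u m) x - u m x) \<le> ennreal (1 / real (Suc m))
      \<and> N2 (\<lambda>\<xi>. fourier_integral (trunc (real r) (u m)) \<xi> - Gm m \<xi>) \<le> ennreal (1 / real (Suc m))" for m
  proof -
    have "0 < ennreal (1 / real (Suc m))" by simp
    then have "\<forall>\<^sub>F r in sequentially. N2 (\<lambda>x. trunc (real r) (u m) x - u m x) < ennreal (1 / real (Suc m))"
      "\<forall>\<^sub>F r in sequentially. N2 (\<lambda>\<xi>. fourier_integral (trunc (real r) (u m)) \<xi> - Gm m \<xi>) < ennreal (1 / real (Suc m))"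
      using order_tendstoD(2)[OF L2_tendsto_trunc[OF u[of m], unfolded L2_tendsto_iff]]
        order_tendstoD(2)[OF inv(3)[OF Gm[of m], folded u_def, unfolded L2_tendsto_iff]] by blast+
    then have "\<forall>\<^sub>F r in sequentially. N2 (\<lambda>x. trunc (real r) (u m) x - u m x) \<le> ennreal (1 / real (Suc m))
      \<and> N2 (\<lambda>\<xi>. fourier_integral (trunc (real r) (u m)) \<xi> - Gm m \<xi>) \<le> ennreal (1 / real (Suc m))"
      by eventually_elim auto
    then show ?thesis unfolding eventually_sequentially by blast
  qed
  then have "\<exists>r :: nat \<Rightarrow> nat. \<forall>m. N2 (\<lambda>x. trunc (real (r m)) (u m) x - u m x) \<le> ennreal (1 / real (Suc m))
      \<and> N2 (\<lambda>\<xi>. fourier_integral (trunc (real (r m)) (u m)) \<xi> - Gm m \<xi>) \<le> ennreal (1 / real (Suc m))"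
    by (intro choice allI)
  then obtain r :: "nat \<Rightarrow> nat" where r: "\<And>m. N2 (\<lambda>x. trunc (real (r m)) (u m) x - u m x) \<le> ennreal (1 / real (Suc m))"
      "\<And>m. N2 (\<lambda>\<xi>. fourier_integral (trunc (real (r m)) (u m)) \<xi> - Gm m \<xi>) \<le> ennreal (1 / real (Suc m))"
    by blast
  define h where "h m = trunc (real (r m)) (u m)" for m
  have h: "square_integrable (h m)" "integrable lborel (h m)" for m
    unfolding h_def by (intro square_integrable_trunc integrable_trunc u)+
  note [measurable] = square_integrable_measurable[OF h(1)]
  have "L2_tendsto h \<psi>"
    by (rule L2_tendsto_perturb[OF _ _ _ \<psi>(2)]) (use r(1) in \<open>auto simp: h_def[symmetric]\<close>)
  moreover have "L2_tendsto (\<lambda>m. fourier_integral (h m)) G"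
    by (rule L2_tendsto_perturb[OF _ _ _ L2_tendsto_trunc[OF G, folded Gm_def]]) (use r(2) in \<open>auto simp: h_def[symmetric]\<close>)
  ultimately have "has_fourier_L2 \<psi> G"
    unfolding has_fourier_L2_def using G \<psi>(1) h by (intro conjI exI[of _ h]) auto
  then show ?thesis by (rule that)
qed

section \<open>Dilations, translations and wavelet coefficients\<close>

lemma L2_tendsto_affine:
  fixes f :: "real ^ 'n \<Rightarrow> complex"
  assumes [measurable]: "\<And>m. h m \<in> borel_measurable borel" "f \<in> borel_measurable borel"
    and c: "c \<noteq> 0" and b: "\<And>x. cmod (b x) \<le> B" and lim: "L2_tendsto h f"
  shows "L2_tendsto (\<lambda>m x. b x * h m (a + c *\<^sub>R x)) (\<lambda>x. b x * f (a + c *\<^sub>R x))"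
  unfolding L2_tendsto_iff
proof (rule tendsto_sandwich[OF _ _ tendsto_const])
  let ?C = "ennreal (1 / \<bar>c\<bar> ^ CARD('n))"
  have "(\<lambda>m. ennreal (B\<^sup>2) * (?C * N2 (\<lambda>x. h m x - f x))) \<longlonglongrightarrow> ennreal (B\<^sup>2) * (?C * 0)"
    using lim unfolding L2_tendsto_iff by (intro ennreal_tendsto_cmult) auto
  then show "(\<lambda>m. ennreal (B\<^sup>2) * (?C * N2 (\<lambda>x. h m x - f x))) \<longlonglongrightarrow> 0" by simp
  have "N2 (\<lambda>x. b x * h m (a + c *\<^sub>R x) - b x * f (a + c *\<^sub>R x)) \<le> ennreal (B\<^sup>2) * (?C * N2 (\<lambda>x. h m x - f x))" for m
  proof -
    have "N2 (\<lambda>x. b x * h m (a + c *\<^sub>R x) - b x * f (a + c *\<^sub>R x)) \<le> N2 (\<lambda>x. of_real B * (h m (a + c *\<^sub>R x) - f (a + c *\<^sub>R x)))"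
      unfolding N2_def
    proof (intro nn_integral_mono ennreal_leI power_mono norm_ge_zero)
      fix x
      have "cmod (b x) \<le> \<bar>B\<bar>" using b[of x] by simp
      then show "cmod (b x * h m (a + c *\<^sub>R x) - b x * f (a + c *\<^sub>R x)) \<le> cmod (of_real B * (h m (a + c *\<^sub>R x) - f (a + c *\<^sub>R x)))"
        unfolding right_diff_distrib[symmetric] norm_mult by (intro mult_right_mono) auto
    qed
    also have "\<dots> = ennreal (B\<^sup>2) * N2 (\<lambda>x. h m (a + c *\<^sub>R x) - f (a + c *\<^sub>R x))"
      by (subst N2_cmult) simp_all
    also have "N2 (\<lambda>x. h m (a + c *\<^sub>R x) - f (a + c *\<^sub>R x)) = ?C * N2 (\<lambda>x. h m x - f x)"
      using N2_affine[of "\<lambda>x. h m x - f x" c a] c by (simp add: mult.assoc[symmetric] ennreal_mult[symmetric])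
    finally show ?thesis .
  qed
  then show "\<forall>\<^sub>F m in sequentially. N2 (\<lambda>x. b x * h m (a + c *\<^sub>R x) - b x * f (a + c *\<^sub>R x)) \<le> ennreal (B\<^sup>2) * (?C * N2 (\<lambda>x. h m x - f x))"
    by (rule always_eventually[OF allI])
qed auto

lemma integrable_affine:
  fixes f :: "real ^ 'n \<Rightarrow> complex"
  assumes f: "integrable lborel f" and c: "c \<noteq> 0"
  shows "integrable lborel (\<lambda>x. f (a + c *\<^sub>R x))"
proof -
  have [measurable]: "f \<in> borel_measurable borel" using f by auto
  have "ennreal (\<bar>c\<bar> ^ DIM(real ^ 'n)) * (\<integral>\<^sup>+x. ennreal (norm (f (a + c *\<^sub>R x))) \<partial>lborel) < \<infinity>"
    using f nn_integral_lborel_affine[of "\<lambda>x. ennreal (norm (f x))" c a] c by (simp add: integrable_iff_bounded)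
  then have "(\<integral>\<^sup>+x. ennreal (norm (f (a + c *\<^sub>R x))) \<partial>lborel) < \<infinity>"
    using c by (auto simp: ennreal_mult_less_top)
  then show ?thesis by (simp add: integrable_iff_bounded)
qed

lemma has_fourier_L2_affine:
  fixes f :: "real ^ 'n \<Rightarrow> complex"
  assumes f: "has_fourier_L2 f F" and c: "c \<noteq> 0"
  shows "has_fourier_L2 (\<lambda>x. f (a + c *\<^sub>R x))
     (\<lambda>\<xi>. of_real (1 / \<bar>c\<bar> ^ CARD('n)) * cis ((a \<bullet> \<xi>) / c) * F ((1 / c) *\<^sub>R \<xi>))" (is "has_fourier_L2 ?f ?F")
proof -
  obtain h where sq: "square_integrable f" "square_integrable F"
    and h: "\<And>m. integrable lborel (h m)" "\<And>m. square_integrable (h m)"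
    and lim: "L2_tendsto h f" "L2_tendsto (\<lambda>m. fourier_integral (h m)) F"
    using f unfolding has_fourier_L2_def by blast
  note [measurable] = square_integrable_measurable[OF sq(1)] square_integrable_measurable[OF sq(2)]
    square_integrable_measurable[OF h(2)]
  let ?b = "\<lambda>\<xi>. of_real (1 / \<bar>c\<bar> ^ CARD('n)) * cis ((a \<bullet> \<xi>) / c) :: complex"
  have cis_eq: "cis ((a \<bullet> \<xi>) / c) = cis (((1 / c) *\<^sub>R a) \<bullet> \<xi>)" for \<xi> by simp
  have [measurable]: "?b \<in> borel_measurable borel" unfolding cis_eq by measurable
  have "L2_tendsto (\<lambda>m x. 1 * h m (a + c *\<^sub>R x)) (\<lambda>x. 1 * f (a + c *\<^sub>R x))"
    by (rule L2_tendsto_affine[OF _ _ c _ lim(1), of _ 1]) simp_all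
  moreover have "L2_tendsto (\<lambda>m \<xi>. ?b \<xi> * fourier_integral (h m) (0 + (1 / c) *\<^sub>R \<xi>)) (\<lambda>\<xi>. ?b \<xi> * F (0 + (1 / c) *\<^sub>R \<xi>))"
    by (rule L2_tendsto_affine[OF _ _ _ _ lim(2), of _ _ "1 / \<bar>c\<bar> ^ CARD('n)"])
       (use c in \<open>simp_all add: norm_mult norm_divide norm_power\<close>)
  moreover have "square_integrable ?F"
  proof (rule square_integrable_le)
    show "square_integrable (\<lambda>\<xi>. of_real (1 / \<bar>c\<bar> ^ CARD('n)) * F (0 + (1 / c) *\<^sub>R \<xi>))"
      using c by (intro square_integrable_cmult square_integrable_affine sq) simp
    show "?F \<in> borel_measurable borel" unfolding cis_eq by measurable
  qed (simp add: norm_mult norm_divide)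
  moreover have "fourier_integral (\<lambda>x. h m (a + c *\<^sub>R x)) = (\<lambda>\<xi>. ?b \<xi> * fourier_integral (h m) (0 + (1 / c) *\<^sub>R \<xi>))" for m
    using c by (intro ext) (subst fourier_integral_affine, auto)
  ultimately show ?thesis
    unfolding has_fourier_L2_def using c h sq
    by (intro conjI exI[of _ "\<lambda>m x. h m (a + c *\<^sub>R x)"])
       (auto intro: square_integrable_affine integrable_affine)
qed

text \<open>Parseval moves the inner product to the Fourier side, and the substitution \<xi> = c
  \<eta> shifts the dilation from the wavelet to F. So at every scale the same \<Psi> is tested,
  against a dilate of F, and k enters only as a frequency.\<close>

lemma wavelet_coefficient:
  fixes f \<psi> :: "real ^ 'n \<Rightarrow> complex" and j :: int
  assumes f: "has_fourier_L2 f F" and \<psi>: "has_fourier_L2 \<psi> \<Psi>" and lam: "0 < lam"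
  defines "c \<equiv> real lam powi j"
  shows "(norm (L2_inner f (wavelet lam \<psi> j k)))\<^sup>2
    = c ^ CARD('n) / ((2 * pi) ^ CARD('n))\<^sup>2 * (norm (\<integral>\<eta>. F (c *\<^sub>R \<eta>) * cnj (\<Psi> \<eta>) * ek (- k) \<eta> \<partial>lborel))\<^sup>2"
proof -
  let ?n = "CARD('n)"
  let ?w = "(2 * pi) ^ ?n"
  define A where "A = real lam powr (real_of_int j * real ?n / 2)"
  have c: "c > 0" using lam by (simp add: c_def)
  have A2: "A\<^sup>2 = c ^ ?n"
  proof -
    have "A\<^sup>2 = real lam powr (real_of_int j * real ?n)"
      unfolding A_def power2_eq_square by (simp add: powr_add[symmetric])
    also have "\<dots> = (real lam powr real_of_int j) powr real ?n" by (simp add: powr_powr)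
    also have "\<dots> = c ^ ?n" using lam c by (simp add: c_def powr_real_of_int' powr_realpow)
    finally show ?thesis .
  qed
  have [measurable]: "F \<in> borel_measurable borel" "\<Psi> \<in> borel_measurable borel"
    using has_fourier_L2_square_integrable(2)[OF f] has_fourier_L2_square_integrable(2)[OF \<psi>] by (auto simp: square_integrable_iff)
  define W where "W x = \<psi> (- int_vec k + c *\<^sub>R x)" for x
  define W' where "W' \<xi> = of_real (1 / c ^ ?n) * cis (((- int_vec k) \<bullet> \<xi>) / c) * \<Psi> ((1 / c) *\<^sub>R \<xi>)" for \<xi>
  have W: "has_fourier_L2 W W'"
    using has_fourier_L2_affine[OF \<psi>, of c "- int_vec k"] c unfolding W_def W'_def by simp
  have "L2_inner f (wavelet lam \<psi> j k) = of_real A * L2_inner f W"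
    unfolding L2_inner_def wavelet_def W_def c_def[symmetric] A_def[symmetric]
    by (simp add: mult.left_commute add.commute flip: integral_mult_right_zero)
  moreover have "L2_inner F W' = of_real ?w * L2_inner f W" by (rule has_fourier_L2_inner[OF f W])
  moreover have "L2_inner F W' = (\<integral>\<eta>. F (c *\<^sub>R \<eta>) * cnj (\<Psi> \<eta>) * ek (- k) \<eta> \<partial>lborel)"
  proof -
    have [measurable]: "W' \<in> borel_measurable borel"
      using has_fourier_L2_square_integrable(2)[OF W] by (simp add: square_integrable_iff)
    have "L2_inner F W' = of_real (\<bar>c\<bar> ^ DIM(real ^ 'n)) * (\<integral>\<eta>. F (0 + c *\<^sub>R \<eta>) * cnj (W' (0 + c *\<^sub>R \<eta>)) \<partial>lborel)"
      unfolding L2_inner_def by (rule integral_lborel_affine) (use c in \<open>auto\<close>)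
    also have "\<dots> = (\<integral>\<eta>. of_real (c ^ ?n) * (F (c *\<^sub>R \<eta>) * cnj (W' (c *\<^sub>R \<eta>))) \<partial>lborel)"
      using c by (simp add: DIM_cart)
    also have "\<dots> = (\<integral>\<eta>. F (c *\<^sub>R \<eta>) * cnj (\<Psi> \<eta>) * ek (- k) \<eta> \<partial>lborel)"
    proof (rule Bochner_Integration.integral_cong[OF refl])
      fix \<eta> :: "real ^ 'n"
      have "cnj (W' (c *\<^sub>R \<eta>)) = of_real (1 / c ^ ?n) * ek (- k) \<eta> * cnj (\<Psi> \<eta>)"
        using c by (simp add: W'_def ek_def int_vec_minus cis_cnj)
      then show "of_real (c ^ ?n) * (F (c *\<^sub>R \<eta>) * cnj (W' (c *\<^sub>R \<eta>))) = F (c *\<^sub>R \<eta>) * cnj (\<Psi> \<eta>) * ek (- k) \<eta>"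
        using c by simp
    qed
    finally show ?thesis .
  qed
  ultimately have "L2_inner f (wavelet lam \<psi> j k) = of_real (A / ?w) * (\<integral>\<eta>. F (c *\<^sub>R \<eta>) * cnj (\<Psi> \<eta>) * ek (- k) \<eta> \<partial>lborel)"
    by simp
  then show ?thesis
    unfolding A2[symmetric] by (simp only: norm_mult norm_of_real power_mult_distrib power2_abs power_divide)
qed

section \<open>Bracket products\<close>

definition lat :: "int ^ 'n \<Rightarrow> real ^ 'n" where
  "lat k = (2 * pi) *\<^sub>R int_vec k"

lemma lat_add: "lat (k + l) = lat k + lat l"
  by (simp add: lat_def int_vec_add scaleR_add_right)

lemma lat_0 [simp]: "lat 0 = 0"
  by (simp add: lat_def)

text \<open>The bracket product. Where its series does not converge absolutely the Bochner integral
  is 0, which keeps Cauchy-Schwarz true at every point.\<close>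

definition br :: "(real ^ 'n \<Rightarrow> complex) \<Rightarrow> (real ^ 'n \<Rightarrow> complex) \<Rightarrow> real ^ 'n \<Rightarrow> complex" where
  "br G \<phi> \<eta> = (\<integral>k. G (\<eta> + lat k) * cnj (\<phi> (\<eta> + lat k)) \<partial>count_space UNIV)"

text \<open>The bracket of G with itself, as an extended real.\<close>

definition sqs :: "(real ^ 'n \<Rightarrow> complex) \<Rightarrow> real ^ 'n \<Rightarrow> ennreal" where
  "sqs G \<eta> = (\<integral>\<^sup>+k. ennreal ((cmod (G (\<eta> + lat k)))\<^sup>2) \<partial>count_space UNIV)"

lemma br_measurable [measurable]:
  assumes [measurable]: "G \<in> borel_measurable borel" "\<phi> \<in> borel_measurable borel"
  shows "br G \<phi> \<in> borel_measurable borel"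
  unfolding br_def[abs_def] by measurable

lemma sqs_measurable [measurable]:
  assumes [measurable]: "G \<in> borel_measurable borel"
  shows "sqs G \<in> borel_measurable borel"
  unfolding sqs_def[abs_def] by measurable

lemma bij_plus_vec: "bij ((+) (l :: int ^ 'n))"
  by (rule bij_betwI[where g="\<lambda>x. x - l"]) auto

lemma sqs_periodic: "sqs G (\<eta> + lat l) = sqs G \<eta>"
  unfolding sqs_def
  using nn_integral_bij_count_space[OF bij_plus_vec[of l], of "\<lambda>k. ennreal ((cmod (G (\<eta> + lat k)))\<^sup>2)"]
  by (simp add: lat_add add.assoc)

lemma nn_integral_tile_TM:
  fixes f :: "real ^ 'n \<Rightarrow> ennreal"
  assumes "f \<in> borel_measurable borel"
  shows "(\<integral>\<^sup>+x. f x \<partial>lborel) = (\<integral>\<^sup>+x. (\<integral>\<^sup>+k. f (x + lat k) \<partial>count_space UNIV) \<partial>TM)"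
  unfolding nn_integral_TM lat_def by (rule nn_integral_tile[OF fundamental_domain_cube0 assms]) simp

lemma integral_sqs:
  assumes [measurable]: "G \<in> borel_measurable borel"
  shows "(\<integral>\<^sup>+\<eta>. sqs G \<eta> \<partial>TM) = N2 G"
  unfolding sqs_def N2_def by (rule nn_integral_tile_TM[symmetric]) measurable

lemma norm_integral_le_nn_integral:
  fixes f :: "'a \<Rightarrow> complex"
  shows "ennreal (norm (integral\<^sup>L M f)) \<le> (\<integral>\<^sup>+x. ennreal (norm (f x)) \<partial>M)"
  by (cases "integrable M f") (auto simp: not_integrable_integral_eq intro: integral_norm_bound_ennreal)

lemma br_Cauchy_Schwarz: "ennreal ((cmod (br G \<phi> \<eta>))\<^sup>2) \<le> sqs G \<eta> * sqs \<phi> \<eta>"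
proof -
  have "ennreal (cmod (br G \<phi> \<eta>)) \<le> (\<integral>\<^sup>+k. ennreal (cmod (G (\<eta> + lat k))) * ennreal (cmod (\<phi> (\<eta> + lat k))) \<partial>count_space UNIV)"
    unfolding br_def using norm_integral_le_nn_integral[of "count_space UNIV" "\<lambda>k. G (\<eta> + lat k) * cnj (\<phi> (\<eta> + lat k))"]
    by (simp add: norm_mult ennreal_mult)
  then have "(ennreal (cmod (br G \<phi> \<eta>)))\<^sup>2 \<le> (\<integral>\<^sup>+k. ennreal (cmod (G (\<eta> + lat k))) * ennreal (cmod (\<phi> (\<eta> + lat k))) \<partial>count_space UNIV)\<^sup>2"
    by (rule power_mono) simp
  also have "\<dots> \<le> (\<integral>\<^sup>+k. (ennreal (cmod (G (\<eta> + lat k))))\<^sup>2 \<partial>count_space UNIV) * (\<integral>\<^sup>+k. (ennreal (cmod (\<phi> (\<eta> + lat k))))\<^sup>2 \<partial>count_space UNIV)"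
    by (rule Cauchy_Schwarz_nn_integral) simp_all
  finally show ?thesis unfolding sqs_def by (simp add: ennreal_power)
qed

lemma br_integrable:
  assumes "sqs G \<eta> < \<infinity>" "sqs \<phi> \<eta> < \<infinity>"
  shows "integrable (count_space UNIV) (\<lambda>k. G (\<eta> + lat k) * cnj (\<phi> (\<eta> + lat k)))"
proof (rule integrableI_bounded)
  let ?I = "\<integral>\<^sup>+k. ennreal (cmod (G (\<eta> + lat k))) * ennreal (cmod (\<phi> (\<eta> + lat k))) \<partial>count_space UNIV"
  have "?I\<^sup>2 \<le> (\<integral>\<^sup>+k. (ennreal (cmod (G (\<eta> + lat k))))\<^sup>2 \<partial>count_space UNIV) * (\<integral>\<^sup>+k. (ennreal (cmod (\<phi> (\<eta> + lat k))))\<^sup>2 \<partial>count_space UNIV)"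
    by (rule Cauchy_Schwarz_nn_integral) simp_all
  also have "\<dots> = sqs G \<eta> * sqs \<phi> \<eta>" unfolding sqs_def by (simp add: ennreal_power)
  also have "\<dots> < \<infinity>" using assms by (simp add: ennreal_mult_less_top)
  finally have "?I < \<infinity>" by (cases ?I) (auto simp: power2_eq_square ennreal_top_mult)
  then show "(\<integral>\<^sup>+k. ennreal (norm (G (\<eta> + lat k) * cnj (\<phi> (\<eta> + lat k)))) \<partial>count_space UNIV) < \<infinity>"
    by (simp add: norm_mult ennreal_mult)
qed simp

text \<open>Countably many lattice translates of the cube cover the space, and each contributes only
  a null set.\<close>

lemma AE_periodic:
  fixes P :: "real ^ 'n \<Rightarrow> bool"
  assumes "AE \<eta> in TM. P \<eta>" and per: "\<And>\<eta> k. P (\<eta> + lat k) \<Longrightarrow> P \<eta>"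
  shows "AE \<eta> in lborel. P \<eta>"
proof -
  have *: "AE \<eta> in lborel. \<eta> \<in> cube (2 * pi) \<longrightarrow> P \<eta>"
    using assms(1) by (subst (asm) AE_restrict_space_iff) auto
  have "AE \<eta> in lborel. \<forall>k. \<eta> + lat k \<in> cube (2 * pi) \<longrightarrow> P (\<eta> + lat k)"
    unfolding AE_all_countable
  proof
    fix k show "AE \<eta> in lborel. \<eta> + lat k \<in> cube (2 * pi) \<longrightarrow> P (\<eta> + lat k)"
      using AE_lborel_affine[OF *, of 1 "lat k"] by (simp add: add.commute)
  qed
  then show ?thesis
  proof eventually_elim
    case (elim \<eta>)
    obtain k where "\<eta> + lat k \<in> cube (2 * pi)"
      using fundamental_domain_cube0[of "2 * pi"] unfolding fundamental_domain_def lat_def by force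
    then show ?case using elim per by blast
  qed
qed

lemma AE_sqs_finite:
  assumes "square_integrable G"
  shows "AE \<eta> in lborel. sqs G \<eta> < \<infinity>"
proof (rule AE_periodic)
  note [measurable] = square_integrable_measurable[OF assms]
  have "(\<integral>\<^sup>+\<eta>. sqs G \<eta> \<partial>TM) \<noteq> \<infinity>"
    using integral_sqs[of G] square_integrable_finite[OF assms] by simp
  then have "AE \<eta> in TM. sqs G \<eta> \<noteq> \<infinity>" by (intro nn_integral_PInf_AE) measurable
  then show "AE \<eta> in TM. sqs G \<eta> < \<infinity>" by eventually_elim (simp add: less_top)
qed (simp add: sqs_periodic)

lemma ek_lat: "ek k (x + lat l) = ek k x"
  unfolding lat_def by (rule ek_periodic)

lemma integral_br:
  fixes G :: "real ^ 'n \<Rightarrow> complex"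
  assumes G: "square_integrable G" and \<phi>: "square_integrable \<phi>"
  shows "(\<integral>\<eta>. G \<eta> * cnj (\<phi> \<eta>) * ek k \<eta> \<partial>lborel) = (\<integral>\<eta>. br G \<phi> \<eta> * ek k \<eta> \<partial>TM)"
proof -
  note [measurable] = square_integrable_measurable[OF G] square_integrable_measurable[OF \<phi>]
  have int: "integrable lborel (\<lambda>\<eta>. G \<eta> * cnj (\<phi> \<eta>) * ek k \<eta>)"
    by (rule Bochner_Integration.integrable_bound[OF integrable_inner_square[OF G \<phi>]]) (auto simp: norm_mult)
  have "(\<integral>\<eta>. G \<eta> * cnj (\<phi> \<eta>) * ek k \<eta> \<partial>lborel) =
    (\<integral>\<eta>. (\<integral>l. G (\<eta> + lat l) * cnj (\<phi> (\<eta> + lat l)) * ek k (\<eta> + lat l) \<partial>count_space UNIV) \<partial>TM)"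
    unfolding integral_TM lat_def by (rule integral_tile(1)[OF fundamental_domain_cube0 int]) simp
  also have "\<dots> = (\<integral>\<eta>. br G \<phi> \<eta> * ek k \<eta> \<partial>TM)"
    unfolding br_def ek_lat by simp
  finally show ?thesis .
qed

text \<open>Folding over the lattice leaves the exponentials unchanged, so an integral over the
  whole space becomes a Fourier coefficient of the bracket on the torus.\<close>

lemma parseval_br:
  fixes G :: "real ^ 'n \<Rightarrow> complex"
  assumes G: "square_integrable G" and \<phi>: "square_integrable \<phi>"
    and fin: "(\<integral>\<^sup>+\<eta>. ennreal ((cmod (br G \<phi> \<eta>))\<^sup>2) \<partial>TM) < \<infinity>"
  shows "(\<integral>\<^sup>+k. ennreal ((cmod (\<integral>\<eta>. G \<eta> * cnj (\<phi> \<eta>) * ek (- k) \<eta> \<partial>lborel))\<^sup>2) \<partial>count_space UNIV)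
    = ennreal ((2 * pi) ^ CARD('n)) * (\<integral>\<^sup>+\<eta>. ennreal ((cmod (br G \<phi> \<eta>))\<^sup>2) \<partial>TM)"
proof -
  note [measurable] = square_integrable_measurable[OF G] square_integrable_measurable[OF \<phi>]
  have "bij (uminus :: int ^ 'n \<Rightarrow> int ^ 'n)" by (rule bij_uminus)
  then have "(\<integral>\<^sup>+k. ennreal ((cmod (\<integral>\<eta>. G \<eta> * cnj (\<phi> \<eta>) * ek (- k) \<eta> \<partial>lborel))\<^sup>2) \<partial>count_space UNIV)
    = (\<integral>\<^sup>+k. ennreal ((cmod (\<integral>\<eta>. G \<eta> * cnj (\<phi> \<eta>) * ek k \<eta> \<partial>lborel))\<^sup>2) \<partial>count_space UNIV)"
    by (rule nn_integral_bij_count_space[where f="\<lambda>k. ennreal ((cmod (\<integral>\<eta>. G \<eta> * cnj (\<phi> \<eta>) * ek k \<eta> \<partial>lborel))\<^sup>2)"])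
  also have "\<dots> = (\<integral>\<^sup>+k. ennreal ((cmod (\<integral>\<eta>. br G \<phi> \<eta> * ek k \<eta> \<partial>TM))\<^sup>2) \<partial>count_space UNIV)"
    by (simp only: integral_br[OF G \<phi>])
  also have "\<dots> = ennreal ((2 * pi) ^ CARD('n)) * (\<integral>\<^sup>+\<eta>. ennreal ((cmod (br G \<phi> \<eta>))\<^sup>2) \<partial>TM)"
    by (rule parseval_torus[OF _ fin]) measurable
  finally show ?thesis .
qed

section \<open>Digits\<close>

definition digits :: "nat \<Rightarrow> (int ^ 'n) set" where
  "digits lam = {k. \<forall>i. 0 \<le> k $ i \<and> k $ i < int lam}"

definition sc :: "nat \<Rightarrow> int ^ 'n \<Rightarrow> int ^ 'n" where
  "sc lam k = (\<chi> i. int lam * k $ i)"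

lemma lat_sc: "lat (sc lam k) = real lam *\<^sub>R lat k"
  by (simp add: lat_def sc_def vec_eq_iff)

lemma bij_digits:
  assumes "0 < lam"
  shows "bij_betw (\<lambda>(m, k). m + sc lam k) (digits lam \<times> UNIV) (UNIV :: (int ^ 'n) set)"
proof (rule bij_betwI[where g="\<lambda>k. (\<chi> i. k $ i mod int lam, \<chi> i. k $ i div int lam)"])
  show "(\<lambda>k. (\<chi> i. k $ i mod int lam, \<chi> i. k $ i div int lam)) \<in> UNIV \<rightarrow> digits lam \<times> UNIV"
    using assms by (auto simp: digits_def)
qed (use assms in \<open>auto simp: digits_def sc_def vec_eq_iff\<close>)

lemma nn_integral_count_space_Times:
  assumes "finite A"
  shows "(\<integral>\<^sup>+z. f z \<partial>count_space (A \<times> (UNIV :: 'b :: countable set))) = (\<Sum>a\<in>A. \<integral>\<^sup>+b. f (a, b) \<partial>count_space UNIV)"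
proof -
  have "(\<integral>\<^sup>+z. f z \<partial>count_space (A \<times> (UNIV :: 'b set))) = (\<integral>\<^sup>+z. f z \<partial>(count_space A \<Otimes>\<^sub>M count_space (UNIV :: 'b set)))"
    by (subst pair_measure_countable) (auto simp: assms countable_finite)
  also have "\<dots> = (\<integral>\<^sup>+a. \<integral>\<^sup>+b. f (a, b) \<partial>count_space UNIV \<partial>count_space A)"
    by (rule sigma_finite_measure.nn_integral_fst[OF sigma_finite_measure_count_space, symmetric])
       (auto simp: assms countable_finite pair_measure_countable)
  finally show ?thesis by (simp add: nn_integral_count_space_finite assms)
qed

lemma integral_count_space_Times:
  fixes f :: "'a \<times> 'b :: countable \<Rightarrow> complex"
  assumes "finite A" and "integrable (count_space (A \<times> (UNIV :: 'b set))) f"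
  shows "(\<integral>z. f z \<partial>count_space (A \<times> (UNIV :: 'b set))) = (\<Sum>a\<in>A. \<integral>b. f (a, b) \<partial>count_space UNIV)"
proof -
  have pm: "count_space A \<Otimes>\<^sub>M count_space (UNIV :: 'b set) = count_space (A \<times> UNIV)"
    by (rule pair_measure_countable) (auto simp: assms countable_finite)
  interpret pair_sigma_finite "count_space A" "count_space (UNIV :: 'b set)"
    by (intro pair_sigma_finite.intro sigma_finite_measure_count_space_countable)
       (auto simp: assms countable_finite)
  have "(\<integral>z. f z \<partial>count_space (A \<times> (UNIV :: 'b set))) = (\<integral>a. (\<integral>b. f (a, b) \<partial>count_space UNIV) \<partial>count_space A)"
    using integral_fst'[of f] assms(2) by (simp add: pm)
  then show ?thesis by (simp add: lebesgue_integral_count_space_finite assms(1))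
qed

lemma finite_digits: "finite (digits lam :: (int ^ 'n) set)"
proof -
  have "inj_on vec_nth (digits lam :: (int ^ 'n) set)" by (auto simp: inj_on_def vec_eq_iff)
  moreover have "vec_nth ` (digits lam :: (int ^ 'n) set) \<subseteq> PiE UNIV (\<lambda>_. {0..<int lam})"
    by (auto simp: digits_def)
  ultimately show ?thesis by (meson finite_PiE finite finite_atLeastLessThan_int finite_imageD finite_subset)
qed

lemma nn_integral_digits:
  assumes "0 < lam"
  shows "(\<integral>\<^sup>+k. f k \<partial>count_space (UNIV :: (int ^ 'n) set)) = (\<Sum>m\<in>digits lam. \<integral>\<^sup>+k. f (m + sc lam k) \<partial>count_space UNIV)"
  using nn_integral_bij_count_space[OF bij_digits[OF assms], of f]
  by (simp add: nn_integral_count_space_Times[OF finite_digits] case_prod_beta')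

lemma integral_digits:
  fixes f :: "int ^ 'n \<Rightarrow> complex"
  assumes "0 < lam" and int: "integrable (count_space UNIV) f"
  shows "(\<integral>k. f k \<partial>count_space UNIV) = (\<Sum>m\<in>digits lam. \<integral>k. f (m + sc lam k) \<partial>count_space UNIV)"
proof -
  let ?g = "\<lambda>z. f (fst z + sc lam (snd z))"
  have "integrable (count_space (digits lam \<times> UNIV)) ?g"
    using integrable_bij_count_space[OF bij_digits[OF assms(1)], of f] int by (simp add: case_prod_beta')
  from integral_count_space_Times[OF finite_digits this] show ?thesis
    using integral_bij_count_space[OF bij_digits[OF assms(1)], of f]
    by (simp add: case_prod_beta')
qed

lemma cube_dilate:
  assumes "\<eta> \<in> cube (2 * pi)" "0 < lam"
  shows "(1 / real lam) *\<^sub>R (\<eta> + lat k) \<in> cube (2 * pi) \<longleftrightarrow> k \<in> digits lam"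
proof -
  have "0 \<le> (\<eta> $ i + 2 * pi * real_of_int (k $ i)) / real lam \<and> (\<eta> $ i + 2 * pi * real_of_int (k $ i)) / real lam < 2 * pi
     \<longleftrightarrow> 0 \<le> k $ i \<and> k $ i < int lam" for i
  proof -
    have e: "0 \<le> \<eta> $ i" "\<eta> $ i < 2 * pi" using assms(1) by (auto simp: cube_def)
    have "0 \<le> \<eta> $ i + 2 * pi * real_of_int (k $ i) \<longleftrightarrow> 0 \<le> k $ i"
    proof
      assume "0 \<le> \<eta> $ i + 2 * pi * real_of_int (k $ i)"
      then have "0 < 2 * pi * (1 + real_of_int (k $ i))" using e by (simp add: algebra_simps)
      then have "0 < 1 + real_of_int (k $ i)" by (simp add: zero_less_mult_iff)
      then show "0 \<le> k $ i" by linarith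
    qed (use e in simp)
    moreover have "\<eta> $ i + 2 * pi * real_of_int (k $ i) < 2 * pi * real lam \<longleftrightarrow> k $ i < int lam"
    proof
      assume "\<eta> $ i + 2 * pi * real_of_int (k $ i) < 2 * pi * real lam"
      then have "2 * pi * real_of_int (k $ i) < 2 * pi * real lam" using e by linarith
      then have "real_of_int (k $ i) < real lam" by simp
      then show "k $ i < int lam" by linarith
    next
      assume "k $ i < int lam"
      then have "real_of_int (k $ i) + 1 \<le> real lam" by linarith
      then have "2 * pi * (real_of_int (k $ i) + 1) \<le> 2 * pi * real lam" by (intro mult_left_mono) auto
      then show "\<eta> $ i + 2 * pi * real_of_int (k $ i) < 2 * pi * real lam" using e by (simp add: algebra_simps)
    qed
    ultimately show ?thesis using assms(2) by (simp add: field_simps)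
  qed
  then show ?thesis unfolding cube_def digits_def lat_def by simp
qed

text \<open>The substitution \<xi> = \<eta> / lam enlarges the cube to side 2 pi lam. Folding it
  back leaves one term for each digit vector, by \<open>cube_dilate\<close>.\<close>

lemma nn_integral_dilate_TM:
  fixes V :: "real ^ 'n \<Rightarrow> ennreal"
  assumes [measurable]: "V \<in> borel_measurable borel" and lam: "0 < lam"
  shows "ennreal (real lam ^ CARD('n)) * (\<integral>\<^sup>+\<xi>. V \<xi> \<partial>TM)
     = (\<integral>\<^sup>+\<eta>. (\<Sum>m\<in>digits lam. V ((1 / real lam) *\<^sub>R (\<eta> + lat m))) \<partial>TM)"
proof -
  let ?V = "\<lambda>\<xi>. V \<xi> * indicator (cube (2 * pi)) \<xi>"
  have "(\<integral>\<^sup>+\<xi>. V \<xi> \<partial>TM) = (\<integral>\<^sup>+\<xi>. ?V \<xi> \<partial>lborel)" by (rule nn_integral_TM)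
  also have "\<dots> = ennreal ((1 / real lam) ^ CARD('n)) * (\<integral>\<^sup>+\<xi>. ?V ((1 / real lam) *\<^sub>R \<xi>) \<partial>lborel)"
    using nn_integral_lborel_affine[of ?V "1 / real lam" 0] lam by (simp add: DIM_cart)
  also have "(\<integral>\<^sup>+\<xi>. ?V ((1 / real lam) *\<^sub>R \<xi>) \<partial>lborel) = (\<integral>\<^sup>+\<eta>. (\<integral>\<^sup>+k. ?V ((1 / real lam) *\<^sub>R (\<eta> + lat k)) \<partial>count_space UNIV) \<partial>TM)"
    by (rule nn_integral_tile_TM) measurable
  also have "\<dots> = (\<integral>\<^sup>+\<eta>. (\<Sum>m\<in>digits lam. V ((1 / real lam) *\<^sub>R (\<eta> + lat m))) \<partial>TM)"
  proof (rule nn_integral_cong)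
    fix \<eta> :: "real ^ 'n" assume "\<eta> \<in> space TM"
    then have \<eta>: "\<eta> \<in> cube (2 * pi)" by (simp add: space_restrict_space)
    have "(\<integral>\<^sup>+k. ?V ((1 / real lam) *\<^sub>R (\<eta> + lat k)) \<partial>count_space UNIV)
      = (\<integral>\<^sup>+k. V ((1 / real lam) *\<^sub>R (\<eta> + lat k)) * indicator (digits lam) k \<partial>count_space UNIV)"
      by (intro nn_integral_cong) (simp add: indicator_def cube_dilate[OF \<eta> lam])
    also have "\<dots> = (\<integral>\<^sup>+k. V ((1 / real lam) *\<^sub>R (\<eta> + lat k)) \<partial>count_space (digits lam))"
      by (simp add: nn_integral_count_space_indicator)
    also have "\<dots> = (\<Sum>m\<in>digits lam. V ((1 / real lam) *\<^sub>R (\<eta> + lat m)))"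
      by (rule nn_integral_count_space_finite[OF finite_digits])
    finally show "(\<integral>\<^sup>+k. ?V ((1 / real lam) *\<^sub>R (\<eta> + lat k)) \<partial>count_space UNIV) = (\<Sum>m\<in>digits lam. V ((1 / real lam) *\<^sub>R (\<eta> + lat m)))" .
  qed
  finally show ?thesis
    using lam by (simp add: mult.assoc[symmetric] ennreal_mult[symmetric] power_mult_distrib[symmetric])
qed

section \<open>The refinable function\<close>

text \<open>The oblique extension principle, detached from rational masks. The matrix identity over
  the cosets of \<eta> is encoded as an equality of quadratic forms in u: this is the form in which
  brackets are inserted, and special choices of u give the bounds on the masks. The identity is
  required only almost everywhere because the masks may have poles.\<close>

locale oep =
  fixes lam :: nat and \<tau> :: "real ^ 'n \<Rightarrow> complex" and S :: "real ^ 'n \<Rightarrow> real"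
    and I :: "'i set" and q :: "'i \<Rightarrow> real ^ 'n \<Rightarrow> complex"
  assumes lam: "2 \<le> lam" and finite_I: "finite I"
    and \<tau>_measurable [measurable]: "\<tau> \<in> borel_measurable borel"
    and S_measurable [measurable]: "S \<in> borel_measurable borel"
    and q_measurable: "\<And>i. i \<in> I \<Longrightarrow> q i \<in> borel_measurable borel"
    and \<tau>_periodic: "\<And>\<xi> k. \<tau> (\<xi> + lat k) = \<tau> \<xi>"
    and S_periodic: "\<And>\<xi> k. S (\<xi> + lat k) = S \<xi>"
    and q_periodic: "\<And>i \<xi> k. i \<in> I \<Longrightarrow> q i (\<xi> + lat k) = q i \<xi>"
    and S_pos: "AE \<xi> in lborel. 0 < S \<xi>"
    and S_0: "isCont S 0" "S 0 = 1"
    and \<tau>_Lipschitz: "\<exists>C \<delta>. 0 < \<delta> \<and> (\<forall>\<xi>. norm \<xi> < \<delta> \<longrightarrow> cmod (\<tau> \<xi> - 1) \<le> C * norm \<xi>)"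
    and card_digits: "card (digits lam :: (int ^ 'n) set) = lam ^ CARD('n)"
    and extension: "AE \<eta> in lborel. \<forall>u. S \<eta> * (cmod (\<Sum>m\<in>digits lam. cnj (\<tau> ((1 / real lam) *\<^sub>R (\<eta> + lat m))) * u m))\<^sup>2
        + (\<Sum>i\<in>I. (cmod (\<Sum>m\<in>digits lam. cnj (q i ((1 / real lam) *\<^sub>R (\<eta> + lat m))) * u m))\<^sup>2)
      = (\<Sum>m\<in>digits lam. S ((1 / real lam) *\<^sub>R (\<eta> + lat m)) * (cmod (u m))\<^sup>2)"
begin

abbreviation \<Phi> :: "real ^ 'n \<Rightarrow> complex" where "\<Phi> \<equiv> refinable_hat lam \<tau>"

lemma lam_pos: "0 < lam" "0 < real lam" "1 < real lam" using lam by auto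

lemma tendsto_inverse_power: "(\<lambda>J. (1 / real lam) ^ J) \<longlonglongrightarrow> 0"
  using lam_pos by (intro LIMSEQ_realpow_zero) auto

text \<open>The Lipschitz bound at 0 makes the factors deviate from 1 by a geometric
  sequence.\<close>

lemma convergent_prod_\<tau>: "convergent_prod (\<lambda>j. \<tau> ((1 / real lam ^ Suc j) *\<^sub>R \<xi>))"
proof -
  obtain C \<delta> where \<delta>: "0 < \<delta>" and C: "\<And>\<xi>. norm \<xi> < \<delta> \<Longrightarrow> cmod (\<tau> \<xi> - 1) \<le> C * norm \<xi>"
    using \<tau>_Lipschitz by blast
  have norm_eq: "norm ((1 / real lam ^ Suc j) *\<^sub>R \<xi>) = (1 / real lam) ^ j * (norm \<xi> / real lam)" for j
    using lam_pos by (simp add: power_divide)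
  have "(\<lambda>j. (1 / real lam) ^ j * (norm \<xi> / real lam)) \<longlonglongrightarrow> 0 * (norm \<xi> / real lam)"
    by (intro tendsto_intros tendsto_inverse_power)
  then have "\<forall>\<^sub>F j in sequentially. (1 / real lam) ^ j * (norm \<xi> / real lam) < \<delta>"
    using \<delta> by (intro order_tendstoD(2)) auto
  then have "\<forall>\<^sub>F j in sequentially. norm (cmod (\<tau> ((1 / real lam ^ Suc j) *\<^sub>R \<xi>) - 1)) \<le> (C * (norm \<xi> / real lam)) * (1 / real lam) ^ j"
  proof eventually_elim
    case (elim j)
    then have "norm ((1 / real lam ^ Suc j) *\<^sub>R \<xi>) < \<delta>" by (simp only: norm_eq)
    from C[OF this] show ?case unfolding norm_eq by (simp add: mult_ac)
  qed
  moreover have "summable (\<lambda>j. (C * (norm \<xi> / real lam)) * (1 / real lam) ^ j)"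
    by (rule summable_mult[OF summable_geometric]) (use lam_pos in simp)
  ultimately have "summable (\<lambda>j. cmod (\<tau> ((1 / real lam ^ Suc j) *\<^sub>R \<xi>) - 1))"
    by (rule summable_comparison_test_ev)
  then show ?thesis
    by (intro abs_convergent_prod_imp_convergent_prod summable_imp_abs_convergent_prod)
qed

definition part :: "nat \<Rightarrow> real ^ 'n \<Rightarrow> complex" where
  "part J \<xi> = (\<Prod>j<J. \<tau> ((1 / real lam ^ Suc j) *\<^sub>R \<xi>))"

lemma part_measurable [measurable]: "part J \<in> borel_measurable borel"
  unfolding part_def[abs_def] by measurable

lemma part_LIMSEQ: "(\<lambda>J. part J \<xi>) \<longlonglongrightarrow> \<Phi> \<xi>"
proof -
  have "(\<lambda>J. part (Suc J) \<xi>) \<longlonglongrightarrow> \<Phi> \<xi>"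
    using convergent_prod_LIMSEQ[OF convergent_prod_\<tau>[of \<xi>]]
    by (simp add: part_def refinable_hat_def lessThan_Suc_atMost)
  then show ?thesis by (rule LIMSEQ_imp_Suc)
qed

lemma \<Phi>_measurable [measurable]: "\<Phi> \<in> borel_measurable borel"
  by (rule borel_measurable_LIMSEQ_metric[OF part_measurable part_LIMSEQ])

lemma part_Suc: "part (Suc J) (real lam *\<^sub>R \<xi>) = \<tau> \<xi> * part J \<xi>"
  unfolding part_def prod.lessThan_Suc_shift using lam_pos by (simp add: mult.commute)

lemma refinement: "\<Phi> \<xi> = \<tau> ((1 / real lam) *\<^sub>R \<xi>) * \<Phi> ((1 / real lam) *\<^sub>R \<xi>)"
proof -
  let ?y = "(1 / real lam) *\<^sub>R \<xi>"
  have "(\<lambda>J. part (Suc J) (real lam *\<^sub>R ?y)) \<longlonglongrightarrow> \<tau> ?y * \<Phi> ?y"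
    unfolding part_Suc by (intro tendsto_intros part_LIMSEQ)
  moreover have "(\<lambda>J. part (Suc J) (real lam *\<^sub>R ?y)) \<longlonglongrightarrow> \<Phi> (real lam *\<^sub>R ?y)"
    using part_LIMSEQ by (rule LIMSEQ_Suc)
  ultimately show ?thesis using LIMSEQ_unique lam_pos by fastforce
qed

lemma refinement_part: "\<Phi> \<xi> = part J \<xi> * \<Phi> ((1 / real lam ^ J) *\<^sub>R \<xi>)"
proof (induction J)
  case (Suc J)
  have "(1 / real lam) *\<^sub>R ((1 / real lam ^ J) *\<^sub>R \<xi>) = (1 / real lam ^ Suc J) *\<^sub>R \<xi>" by simp
  then show ?case
    using Suc refinement[of "(1 / real lam ^ J) *\<^sub>R \<xi>"] by (simp add: part_def mult.assoc)
qed (simp add: part_def)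

text \<open>This takes the place of continuity of \<Phi> at 0. By \<open>refinement_part\<close> the
  values are quotients \<Phi> y / part J y, which tend to 1 when \<Phi> y is nonzero.\<close>

lemma \<Phi>_scaled_LIMSEQ: "(\<lambda>J. \<Phi> ((1 / real lam ^ J) *\<^sub>R \<xi>)) \<longlonglongrightarrow> 1"
proof -
  obtain M p where "raw_has_prod (\<lambda>j. \<tau> ((1 / real lam ^ Suc j) *\<^sub>R \<xi>)) M p"
    using convergent_prod_\<tau>[of \<xi>] unfolding convergent_prod_def by blast
  then have lim: "(\<lambda>n. \<Prod>i\<le>n. \<tau> ((1 / real lam ^ Suc (i + M)) *\<^sub>R \<xi>)) \<longlonglongrightarrow> p" and "p \<noteq> 0"
    unfolding raw_has_prod_def by auto
  \<comment> \<open>Starting M scales further in skips the factors that may vanish: the remaining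
    product is p, which is nonzero.\<close>
  define y where "y = (1 / real lam ^ M) *\<^sub>R \<xi>"
  have part_y: "part (Suc n) y = (\<Prod>i\<le>n. \<tau> ((1 / real lam ^ Suc (i + M)) *\<^sub>R \<xi>))" for n
    unfolding part_def y_def lessThan_Suc_atMost
    by (intro prod.cong refl arg_cong[where f=\<tau>]) (simp add: power_add)
  have "(\<lambda>n. part (Suc n) y) \<longlonglongrightarrow> p" using lim part_y by simp
  then have "(\<lambda>n. part n y) \<longlonglongrightarrow> p" by (rule LIMSEQ_imp_Suc)
  then have "\<Phi> y = p" using part_LIMSEQ LIMSEQ_unique by blast
  have "part J y \<noteq> 0" for J
    using refinement_part[of y J] \<open>\<Phi> y = p\<close> \<open>p \<noteq> 0\<close> by auto
  then have "\<Phi> ((1 / real lam ^ J) *\<^sub>R y) = \<Phi> y / part J y" for J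
    using refinement_part[of y J] by (metis nonzero_mult_div_cancel_left)
  moreover have "(\<lambda>J. \<Phi> y / part J y) \<longlonglongrightarrow> \<Phi> y / \<Phi> y"
    using \<open>\<Phi> y = p\<close> \<open>p \<noteq> 0\<close> by (intro tendsto_intros part_LIMSEQ) auto
  ultimately have "(\<lambda>J. \<Phi> ((1 / real lam ^ J) *\<^sub>R y)) \<longlonglongrightarrow> 1"
    using \<open>\<Phi> y = p\<close> \<open>p \<noteq> 0\<close> by simp
  then have "(\<lambda>J. \<Phi> ((1 / real lam ^ (J + M)) *\<^sub>R \<xi>)) \<longlonglongrightarrow> 1"
    by (simp add: y_def power_add)
  then show ?thesis by (rule LIMSEQ_offset)
qed

lemma S_scaled_LIMSEQ: "(\<lambda>J. S ((1 / real lam ^ J) *\<^sub>R \<xi>)) \<longlonglongrightarrow> 1"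
proof -
  have "(\<lambda>J. (1 / real lam ^ J) *\<^sub>R \<xi>) \<longlonglongrightarrow> 0 *\<^sub>R \<xi>"
    using tendsto_inverse_power by (intro tendsto_intros) (simp add: power_divide)
  then show ?thesis using isCont_tendsto_compose[OF S_0(1)] S_0(2) by fastforce
qed

section \<open>Consequences of the extension identity for the masks and the refinable
  function\<close>

abbreviation \<zeta> :: "real ^ 'n \<Rightarrow> int ^ 'n \<Rightarrow> real ^ 'n" where
  "\<zeta> \<eta> m \<equiv> (1 / real lam) *\<^sub>R (\<eta> + lat m)"

lemma \<zeta>_affine: "\<zeta> \<eta> m = (1 / real lam) *\<^sub>R lat m + (1 / real lam) *\<^sub>R \<eta>"
  by (simp add: scaleR_add_right)

lemma AE_\<zeta>:
  assumes "AE \<xi> in lborel. P \<xi>"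
  shows "AE \<eta> in lborel. \<forall>m. P (\<zeta> \<eta> m)"
  unfolding AE_all_countable \<zeta>_affine using AE_lborel_affine[OF assms] lam_pos by auto

text \<open>Testing the extension identity with \<open>u m = \<tau> (\<zeta> m) / S (\<zeta> m)\<close>.\<close>

lemma mask_bound: "AE \<eta> in lborel. (\<Sum>m\<in>digits lam. (cmod (\<tau> (\<zeta> \<eta> m)))\<^sup>2 / S (\<zeta> \<eta> m)) \<le> 1 / S \<eta>"
  using extension S_pos AE_\<zeta>[OF S_pos]
proof eventually_elim
  case (elim \<eta>)
  define X where "X = (\<Sum>m\<in>digits lam. (cmod (\<tau> (\<zeta> \<eta> m)))\<^sup>2 / S (\<zeta> \<eta> m))"
  have "X \<ge> 0" unfolding X_def using elim(3) by (intro sum_nonneg) (simp add: less_imp_le)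
  define u where "u m = \<tau> (\<zeta> \<eta> m) / of_real (S (\<zeta> \<eta> m))" for m
  have "(\<Sum>m\<in>digits lam. cnj (\<tau> (\<zeta> \<eta> m)) * u m) = of_real X"
    unfolding X_def u_def of_real_sum of_real_divide complex_norm_square by (simp add: mult.commute)
  moreover have "(\<Sum>m\<in>digits lam. S (\<zeta> \<eta> m) * (cmod (u m))\<^sup>2) = X"
    unfolding X_def u_def using elim(3)
    by (intro sum.cong refl) (auto simp: norm_divide power2_eq_square less_imp_neq[symmetric])
  moreover have "0 \<le> (\<Sum>i\<in>I. (cmod (\<Sum>m\<in>digits lam. cnj (q i (\<zeta> \<eta> m)) * u m))\<^sup>2)"
    by (intro sum_nonneg) simp
  \<comment> \<open>For this u the low-pass sum and the right-hand side are both X. Dropping the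
    nonnegative terms of the q i leaves a quadratic inequality, to be divided by X unless X =
    0.\<close>
  ultimately have "S \<eta> * X\<^sup>2 \<le> X" using elim(1)[rule_format, of u] by simp
  then have "X * (S \<eta> * X) \<le> X * 1" by (simp add: power2_eq_square mult_ac)
  then have "S \<eta> * X \<le> 1 \<or> X = 0" using \<open>X \<ge> 0\<close> by (auto simp: mult_le_cancel_left)
  then show ?case using elim(2) unfolding X_def[symmetric] by (auto simp: field_simps)
qed

lemma zero_in_digits: "0 \<in> digits lam" using lam by (simp add: digits_def)

text \<open>The extension identity is tested with the unit vector at the digit 0. The resulting
  bound at \<eta> / lam holds for almost every \<eta>, hence at almost every point.\<close>

lemma q_bound:
  assumes "i \<in> I"
  shows "AE \<xi> in lborel. (cmod (q i \<xi>))\<^sup>2 \<le> S \<xi>"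
proof -
  have "AE \<eta> in lborel. (cmod (q i (\<zeta> \<eta> 0)))\<^sup>2 \<le> S (\<zeta> \<eta> 0)"
    using extension S_pos
  proof eventually_elim
    case (elim \<eta>)
    define u where "u m = (if m = 0 then 1 else 0 :: complex)" for m :: "int ^ 'n"
    have eq: "(\<Sum>m\<in>digits lam. f m * u m) = f 0" for f
      unfolding u_def by (simp add: if_distrib[of "(*) _"] zero_in_digits finite_digits cong: if_cong)
    have "(\<Sum>m\<in>digits lam. S (\<zeta> \<eta> m) * (cmod (u m))\<^sup>2) = S (\<zeta> \<eta> 0)"
      unfolding u_def by (simp add: if_distrib[of "\<lambda>x. _ * (cmod x)\<^sup>2"] zero_in_digits finite_digits cong: if_cong)
    then have *: "S \<eta> * (cmod (cnj (\<tau> (\<zeta> \<eta> 0))))\<^sup>2 + (\<Sum>i\<in>I. (cmod (cnj (q i (\<zeta> \<eta> 0))))\<^sup>2) = S (\<zeta> \<eta> 0)"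
      using elim(1)[rule_format, of u] by (simp only: eq)
    have "(cmod (cnj (q i (\<zeta> \<eta> 0))))\<^sup>2 \<le> (\<Sum>i\<in>I. (cmod (cnj (q i (\<zeta> \<eta> 0))))\<^sup>2)"
      using assms finite_I by (intro member_le_sum) auto
    moreover have "0 \<le> S \<eta> * (cmod (cnj (\<tau> (\<zeta> \<eta> 0))))\<^sup>2" using elim(2) by simp
    ultimately show ?case using * by simp
  qed
  from AE_lborel_affine[OF this, of "real lam" 0] show ?thesis using lam_pos by simp
qed

text \<open>Iterates of the cascade started from 1/S on the cube [-pi, pi)^n. This start makes the
  lattice sum of the first iterate exactly 1/S, and the centred cube makes the indicator eventually
  1 at every point.\<close>

definition cascade :: "nat \<Rightarrow> real ^ 'n \<Rightarrow> ennreal" where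
  "cascade J \<xi> = ennreal ((cmod (part J \<xi>))\<^sup>2 / S ((1 / real lam ^ J) *\<^sub>R \<xi>))
      * indicator {x. x - (\<chi> i. - pi) \<in> cube (2 * pi)} ((1 / real lam ^ J) *\<^sub>R \<xi>)"

lemma cascade_Suc: "cascade (Suc J) (real lam *\<^sub>R y) = ennreal ((cmod (\<tau> y))\<^sup>2) * cascade J y"
proof -
  have eq: "(1 / real lam ^ Suc J) *\<^sub>R (real lam *\<^sub>R y) = (1 / real lam ^ J) *\<^sub>R y" using lam_pos by simp
  show ?thesis
    unfolding cascade_def part_Suc eq norm_mult power_mult_distrib times_divide_eq_right[symmetric]
    by (subst ennreal_mult') (simp_all add: mult.assoc)
qed

text \<open>By \<open>mask_bound\<close> the transfer operator of |\<tau>|^2 maps 1/S below itself.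
  Splitting the lattice by residues modulo lam shows that passing from J to J + 1 applies this
  operator to the lattice sum.\<close>

lemma cascade_bound: "AE \<xi> in lborel. (\<integral>\<^sup>+k. cascade J (\<xi> + lat k) \<partial>count_space UNIV) \<le> ennreal (1 / S \<xi>)"
proof (induction J)
  case 0
  have "(\<integral>\<^sup>+k. cascade 0 (\<xi> + lat k) \<partial>count_space UNIV) = ennreal (1 / S \<xi>)" for \<xi>
  proof -
    have "(\<integral>\<^sup>+k. cascade 0 (\<xi> + lat k) \<partial>count_space UNIV)
      = ennreal (1 / S \<xi>) * (\<integral>\<^sup>+k. indicator {x. x - (\<chi> i. - pi) \<in> cube (2 * pi)} (\<xi> + lat k) \<partial>count_space UNIV)"
      unfolding cascade_def part_def by (simp add: S_periodic nn_integral_cmult)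
    then show ?thesis
      unfolding lat_def by (simp add: fundamental_domain_sum[OF fundamental_domain_cube])
  qed
  then show ?case by simp
next
  case (Suc J)
  show ?case using AE_\<zeta>[OF Suc] mask_bound AE_\<zeta>[OF S_pos]
  proof eventually_elim
    case (elim \<xi>)
    have eq: "\<xi> + lat (m + sc lam k) = real lam *\<^sub>R (\<zeta> \<xi> m + lat k)" for m k
      using lam_pos by (simp add: lat_add lat_sc scaleR_add_right)
    have "(\<integral>\<^sup>+k. cascade (Suc J) (\<xi> + lat k) \<partial>count_space UNIV)
      = (\<Sum>m\<in>digits lam. \<integral>\<^sup>+k. ennreal ((cmod (\<tau> (\<zeta> \<xi> m)))\<^sup>2) * cascade J (\<zeta> \<xi> m + lat k) \<partial>count_space UNIV)"
      by (subst nn_integral_digits[OF lam_pos(1)]) (simp only: eq cascade_Suc \<tau>_periodic)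
    also have "\<dots> = (\<Sum>m\<in>digits lam. ennreal ((cmod (\<tau> (\<zeta> \<xi> m)))\<^sup>2) * (\<integral>\<^sup>+k. cascade J (\<zeta> \<xi> m + lat k) \<partial>count_space UNIV))"
      by (simp add: nn_integral_cmult)
    also have "\<dots> \<le> (\<Sum>m\<in>digits lam. ennreal ((cmod (\<tau> (\<zeta> \<xi> m)))\<^sup>2) * ennreal (1 / S (\<zeta> \<xi> m)))"
      using elim(1) by (intro sum_mono mult_left_mono) auto
    also have "\<dots> = ennreal (\<Sum>m\<in>digits lam. (cmod (\<tau> (\<zeta> \<xi> m)))\<^sup>2 / S (\<zeta> \<xi> m))"
      using elim(3) by (subst sum_ennreal[symmetric]) (auto simp: ennreal_mult[symmetric] less_imp_le)
    also have "\<dots> \<le> ennreal (1 / S \<xi>)" using elim(2) by (rule ennreal_leI)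
    finally show ?case .
  qed
qed

lemma cascade_LIMSEQ: "(\<lambda>J. cascade J x) \<longlonglongrightarrow> ennreal ((cmod (\<Phi> x))\<^sup>2)"
proof -
  have "(\<lambda>J. ennreal ((cmod (part J x))\<^sup>2 / S ((1 / real lam ^ J) *\<^sub>R x))) \<longlonglongrightarrow> ennreal ((cmod (\<Phi> x))\<^sup>2 / 1)"
    by (intro tendsto_intros part_LIMSEQ S_scaled_LIMSEQ) simp
  moreover have "\<forall>\<^sub>F J in sequentially. cascade J x = ennreal ((cmod (part J x))\<^sup>2 / S ((1 / real lam ^ J) *\<^sub>R x))"
  proof -
    have "(\<lambda>J. (1 / real lam) ^ J * norm x) \<longlonglongrightarrow> 0 * norm x"
      by (intro tendsto_intros tendsto_inverse_power)
    then have "\<forall>\<^sub>F J in sequentially. (1 / real lam) ^ J * norm x < pi"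
      by (intro order_tendstoD(2)) auto
    then show ?thesis
    proof eventually_elim
      case (elim J)
      let ?y = "(1 / real lam ^ J) *\<^sub>R x"
      have "norm ?y < pi" using elim by (simp add: power_divide)
      then have y: "\<bar>?y $ i\<bar> < pi" for i using component_le_norm_cart[of ?y i] by linarith
      have "?y - (\<chi> i. - pi) \<in> cube (2 * pi)"
        unfolding cube_def mem_Collect_eq vector_minus_component vec_lambda_beta
      proof (intro allI)
        fix i
        show "0 \<le> ?y $ i - - pi \<and> ?y $ i - - pi < 2 * pi"
          using y[of i] unfolding abs_less_iff by (intro conjI; linarith)
      qed
      then show ?case unfolding cascade_def by (simp only: indicator_simps(1) mem_Collect_eq mult_1_right)
    qed
  qed
  ultimately show ?thesis by (simp add: tendsto_cong)
qed

lemma \<Phi>_bracket_bound: "AE \<xi> in lborel. ennreal (S \<xi>) * sqs \<Phi> \<xi> \<le> 1"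
proof -
  have "AE \<xi> in lborel. \<forall>J. (\<integral>\<^sup>+k. cascade J (\<xi> + lat k) \<partial>count_space UNIV) \<le> ennreal (1 / S \<xi>)"
    unfolding AE_all_countable using cascade_bound by blast
  then show ?thesis using S_pos
  proof eventually_elim
    case (elim \<xi>)
    \<comment> \<open>Fatou's lemma for the lattice sum lets the bound, uniform in J, pass to the
      limit.\<close>
    have "sqs \<Phi> \<xi> = (\<integral>\<^sup>+k. liminf (\<lambda>J. cascade J (\<xi> + lat k)) \<partial>count_space UNIV)"
      unfolding sqs_def
    proof (rule nn_integral_cong)
      fix k :: "int ^ 'n"
      show "ennreal ((cmod (\<Phi> (\<xi> + lat k)))\<^sup>2) = liminf (\<lambda>J. cascade J (\<xi> + lat k))"
        by (rule lim_imp_Liminf[OF sequentially_bot cascade_LIMSEQ, symmetric])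
    qed
    also have "\<dots> \<le> liminf (\<lambda>J. \<integral>\<^sup>+k. cascade J (\<xi> + lat k) \<partial>count_space UNIV)"
      by (rule nn_integral_liminf) simp
    also have "\<dots> \<le> ennreal (1 / S \<xi>)"
      by (rule Liminf_le) (use elim in auto)
    finally have "ennreal (S \<xi>) * sqs \<Phi> \<xi> \<le> ennreal (S \<xi>) * ennreal (1 / S \<xi>)" by (rule mult_left_mono) simp
    also have "\<dots> = 1" using elim(2) by (simp add: ennreal_mult[symmetric])
    finally show ?case .
  qed
qed

section \<open>The generators on the Fourier side\<close>

definition \<Psi> :: "'i \<Rightarrow> real ^ 'n \<Rightarrow> complex" where
  "\<Psi> i \<xi> = q i ((1 / real lam) *\<^sub>R \<xi>) * \<Phi> ((1 / real lam) *\<^sub>R \<xi>)"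

lemma \<Psi>_measurable: "i \<in> I \<Longrightarrow> \<Psi> i \<in> borel_measurable borel"
proof -
  assume "i \<in> I"
  note [measurable] = q_measurable[OF this]
  show ?thesis unfolding \<Psi>_def[abs_def] by measurable
qed

lemma weighted_\<Phi>_integral: "(\<integral>\<^sup>+\<xi>. ennreal (S \<xi> * (cmod (\<Phi> \<xi>))\<^sup>2) \<partial>lborel) \<le> ennreal ((2 * pi) ^ CARD('n))"
proof -
  have "(\<integral>\<^sup>+\<xi>. ennreal (S \<xi> * (cmod (\<Phi> \<xi>))\<^sup>2) \<partial>lborel)
    = (\<integral>\<^sup>+\<xi>. (\<integral>\<^sup>+k. ennreal (S (\<xi> + lat k) * (cmod (\<Phi> (\<xi> + lat k)))\<^sup>2) \<partial>count_space UNIV) \<partial>TM)"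
    by (rule nn_integral_tile_TM) measurable
  also have "\<dots> = (\<integral>\<^sup>+\<xi>. ennreal (S \<xi>) * sqs \<Phi> \<xi> \<partial>TM)"
    unfolding sqs_def S_periodic by (simp add: ennreal_mult'' nn_integral_cmult)
  also have "\<dots> \<le> (\<integral>\<^sup>+\<xi>. 1 \<partial>(TM :: (real ^ 'n) measure))"
    by (intro nn_integral_mono_AE AE_TM \<Phi>_bracket_bound)
  also have "\<dots> = ennreal ((2 * pi) ^ CARD('n))" using emeasure_TM[where 'n='n] by simp
  finally show ?thesis .
qed

text \<open>By \<open>q_bound\<close> the weight S dominates |q i|^2, so the weighted mass of \<Phi>
  bounds the norm up to the dilation factor.\<close>

lemma \<Psi>_square_integrable:
  assumes i: "i \<in> I"
  shows "square_integrable (\<Psi> i)"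
proof -
  note [measurable] = q_measurable[OF i] \<Psi>_measurable[OF i]
  have "N2 (\<Psi> i) = ennreal (real lam ^ CARD('n)) * N2 (\<lambda>\<xi>. q i \<xi> * \<Phi> \<xi>)"
    using N2_affine[of "\<Psi> i" "real lam" 0] lam_pos by (simp add: \<Psi>_def)
  also have "N2 (\<lambda>\<xi>. q i \<xi> * \<Phi> \<xi>) \<le> (\<integral>\<^sup>+\<xi>. ennreal (S \<xi> * (cmod (\<Phi> \<xi>))\<^sup>2) \<partial>lborel)"
    unfolding N2_def
  proof (rule nn_integral_mono_AE, use q_bound[OF i] in eventually_elim)
    case (elim \<xi>)
    then show ?case
      by (intro ennreal_leI) (simp add: norm_mult power_mult_distrib mult_right_mono)
  qed
  also note weighted_\<Phi>_integral
  finally have "N2 (\<Psi> i) \<le> ennreal (real lam ^ CARD('n)) * ennreal ((2 * pi) ^ CARD('n))"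
    by (simp add: mult_left_mono)
  also have "\<dots> < \<infinity>" by (simp add: ennreal_mult_less_top)
  finally show ?thesis using \<Psi>_measurable[OF i] by (simp add: square_integrable_iff)
qed

section \<open>Telescoping over the scales\<close>


abbreviation dil :: "real \<Rightarrow> (real ^ 'n \<Rightarrow> complex) \<Rightarrow> real ^ 'n \<Rightarrow> complex" where
  "dil c G \<equiv> (\<lambda>x. G (c *\<^sub>R x))"

lemma square_integrable_dil: "square_integrable G \<Longrightarrow> c \<noteq> 0 \<Longrightarrow> square_integrable (dil c G)"
  using square_integrable_affine[of G c 0] by simp

lemma N2_dil: "square_integrable G \<Longrightarrow> c > 0 \<Longrightarrow> ennreal (c ^ CARD('n)) * N2 (dil c G) = N2 G"
  using N2_affine[of G c 0] by (simp add: square_integrable_iff)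

text \<open>Up to scaling, the energy that one scale retains of a dilated transform; the sums of
  \<open>D\<close> are its increments from scale to scale.\<close>

definition E :: "(real ^ 'n \<Rightarrow> complex) \<Rightarrow> ennreal" where
  "E G = (\<integral>\<^sup>+\<eta>. ennreal (S \<eta> * (cmod (br G \<Phi> \<eta>))\<^sup>2) \<partial>TM)"

lemma AE_sqs_\<Phi>_finite: "AE \<xi> in lborel. sqs \<Phi> \<xi> < \<infinity>"
  using \<Phi>_bracket_bound S_pos
proof eventually_elim
  case (elim \<xi>)
  show ?case
  proof (rule ccontr)
    assume "\<not> sqs \<Phi> \<xi> < \<infinity>"
    then have "sqs \<Phi> \<xi> = \<infinity>" by (simp add: not_less top_unique)
    then show False using elim by (simp add: ennreal_mult_top top_unique)
  qed
qed

lemma S_\<Phi>_le: "AE \<xi> in lborel. S \<xi> * (cmod (\<Phi> \<xi>))\<^sup>2 \<le> 1"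
  using \<Phi>_bracket_bound S_pos
proof eventually_elim
  case (elim \<xi>)
  have "ennreal ((cmod (\<Phi> (\<xi> + lat 0)))\<^sup>2) \<le> sqs \<Phi> \<xi>"
  proof -
    have "(\<integral>\<^sup>+k. ennreal ((cmod (\<Phi> (\<xi> + lat k)))\<^sup>2) * indicator {0} k \<partial>count_space UNIV) \<le> sqs \<Phi> \<xi>"
      unfolding sqs_def by (intro nn_integral_mono) (auto simp: indicator_def)
    then show ?thesis by (simp add: nn_integral_count_space_indicator[symmetric] nn_integral_count_space_finite)
  qed
  then have "ennreal (S \<xi>) * ennreal ((cmod (\<Phi> \<xi>))\<^sup>2) \<le> ennreal (S \<xi>) * sqs \<Phi> \<xi>"
    by (intro mult_left_mono) auto
  also note elim(1)
  finally show ?case using elim(2) by (simp add: ennreal_mult[symmetric])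
qed

text \<open>Cauchy-Schwarz for brackets followed by S [\<Phi>, \<Phi>] \<le> 1. The resulting bound,
  uniform over the scales, permits approximation of F in both limits.\<close>

lemma E_le:
  assumes [measurable]: "G \<in> borel_measurable borel"
  shows "E G \<le> N2 G"
proof -
  have "E G \<le> (\<integral>\<^sup>+\<eta>. sqs G \<eta> \<partial>TM)"
    unfolding E_def
  proof (rule nn_integral_mono_AE, rule AE_TM, use \<Phi>_bracket_bound S_pos in eventually_elim)
    case (elim \<eta>)
    have "ennreal (S \<eta> * (cmod (br G \<Phi> \<eta>))\<^sup>2) = ennreal (S \<eta>) * ennreal ((cmod (br G \<Phi> \<eta>))\<^sup>2)"
      using elim by (simp add: ennreal_mult)
    also have "\<dots> \<le> ennreal (S \<eta>) * (sqs G \<eta> * sqs \<Phi> \<eta>)"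
      by (intro mult_left_mono br_Cauchy_Schwarz) simp
    also have "\<dots> = sqs G \<eta> * (ennreal (S \<eta>) * sqs \<Phi> \<eta>)" by (simp add: mult_ac)
    also have "\<dots> \<le> sqs G \<eta> * 1" using elim by (intro mult_left_mono) auto
    finally show ?case by simp
  qed
  also have "\<dots> = N2 G" by (rule integral_sqs) measurable
  finally show ?thesis .
qed

lemma E_weighted:
  assumes G: "square_integrable G" and H: "square_integrable H" and e: "0 < e"
  shows "E (\<lambda>x. G x + H x) \<le> ennreal (1 + e) * E G + ennreal (1 + 1 / e) * E H"
proof -
  note [measurable] = square_integrable_measurable[OF G] square_integrable_measurable[OF H]
  have "E (\<lambda>x. G x + H x) \<le> (\<integral>\<^sup>+\<eta>. ennreal (1 + e) * ennreal (S \<eta> * (cmod (br G \<Phi> \<eta>))\<^sup>2)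
      + ennreal (1 + 1 / e) * ennreal (S \<eta> * (cmod (br H \<Phi> \<eta>))\<^sup>2) \<partial>TM)"
    unfolding E_def
  proof (rule nn_integral_mono_AE, rule AE_TM, use S_pos AE_sqs_finite[OF G] AE_sqs_finite[OF H] AE_sqs_\<Phi>_finite in eventually_elim)
    case (elim \<eta>)
    \<comment> \<open>The bracket is additive where both series converge absolutely, which happens
      almost everywhere.\<close>
    have "br (\<lambda>x. G x + H x) \<Phi> \<eta> = br G \<Phi> \<eta> + br H \<Phi> \<eta>"
      unfolding br_def distrib_right
      using elim by (intro Bochner_Integration.integral_add br_integrable)
    then have "S \<eta> * (cmod (br (\<lambda>x. G x + H x) \<Phi> \<eta>))\<^sup>2
      \<le> S \<eta> * ((1 + e) * (cmod (br G \<Phi> \<eta>))\<^sup>2 + (1 + 1 / e) * (cmod (br H \<Phi> \<eta>))\<^sup>2)"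
      using norm_add_weighted[OF e] elim(1) by (simp add: mult_left_mono)
    also have "\<dots> = (1 + e) * (S \<eta> * (cmod (br G \<Phi> \<eta>))\<^sup>2) + (1 + 1 / e) * (S \<eta> * (cmod (br H \<Phi> \<eta>))\<^sup>2)"
      by (simp add: algebra_simps)
    finally have "ennreal (S \<eta> * (cmod (br (\<lambda>x. G x + H x) \<Phi> \<eta>))\<^sup>2)
      \<le> ennreal ((1 + e) * (S \<eta> * (cmod (br G \<Phi> \<eta>))\<^sup>2) + (1 + 1 / e) * (S \<eta> * (cmod (br H \<Phi> \<eta>))\<^sup>2))"
      by (rule ennreal_leI)
    also have "\<dots> = ennreal (1 + e) * ennreal (S \<eta> * (cmod (br G \<Phi> \<eta>))\<^sup>2)
      + ennreal (1 + 1 / e) * ennreal (S \<eta> * (cmod (br H \<Phi> \<eta>))\<^sup>2)"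
    proof -
      have "ennreal (a * x + b * y) = ennreal a * ennreal x + ennreal b * ennreal y"
        if "0 \<le> a" "0 \<le> b" "0 \<le> x" "0 \<le> y" for a b x y
        using that by (simp add: ennreal_mult)
      then show ?thesis using e elim(1) by simp
    qed
    finally show ?case .
  qed
  also have "\<dots> = ennreal (1 + e) * E G + ennreal (1 + 1 / e) * E H"
    unfolding E_def by (simp add: nn_integral_add nn_integral_cmult)
  finally show ?thesis .
qed

text \<open>For k = m + lam k' the point \<eta> + 2 pi k is lam times a lattice translate of
  \<open>\<zeta> \<eta> m\<close>. The periodic factor r is constant along k' and leaves the inner
  sum. It is used both for \<tau> and for the q i.\<close>

lemma br_refine:
  assumes \<kappa>: "\<And>x. \<kappa> x = r ((1 / real lam) *\<^sub>R x) * \<Phi> ((1 / real lam) *\<^sub>R x)"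
    and r: "\<And>x k. r (x + lat k) = r x"
    and int: "integrable (count_space UNIV) (\<lambda>k. G (\<eta> + lat k) * cnj (\<kappa> (\<eta> + lat k)))"
  shows "br G \<kappa> \<eta> = (\<Sum>m\<in>digits lam. cnj (r (\<zeta> \<eta> m)) * br (dil (real lam) G) \<Phi> (\<zeta> \<eta> m))"
proof -
  have eq: "\<eta> + lat (m + sc lam k) = real lam *\<^sub>R (\<zeta> \<eta> m + lat k)" for m k
    using lam_pos by (simp add: lat_add lat_sc scaleR_add_right)
  have eq2: "\<kappa> (real lam *\<^sub>R (\<zeta> \<eta> m + lat k)) = r (\<zeta> \<eta> m) * \<Phi> (\<zeta> \<eta> m + lat k)" for m k
    unfolding \<kappa> using lam_pos r by simp
  have "br G \<kappa> \<eta> = (\<Sum>m\<in>digits lam. \<integral>k. G (real lam *\<^sub>R (\<zeta> \<eta> m + lat k)) * cnj (r (\<zeta> \<eta> m) * \<Phi> (\<zeta> \<eta> m + lat k)) \<partial>count_space UNIV)"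
    unfolding br_def by (subst integral_digits[OF lam_pos(1) int]) (simp only: eq eq2)
  also have "\<dots> = (\<Sum>m\<in>digits lam. cnj (r (\<zeta> \<eta> m)) * br (dil (real lam) G) \<Phi> (\<zeta> \<eta> m))"
    unfolding br_def by (intro sum.cong refl) (simp add: mult_ac flip: integral_mult_right_zero)
  finally show ?thesis .
qed

text \<open>The extension identity with u m equal to the bracket of the dilated G with \<Phi> at
  \<open>\<zeta> \<eta> m\<close>; by \<open>br_refine\<close> its inner sums are the brackets of G
  with \<Phi> and with the \<Psi> i.\<close>

lemma level_pointwise:
  assumes G: "square_integrable G"
  shows "AE \<eta> in lborel. S \<eta> * (cmod (br G \<Phi> \<eta>))\<^sup>2 + (\<Sum>i\<in>I. (cmod (br G (\<Psi> i) \<eta>))\<^sup>2)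
    = (\<Sum>m\<in>digits lam. S (\<zeta> \<eta> m) * (cmod (br (dil (real lam) G) \<Phi> (\<zeta> \<eta> m)))\<^sup>2)"
proof -
  have "AE \<eta> in lborel. \<forall>i\<in>I. sqs (\<Psi> i) \<eta> < \<infinity>"
    by (rule AE_finite_allI[OF finite_I]) (intro AE_sqs_finite \<Psi>_square_integrable)
  then show ?thesis
    using extension AE_sqs_finite[OF G] AE_sqs_\<Phi>_finite
  proof eventually_elim
    case (elim \<eta>)
    have 1: "br G \<Phi> \<eta> = (\<Sum>m\<in>digits lam. cnj (\<tau> (\<zeta> \<eta> m)) * br (dil (real lam) G) \<Phi> (\<zeta> \<eta> m))"
      using elim by (intro br_refine refinement \<tau>_periodic br_integrable)
    have 2: "br G (\<Psi> i) \<eta> = (\<Sum>m\<in>digits lam. cnj (q i (\<zeta> \<eta> m)) * br (dil (real lam) G) \<Phi> (\<zeta> \<eta> m))" if "i \<in> I" for i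
      using elim that by (intro br_refine \<Psi>_def q_periodic br_integrable) auto
    show ?case
      unfolding 1 using elim(2)[rule_format, of "\<lambda>m. br (dil (real lam) G) \<Phi> (\<zeta> \<eta> m)"] 2
      by simp
  qed
qed

definition D :: "(real ^ 'n \<Rightarrow> complex) \<Rightarrow> 'i \<Rightarrow> ennreal" where
  "D G i = (\<integral>\<^sup>+\<eta>. ennreal ((cmod (br G (\<Psi> i) \<eta>))\<^sup>2) \<partial>TM)"

lemma level:
  assumes G: "square_integrable G"
  shows "E G + (\<Sum>i\<in>I. D G i) = ennreal (real lam ^ CARD('n)) * E (dil (real lam) G)"
proof -
  note [measurable] = square_integrable_measurable[OF G]
  have m: "i \<in> I \<Longrightarrow> (\<lambda>\<eta>. ennreal ((cmod (br G (\<Psi> i) \<eta>))\<^sup>2)) \<in> borel_measurable TM" for i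
  proof -
    assume "i \<in> I"
    note [measurable] = \<Psi>_measurable[OF this]
    show ?thesis by measurable
  qed
  have "E G + (\<Sum>i\<in>I. D G i)
    = (\<integral>\<^sup>+\<eta>. ennreal (S \<eta> * (cmod (br G \<Phi> \<eta>))\<^sup>2) + (\<Sum>i\<in>I. ennreal ((cmod (br G (\<Psi> i) \<eta>))\<^sup>2)) \<partial>TM)"
    unfolding E_def D_def using m
    by (subst nn_integral_add) (auto simp: nn_integral_sum simp del: sum_ennreal intro!: borel_measurable_sum)
  also have "\<dots> = (\<integral>\<^sup>+\<eta>. (\<Sum>m\<in>digits lam. ennreal (S (\<zeta> \<eta> m) * (cmod (br (dil (real lam) G) \<Phi> (\<zeta> \<eta> m)))\<^sup>2)) \<partial>TM)"
  proof (rule nn_integral_cong_AE, rule AE_TM, use level_pointwise[OF G] S_pos AE_\<zeta>[OF S_pos] in eventually_elim)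
    case (elim \<eta>)
    have "ennreal (S \<eta> * (cmod (br G \<Phi> \<eta>))\<^sup>2) + (\<Sum>i\<in>I. ennreal ((cmod (br G (\<Psi> i) \<eta>))\<^sup>2))
      = ennreal (S \<eta> * (cmod (br G \<Phi> \<eta>))\<^sup>2 + (\<Sum>i\<in>I. (cmod (br G (\<Psi> i) \<eta>))\<^sup>2))"
      using elim(2) by (subst sum_ennreal) (auto simp: sum_nonneg)
    also have "\<dots> = (\<Sum>m\<in>digits lam. ennreal (S (\<zeta> \<eta> m) * (cmod (br (dil (real lam) G) \<Phi> (\<zeta> \<eta> m)))\<^sup>2))"
      unfolding elim(1) using elim(3) by (subst sum_ennreal) (auto simp: less_imp_le)
    finally show ?case .
  qed
  also have "\<dots> = ennreal (real lam ^ CARD('n)) * E (dil (real lam) G)"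
    unfolding E_def by (rule nn_integral_dilate_TM[symmetric, OF _ lam_pos(1)]) measurable
  finally show ?thesis .
qed

text \<open>Supplies the finiteness that \<open>parseval_br\<close> requires of the brackets with
  the generators.\<close>

lemma D_finite:
  assumes G: "square_integrable G" and "i \<in> I"
  shows "D G i < \<infinity>"
proof -
  have "D G i \<le> (\<Sum>i\<in>I. D G i)" using finite_I assms(2) by (intro member_le_sum) auto
  also have "\<dots> \<le> E G + (\<Sum>i\<in>I. D G i)" by simp
  also have "\<dots> \<le> ennreal (real lam ^ CARD('n)) * N2 (dil (real lam) G)"
    unfolding level[OF G] using square_integrable_dil[OF G, of "real lam"] lam_pos
    by (intro mult_left_mono E_le) (auto simp: square_integrable_iff)
  also have "\<dots> = N2 G" using lam_pos by (intro N2_dil G) auto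
  also have "\<dots> < \<infinity>" by (rule square_integrable_finite[OF G])
  finally show ?thesis .
qed

text \<open>The factor compensates the dilation, so that the bound by \<open>N2 F\<close> is the
  same for all j and consecutive values differ by exactly the contribution of scale j.\<close>

definition Q :: "(real ^ 'n \<Rightarrow> complex) \<Rightarrow> int \<Rightarrow> ennreal" where
  "Q F j = ennreal ((real lam powi j) ^ CARD('n)) * E (dil (real lam powi j) F)"

lemma scale_pos: "0 < real lam powi j" using lam_pos by simp

lemma square_integrable_scale:
  "square_integrable F \<Longrightarrow> square_integrable (dil (real lam powi j) F)"
  by (rule square_integrable_dil[OF _ less_imp_neq[OF scale_pos, symmetric]])

lemma Q_le:
  assumes F: "square_integrable F"
  shows "Q F j \<le> N2 F"
proof -
  have "Q F j \<le> ennreal ((real lam powi j) ^ CARD('n)) * N2 (dil (real lam powi j) F)"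
    unfolding Q_def using square_integrable_measurable[OF square_integrable_scale[OF F]]
    by (intro mult_left_mono E_le) auto
  also have "\<dots> = N2 F" by (rule N2_dil[OF F scale_pos])
  finally show ?thesis .
qed

lemma Q_Suc:
  assumes F: "square_integrable F"
  shows "Q F j + ennreal ((real lam powi j) ^ CARD('n)) * (\<Sum>i\<in>I. D (dil (real lam powi j) F) i) = Q F (j + 1)"
proof -
  let ?c = "real lam powi j"
  have c: "real lam powi (j + 1) = ?c * real lam" using lam_pos by (simp add: power_int_add)
  from level[OF square_integrable_scale[OF F]] have "ennreal (?c ^ CARD('n)) * (E (dil ?c F) + (\<Sum>i\<in>I. D (dil ?c F) i))
     = ennreal (?c ^ CARD('n)) * (ennreal (real lam ^ CARD('n)) * E (dil (?c * real lam) F))"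
    by simp
  then show ?thesis
    unfolding Q_def c using scale_pos[of j]
    by (simp add: distrib_left mult.assoc[symmetric] ennreal_mult[symmetric] power_mult_distrib)
qed

lemma Q_mono:
  assumes F: "square_integrable F" and "i \<le> j"
  shows "Q F i \<le> Q F j"
proof -
  have "Q F i \<le> Q F (i + int k)" for k
  proof (induction k)
    case (Suc k)
    have "Q F (i + int k) \<le> Q F (i + int k + 1)"
      using Q_Suc[OF F, of "i + int k"] by (metis le_iff_add)
    then show ?case using Suc by (simp add: add.assoc add.commute[of 1])
  qed simp
  from this[of "nat (j - i)"] show ?thesis using assms(2) by simp
qed

text \<open>The error term is \<open>N2 H\<close> at every scale, so both limits in j can be
  determined on dense classes.\<close>

lemma Q_weighted:
  assumes F: "square_integrable F" and H: "square_integrable H" and e: "0 < e"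
  shows "Q (\<lambda>x. F x + H x) j \<le> ennreal (1 + e) * Q F j + ennreal (1 + 1 / e) * N2 H"
proof -
  let ?c = "real lam powi j"
  have "Q (\<lambda>x. F x + H x) j \<le> ennreal (?c ^ CARD('n)) * (ennreal (1 + e) * E (dil ?c F) + ennreal (1 + 1 / e) * E (dil ?c H))"
    unfolding Q_def by (intro mult_left_mono E_weighted square_integrable_scale F H e) auto
  also have "\<dots> = ennreal (1 + e) * Q F j + ennreal (1 + 1 / e) * Q H j"
    unfolding Q_def by (simp add: distrib_left mult_ac)
  also have "\<dots> \<le> ennreal (1 + e) * Q F j + ennreal (1 + 1 / e) * N2 H"
    using Q_le[OF H] by (intro add_mono mult_left_mono) auto
  finally show ?thesis .
qed

text \<open>If the translates of the support of \<open>G\<close> are disjoint, no cancellation occurs in the bracket.\<close>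

lemma E_small_support:
  assumes [measurable]: "G \<in> borel_measurable borel" and supp: "\<And>x. norm x \<ge> pi \<Longrightarrow> G x = 0"
  shows "E G = (\<integral>\<^sup>+\<xi>. ennreal (S \<xi> * (cmod (G \<xi> * cnj (\<Phi> \<xi>)))\<^sup>2) \<partial>lborel)"
proof -
  have "ennreal (S \<eta> * (cmod (br G \<Phi> \<eta>))\<^sup>2) = (\<integral>\<^sup>+k. ennreal (S (\<eta> + lat k) * (cmod (G (\<eta> + lat k) * cnj (\<Phi> (\<eta> + lat k))))\<^sup>2) \<partial>count_space UNIV)" for \<eta>
  proof (cases "\<exists>k. G (\<eta> + lat k) \<noteq> 0")
    case True
    then obtain k0 where k0: "G (\<eta> + lat k0) \<noteq> 0" by blast
    have zero: "G (\<eta> + lat k) = 0" if "k \<noteq> k0" for k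
    proof (rule ccontr)
      assume "G (\<eta> + lat k) \<noteq> 0"
      then have n: "norm (\<eta> + lat k) < pi" "norm (\<eta> + lat k0) < pi" using k0 supp by (meson not_le)+
      obtain i where i: "k $ i \<noteq> k0 $ i" using \<open>k \<noteq> k0\<close> by (auto simp: vec_eq_iff)
      have "\<bar>(\<eta> + lat k) $ i - (\<eta> + lat k0) $ i\<bar> < 2 * pi"
        using n component_le_norm_cart[of "\<eta> + lat k" i] component_le_norm_cart[of "\<eta> + lat k0" i] by linarith
      moreover have "(\<eta> + lat k) $ i - (\<eta> + lat k0) $ i = 2 * pi * real_of_int (k $ i - k0 $ i)"
        by (simp add: lat_def algebra_simps)
      ultimately have "2 * pi * \<bar>real_of_int (k $ i - k0 $ i)\<bar> < 2 * pi * 1" by (simp add: abs_mult)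
      then have "\<bar>real_of_int (k $ i - k0 $ i)\<bar> < 1" by (simp only: mult_less_cancel_left_pos[of "2 * pi"] pi_gt_zero mult_pos_pos zero_less_numeral)
      then show False using i by linarith
    qed
    have "br G \<Phi> \<eta> = (\<integral>k. indicator {k0} k *\<^sub>R (G (\<eta> + lat k0) * cnj (\<Phi> (\<eta> + lat k0))) \<partial>count_space UNIV)"
      unfolding br_def by (intro Bochner_Integration.integral_cong) (auto simp: indicator_def zero)
    then have "br G \<Phi> \<eta> = G (\<eta> + lat k0) * cnj (\<Phi> (\<eta> + lat k0))" by simp
    moreover have "(\<integral>\<^sup>+k. ennreal (S (\<eta> + lat k) * (cmod (G (\<eta> + lat k) * cnj (\<Phi> (\<eta> + lat k))))\<^sup>2) \<partial>count_space UNIV)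
      = (\<integral>\<^sup>+k. ennreal (S \<eta> * (cmod (G (\<eta> + lat k0) * cnj (\<Phi> (\<eta> + lat k0))))\<^sup>2) * indicator {k0} k \<partial>count_space UNIV)"
      by (intro nn_integral_cong) (auto simp: indicator_def zero S_periodic)
    ultimately show ?thesis by (simp add: nn_integral_cmult_indicator)
  qed (simp add: br_def)
  then show ?thesis
    unfolding E_def by (subst nn_integral_tile_TM) simp_all
qed

text \<open>Once R / lam^m < pi the dilated truncation falls under \<open>E_small_support\<close>.
  After undoing the dilation, S and \<Phi> are evaluated at \<xi> / lam^m, where both tend to 1, and
  S |\<Phi>|^2 \<le> 1 provides the dominating function.\<close>

lemma Q_LIMSEQ_trunc:
  assumes F: "square_integrable F"
  shows "(\<lambda>m. Q (trunc R F) (int m)) \<longlonglongrightarrow> N2 (trunc R F)"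
proof -
  note [measurable] = square_integrable_measurable[OF F]
  let ?F = "trunc R F"
  define T where "T m = (\<integral>\<^sup>+\<xi>. ennreal (S ((1 / real lam ^ m) *\<^sub>R \<xi>) * (cmod (?F \<xi> * cnj (\<Phi> ((1 / real lam ^ m) *\<^sub>R \<xi>))))\<^sup>2) \<partial>lborel)" for m
  have "T \<longlonglongrightarrow> (\<integral>\<^sup>+\<xi>. ennreal (1 * (cmod (?F \<xi> * cnj 1))\<^sup>2) \<partial>lborel)"
    unfolding T_def
  proof (rule nn_integral_dominated_convergence[where w="\<lambda>\<xi>. ennreal ((cmod (?F \<xi>))\<^sup>2)"])
    show "(\<integral>\<^sup>+\<xi>. ennreal ((cmod (?F \<xi>))\<^sup>2) \<partial>lborel) < \<infinity>"
      using square_integrable_finite[OF square_integrable_trunc[OF F]] unfolding N2_def .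
    show "AE \<xi> in lborel. ennreal (S ((1 / real lam ^ m) *\<^sub>R \<xi>) * (cmod (?F \<xi> * cnj (\<Phi> ((1 / real lam ^ m) *\<^sub>R \<xi>))))\<^sup>2) \<le> ennreal ((cmod (?F \<xi>))\<^sup>2)" for m
    proof -
      have "AE \<xi> in lborel. S ((1 / real lam ^ m) *\<^sub>R \<xi>) * (cmod (\<Phi> ((1 / real lam ^ m) *\<^sub>R \<xi>)))\<^sup>2 \<le> 1"
        using AE_lborel_affine[OF S_\<Phi>_le, of "1 / real lam ^ m" 0] lam_pos by simp
      then show ?thesis
      proof eventually_elim
        case (elim \<xi>)
        have "S ((1 / real lam ^ m) *\<^sub>R \<xi>) * (cmod (?F \<xi> * cnj (\<Phi> ((1 / real lam ^ m) *\<^sub>R \<xi>))))\<^sup>2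
          = (cmod (?F \<xi>))\<^sup>2 * (S ((1 / real lam ^ m) *\<^sub>R \<xi>) * (cmod (\<Phi> ((1 / real lam ^ m) *\<^sub>R \<xi>)))\<^sup>2)"
          by (simp add: norm_mult power_mult_distrib)
        also have "\<dots> \<le> (cmod (?F \<xi>))\<^sup>2 * 1" using elim by (intro mult_left_mono) auto
        finally show ?case by (intro ennreal_leI) simp
      qed
    qed
    show "AE \<xi> in lborel. (\<lambda>m. ennreal (S ((1 / real lam ^ m) *\<^sub>R \<xi>) * (cmod (?F \<xi> * cnj (\<Phi> ((1 / real lam ^ m) *\<^sub>R \<xi>))))\<^sup>2)) \<longlonglongrightarrow> ennreal (1 * (cmod (?F \<xi> * cnj 1))\<^sup>2)"
      by (intro AE_I2 tendsto_intros S_scaled_LIMSEQ \<Phi>_scaled_LIMSEQ)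
  qed measurable
  then have "T \<longlonglongrightarrow> N2 ?F" by (simp add: N2_def)
  moreover have "\<forall>\<^sub>F m in sequentially. T m = Q ?F (int m)"
  proof -
    have "(\<lambda>m. R * (1 / real lam) ^ m) \<longlonglongrightarrow> R * 0" by (intro tendsto_intros tendsto_inverse_power)
    then have "\<forall>\<^sub>F m in sequentially. R * (1 / real lam) ^ m < pi" by (intro order_tendstoD(2)) auto
    then show ?thesis
    proof eventually_elim
      case (elim m)
      let ?c = "real lam ^ m"
      have c: "?c > 0" using lam_pos by simp
      have "E (dil ?c ?F) = (\<integral>\<^sup>+\<xi>. ennreal (S \<xi> * (cmod (dil ?c ?F \<xi> * cnj (\<Phi> \<xi>)))\<^sup>2) \<partial>lborel)"
      proof (rule E_small_support)
        fix x :: "real ^ 'n" assume x: "pi \<le> norm x"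
        have "R = R * (1 / real lam) ^ m * ?c" using lam_pos by (simp add: power_divide)
        also have "\<dots> < pi * ?c" using elim c by (rule mult_strict_right_mono)
        also have "\<dots> \<le> norm x * ?c" using x c by (intro mult_right_mono) auto
        finally show "dil ?c ?F x = 0" using lam_pos by (simp add: trunc_def mult.commute)
      qed measurable
      moreover have "T m = ennreal (?c ^ CARD('n)) * (\<integral>\<^sup>+\<xi>. ennreal (S \<xi> * (cmod (dil ?c ?F \<xi> * cnj (\<Phi> \<xi>)))\<^sup>2) \<partial>lborel)"
        unfolding T_def
        using nn_integral_lborel_affine[of "\<lambda>\<xi>. ennreal (S ((1 / real lam ^ m) *\<^sub>R \<xi>) * (cmod (?F \<xi> * cnj (\<Phi> ((1 / real lam ^ m) *\<^sub>R \<xi>))))\<^sup>2)" ?c 0] c lam_pos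
        by (simp add: DIM_cart)
      ultimately show ?case unfolding Q_def by simp
    qed
  qed
  ultimately show ?thesis by (rule Lim_transform_eventually)
qed

text \<open>The limit L exists by monotonicity. Comparison with truncations gives
  \<open>N2 F\<close> \<le> (1 + e) L for every e > 0; here the weight e matters, as a fixed factor
  such as 2 would not identify the limit.\<close>

lemma Q_LIMSEQ_top:
  assumes F: "square_integrable F"
  shows "(\<lambda>m. Q F (int m)) \<longlonglongrightarrow> N2 F"
proof -
  note [measurable] = square_integrable_measurable[OF F]
  define L where "L = (SUP m. Q F (int m))"
  have lim: "(\<lambda>m. Q F (int m)) \<longlonglongrightarrow> L"
    unfolding L_def by (rule LIMSEQ_SUP) (auto simp: incseq_def intro: Q_mono[OF F])
  have "L \<le> N2 F" unfolding L_def by (rule SUP_least) (rule Q_le[OF F])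
  have L_fin: "L < \<infinity>" using \<open>L \<le> N2 F\<close> square_integrable_finite[OF F] by (rule le_less_trans)
  have N2_lim: "(\<lambda>m. N2 (trunc (real m) F)) \<longlonglongrightarrow> N2 F"
    unfolding N2_def
  proof (rule nn_integral_dominated_convergence)
    show "(\<integral>\<^sup>+x. ennreal ((cmod (F x))\<^sup>2) \<partial>lborel) < \<infinity>"
      using square_integrable_finite[OF F] by (simp add: N2_def)
    show "AE x in lborel. (\<lambda>m. ennreal ((cmod (trunc (real m) F x))\<^sup>2)) \<longlonglongrightarrow> ennreal ((cmod (F x))\<^sup>2)"
      by (intro AE_I2 tendsto_eventually, rule eventually_mono[OF trunc_eventually[of F]], erule ssubst, rule refl)
  qed (auto simp: trunc_def intro!: ennreal_leI)
  have step: "N2 F \<le> ennreal (1 + e) * L" if e: "0 < e" for e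
  proof -
    have "N2 (trunc (real m) F) \<le> ennreal (1 + e) * L + ennreal (1 + 1 / e) * N2 (\<lambda>x. trunc (real m) F x - F x)" for m
    proof (rule LIMSEQ_le[OF Q_LIMSEQ_trunc[OF F]])
      show "(\<lambda>j. ennreal (1 + e) * Q F (int j) + ennreal (1 + 1 / e) * N2 (\<lambda>x. trunc (real m) F x - F x))
        \<longlonglongrightarrow> ennreal (1 + e) * L + ennreal (1 + 1 / e) * N2 (\<lambda>x. trunc (real m) F x - F x)"
        by (intro tendsto_add tendsto_const ennreal_tendsto_cmult lim) simp
      have "Q (trunc (real m) F) (int j) \<le> ennreal (1 + e) * Q F (int j) + ennreal (1 + 1 / e) * N2 (\<lambda>x. trunc (real m) F x - F x)" for j
        using Q_weighted[OF F square_integrable_diff[OF square_integrable_trunc[OF F] F] e, of "real m" "int j"] by simp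
      then show "\<exists>N. \<forall>j\<ge>N. Q (trunc (real m) F) (int j) \<le> ennreal (1 + e) * Q F (int j) + ennreal (1 + 1 / e) * N2 (\<lambda>x. trunc (real m) F x - F x)"
        by blast
    qed
    moreover have "(\<lambda>m. ennreal (1 + e) * L + ennreal (1 + 1 / e) * N2 (\<lambda>x. trunc (real m) F x - F x)) \<longlonglongrightarrow> ennreal (1 + e) * L + ennreal (1 + 1 / e) * 0"
      by (intro tendsto_add tendsto_const ennreal_tendsto_cmult L2_tendsto_trunc[OF F, unfolded L2_tendsto_iff]) simp
    ultimately have "N2 F \<le> ennreal (1 + e) * L + ennreal (1 + 1 / e) * 0"
      by (intro LIMSEQ_le[OF N2_lim]) auto
    then show ?thesis by simp
  qed
  have "N2 F \<le> L"
  proof (rule LIMSEQ_le_const)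
    have "(\<lambda>n. L * ennreal (1 + 1 / real (Suc n))) \<longlonglongrightarrow> L * ennreal (1 + 0)"
      using L_fin by (intro ennreal_tendsto_cmult tendsto_ennrealI tendsto_add tendsto_const LIMSEQ_Suc lim_1_over_n) simp
    then show "(\<lambda>n. L * ennreal (1 + 1 / real (Suc n))) \<longlonglongrightarrow> L" by simp
    have "N2 F \<le> L * ennreal (1 + 1 / real (Suc n))" for n
      using step[of "1 / real (Suc n)"] unfolding mult.commute[of L] by simp
    then show "\<exists>N. \<forall>n\<ge>N. N2 F \<le> L * ennreal (1 + 1 / real (Suc n))" by blast
  qed
  then show ?thesis using lim \<open>L \<le> N2 F\<close> by simp
qed


section \<open>The limit at coarse scales and its reduction to bounded periodizations\<close>

lemma lat_power: "\<exists>l. real lam ^ J *\<^sub>R lat k = lat (l :: int ^ 'n)"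
proof (induction J)
  case (Suc J)
  then obtain l :: "int ^ 'n" where "real lam ^ J *\<^sub>R lat k = lat l" by blast
  then have "real lam ^ Suc J *\<^sub>R lat k = lat (sc lam l)" by (simp add: lat_sc flip: scaleR_scaleR)
  then show ?case by blast
qed (auto intro: exI[of _ k])

text \<open>Multiplication by lam preserves the measure of the torus: each point has lam^n
  preimages, each weighted by lam^-n.\<close>

lemma integral_dilated_periodic:
  assumes [measurable]: "w \<in> borel_measurable borel" and per: "\<And>x k. w (x + lat k) = w x"
  shows "(\<integral>\<^sup>+\<xi>. w ((real lam ^ J) *\<^sub>R \<xi>) \<partial>TM) = (\<integral>\<^sup>+\<xi>. w \<xi> \<partial>(TM :: (real ^ 'n) measure))"
proof (induction J)
  case (Suc J)
  let ?c = "real lam ^ J"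
  have eq: "w (real lam ^ Suc J *\<^sub>R ((1 / real lam) *\<^sub>R (\<eta> + lat m))) = w (?c *\<^sub>R \<eta>)" for \<eta> m
  proof -
    obtain l where l: "?c *\<^sub>R lat m = lat l" using lat_power by blast
    have "real lam ^ Suc J *\<^sub>R ((1 / real lam) *\<^sub>R (\<eta> + lat m)) = ?c *\<^sub>R \<eta> + lat l"
      unfolding l[symmetric] using lam_pos by (simp add: scaleR_add_right)
    then show ?thesis by (simp only: per)
  qed
  have "ennreal (real lam ^ CARD('n)) * (\<integral>\<^sup>+\<xi>. w ((real lam ^ Suc J) *\<^sub>R \<xi>) \<partial>TM)
    = (\<integral>\<^sup>+\<eta>. (\<Sum>m\<in>digits lam. w (real lam ^ Suc J *\<^sub>R ((1 / real lam) *\<^sub>R (\<eta> + lat m)))) \<partial>(TM :: (real ^ 'n) measure))"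
    by (rule nn_integral_dilate_TM[OF _ lam_pos(1)]) measurable
  also have "\<dots> = (\<integral>\<^sup>+\<eta>. ennreal (real lam ^ CARD('n)) * w (?c *\<^sub>R \<eta>) \<partial>(TM :: (real ^ 'n) measure))"
    unfolding eq by (simp add: card_digits ennreal_of_nat_eq_real_of_nat)
  also have "\<dots> = ennreal (real lam ^ CARD('n)) * (\<integral>\<^sup>+\<xi>. w \<xi> \<partial>(TM :: (real ^ 'n) measure))"
    by (subst nn_integral_cmult) (simp_all add: Suc)
  finally show ?case using lam_pos
    by (simp add: ennreal_mult_cancel_left)
qed simp

text \<open>The part of \<open>\<Phi>\<close> far from the origin carries little mass, and periodicity spreads this mass evenly.\<close>

lemma Q_LIMSEQ_bot_bounded:
  assumes F: "square_integrable F" and supp: "\<And>x. norm x < r \<Longrightarrow> F x = 0" and "0 < r"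
    and bound: "\<And>x. sqs F x \<le> ennreal M"
  shows "(\<lambda>J. Q F (- int J)) \<longlonglongrightarrow> 0"
proof (rule tendsto_sandwich[OF _ _ tendsto_const])
  note [measurable] = square_integrable_measurable[OF F]
  \<comment> \<open>F vanishes on the ball of radius r, so its dilate by lam^-J vanishes on the ball
    of radius r lam^J; in the bracket only this outer part of \<Phi> is seen.\<close>
  define P where "P J x = (if norm x < r * real lam ^ J then 0 else \<Phi> x)" for J x
  have [measurable]: "P J \<in> borel_measurable borel" for J unfolding P_def[abs_def] by measurable
  define W where "W J x = ennreal (S x) * sqs (P J) x" for J x
  have [measurable]: "W J \<in> borel_measurable borel" for J unfolding W_def[abs_def] by measurable
  have W_per: "W J (x + lat k) = W J x" for J x k by (simp add: W_def S_periodic sqs_periodic)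
  have W_int: "(\<integral>\<^sup>+x. W J x \<partial>TM) = (\<integral>\<^sup>+x. ennreal (S x * (cmod (P J x))\<^sup>2) \<partial>lborel)" for J
  proof -
    have "(\<integral>\<^sup>+x. ennreal (S x * (cmod (P J x))\<^sup>2) \<partial>lborel) = (\<integral>\<^sup>+x. (\<integral>\<^sup>+k. ennreal (S (x + lat k) * (cmod (P J (x + lat k)))\<^sup>2) \<partial>count_space UNIV) \<partial>TM)"
      by (rule nn_integral_tile_TM) measurable
    also have "\<dots> = (\<integral>\<^sup>+x. W J x \<partial>TM)"
      unfolding W_def sqs_def S_periodic by (simp add: ennreal_mult'' nn_integral_cmult)
    finally show ?thesis by simp
  qed
  have "(\<lambda>J. \<integral>\<^sup>+x. ennreal (S x * (cmod (P J x))\<^sup>2) \<partial>lborel) \<longlonglongrightarrow> (\<integral>\<^sup>+x. 0 \<partial>(lborel :: (real ^ 'n) measure))"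
  proof (rule nn_integral_dominated_convergence[where w="\<lambda>x. ennreal (S x * (cmod (\<Phi> x))\<^sup>2)"])
    show "AE x in lborel. ennreal (S x * (cmod (P J x))\<^sup>2) \<le> ennreal (S x * (cmod (\<Phi> x))\<^sup>2)" for J
      using S_pos by eventually_elim (auto simp: P_def intro!: ennreal_leI)
    show "(\<integral>\<^sup>+x. ennreal (S x * (cmod (\<Phi> x))\<^sup>2) \<partial>lborel) < \<infinity>"
      using weighted_\<Phi>_integral by (rule le_less_trans) simp
    show "AE x in lborel. (\<lambda>J. ennreal (S x * (cmod (P J x))\<^sup>2)) \<longlonglongrightarrow> 0"
    proof (rule AE_I2)
      fix x :: "real ^ 'n"
      have "(\<lambda>J. norm x * (1 / real lam) ^ J) \<longlonglongrightarrow> norm x * 0"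
        by (intro tendsto_mult tendsto_const tendsto_inverse_power)
      then have "\<forall>\<^sub>F J in sequentially. norm x * (1 / real lam) ^ J < r"
        using \<open>0 < r\<close> by (intro order_tendstoD(2)) auto
      then have "\<forall>\<^sub>F J in sequentially. ennreal (S x * (cmod (P J x))\<^sup>2) = 0"
      proof eventually_elim
        case (elim J)
        have c: "real lam ^ J > 0" using lam_pos by simp
        have "norm x = norm x * (1 / real lam) ^ J * real lam ^ J" using lam_pos by (simp add: power_divide)
        also have "\<dots> < r * real lam ^ J" using elim c by (rule mult_strict_right_mono)
        finally show ?case by (simp add: P_def)
      qed
      then show "(\<lambda>J. ennreal (S x * (cmod (P J x))\<^sup>2)) \<longlonglongrightarrow> 0" by (rule tendsto_eventually)
    qed
  qed measurable
  then have "(\<lambda>J. \<integral>\<^sup>+x. W J x \<partial>TM) \<longlonglongrightarrow> 0" unfolding W_int by simp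
  then have "(\<lambda>J. ennreal M * (\<integral>\<^sup>+x. W J x \<partial>TM)) \<longlonglongrightarrow> ennreal M * 0"
    by (intro ennreal_tendsto_cmult) auto
  then show "(\<lambda>J. ennreal M * (\<integral>\<^sup>+x. W J x \<partial>TM)) \<longlonglongrightarrow> 0" by simp
  have "Q F (- int J) \<le> ennreal M * (\<integral>\<^sup>+x. W J x \<partial>TM)" for J
  proof -
    define c where "c = 1 / real lam ^ J"
    have c: "c > 0" "real lam powi (- int J) = c" using lam_pos by (auto simp: c_def power_int_minus divide_inverse)
    let ?G = "dil c F"
    have "br ?G \<Phi> \<eta> = br ?G (P J) \<eta>" for \<eta>
      unfolding br_def
    proof (intro Bochner_Integration.integral_cong refl)
      fix k :: "int ^ 'n"
      show "?G (\<eta> + lat k) * cnj (\<Phi> (\<eta> + lat k)) = ?G (\<eta> + lat k) * cnj (P J (\<eta> + lat k))"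
      proof (cases "norm (\<eta> + lat k) < r * real lam ^ J")
        case True
        then have "norm (c *\<^sub>R (\<eta> + lat k)) < r"
          using lam_pos by (simp add: c_def divide_simps mult.commute)
        then show ?thesis by (simp add: supp)
      qed (simp add: P_def)
    qed
    then have "E ?G = (\<integral>\<^sup>+\<eta>. ennreal (S \<eta> * (cmod (br ?G (P J) \<eta>))\<^sup>2) \<partial>TM)"
      unfolding E_def by simp
    also have "\<dots> \<le> (\<integral>\<^sup>+\<eta>. sqs ?G \<eta> * W J \<eta> \<partial>TM)"
    proof (rule nn_integral_mono_AE, rule AE_TM, use S_pos in eventually_elim)
      case (elim \<eta>)
      have "ennreal (S \<eta> * (cmod (br ?G (P J) \<eta>))\<^sup>2) = ennreal (S \<eta>) * ennreal ((cmod (br ?G (P J) \<eta>))\<^sup>2)"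
        using elim by (simp add: ennreal_mult)
      also have "\<dots> \<le> ennreal (S \<eta>) * (sqs ?G \<eta> * sqs (P J) \<eta>)"
        by (intro mult_left_mono br_Cauchy_Schwarz) simp
      finally show ?case by (simp add: W_def mult_ac)
    qed
    \<comment> \<open>The hypothesis bounds \<open>sqs\<close> of F, not of its dilates. Since
      \<open>W J\<close> is periodic, the integral can be unfolded, the dilation undone, and the
      result folded again; the lattice sum is then that of F itself and the dilation sits on
      \<open>W J\<close>.\<close>
    also have "\<dots> = (\<integral>\<^sup>+\<eta>. (\<integral>\<^sup>+k. ennreal ((cmod (?G (\<eta> + lat k)))\<^sup>2) * W J (\<eta> + lat k) \<partial>count_space UNIV) \<partial>TM)"
      unfolding sqs_def W_per by (simp add: nn_integral_multc)
    also have "\<dots> = (\<integral>\<^sup>+\<eta>. ennreal ((cmod (?G \<eta>))\<^sup>2) * W J \<eta> \<partial>lborel)"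
      by (rule nn_integral_tile_TM[symmetric]) measurable
    finally have "Q F (- int J) \<le> ennreal (c ^ CARD('n)) * (\<integral>\<^sup>+\<eta>. ennreal ((cmod (F (0 + c *\<^sub>R \<eta>)))\<^sup>2) * W J ((real lam ^ J) *\<^sub>R (0 + c *\<^sub>R \<eta>)) \<partial>lborel)"
      unfolding Q_def c(2) using lam_pos by (intro mult_left_mono) (simp_all add: c_def)
    also have "\<dots> = (\<integral>\<^sup>+\<xi>. ennreal ((cmod (F \<xi>))\<^sup>2) * W J ((real lam ^ J) *\<^sub>R \<xi>) \<partial>lborel)"
      using nn_integral_lborel_affine[of "\<lambda>\<xi>. ennreal ((cmod (F \<xi>))\<^sup>2) * W J ((real lam ^ J) *\<^sub>R \<xi>)" c 0] c(1)
      by (simp add: DIM_cart)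
    also have "\<dots> = (\<integral>\<^sup>+\<xi>. (\<integral>\<^sup>+k. ennreal ((cmod (F (\<xi> + lat k)))\<^sup>2) * W J ((real lam ^ J) *\<^sub>R (\<xi> + lat k)) \<partial>count_space UNIV) \<partial>TM)"
      by (rule nn_integral_tile_TM) measurable
    also have "\<dots> = (\<integral>\<^sup>+\<xi>. sqs F \<xi> * W J ((real lam ^ J) *\<^sub>R \<xi>) \<partial>TM)"
    proof -
      have "W J ((real lam ^ J) *\<^sub>R (\<xi> + lat k)) = W J ((real lam ^ J) *\<^sub>R \<xi>)" for \<xi> k
        unfolding scaleR_add_right using lat_power[of J k] W_per by metis
      then show ?thesis unfolding sqs_def by (simp add: nn_integral_multc)
    qed
    also have "\<dots> \<le> (\<integral>\<^sup>+\<xi>. ennreal M * W J ((real lam ^ J) *\<^sub>R \<xi>) \<partial>TM)"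
      by (intro nn_integral_mono mult_right_mono bound) simp
    also have "\<dots> = ennreal M * (\<integral>\<^sup>+x. W J x \<partial>TM)"
      by (simp add: nn_integral_cmult integral_dilated_periodic W_per)
    finally show ?thesis .
  qed
  then show "\<forall>\<^sub>F J in sequentially. Q F (- int J) \<le> ennreal M * (\<integral>\<^sup>+x. W J x \<partial>TM)"
    by (rule always_eventually[OF allI])
qed auto

lemma Q_LIMSEQ_bot:
  assumes F: "square_integrable F"
  shows "(\<lambda>J. Q F (- int J)) \<longlonglongrightarrow> 0"
proof -
  note [measurable] = square_integrable_measurable[OF F]
  \<comment> \<open>Removes a ball around 0 and all points where \<open>sqs F\<close> exceeds m. The
    second condition is lattice periodic, so it removes whole lattice orbits and leaves
    \<open>sqs (cut m)\<close> at most m.\<close>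
  define cut where "cut m x = (if norm x < 1 / real (Suc m) \<or> \<not> sqs F x \<le> ennreal (real m) then 0 else F x)" for m x
  have [measurable]: "cut m \<in> borel_measurable borel" for m unfolding cut_def[abs_def] by measurable
  have cut: "square_integrable (cut m)" for m
    by (rule square_integrable_le[OF F]) (auto simp: cut_def)
  have "sqs (cut m) x \<le> ennreal (real m)" for m x
  proof (cases "sqs F x \<le> ennreal (real m)")
    case True
    have "sqs (cut m) x \<le> sqs F x"
      unfolding sqs_def by (intro nn_integral_mono ennreal_leI power_mono) (auto simp: cut_def)
    then show ?thesis using True by (rule order_trans)
  next
    case False
    then have "cut m (x + lat k) = 0" for k by (simp add: cut_def sqs_periodic)
    then show ?thesis by (simp add: sqs_def)
  qed
  then have cut_lim: "(\<lambda>J. Q (cut m) (- int J)) \<longlonglongrightarrow> 0" for m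
    by (intro Q_LIMSEQ_bot_bounded[OF cut, of "1 / real (Suc m)"]) (auto simp: cut_def)
  define L where "L = (INF J. Q F (- int J))"
  have lim: "(\<lambda>J. Q F (- int J)) \<longlonglongrightarrow> L"
    unfolding L_def by (rule LIMSEQ_INF) (auto simp: decseq_def intro: Q_mono[OF F])
  have diff_lim: "(\<lambda>m. N2 (\<lambda>x. F x - cut m x)) \<longlonglongrightarrow> (\<integral>\<^sup>+x. 0 \<partial>(lborel :: (real ^ 'n) measure))"
    unfolding N2_def
  proof (rule nn_integral_dominated_convergence)
    show "(\<integral>\<^sup>+x. ennreal ((cmod (F x))\<^sup>2) \<partial>lborel) < \<infinity>"
      using square_integrable_finite[OF F] by (simp add: N2_def)
    have "AE x in lborel. x \<noteq> (0 :: real ^ 'n)" by (rule AE_lborel_singleton)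
    then show "AE x in lborel. (\<lambda>m. ennreal ((cmod (F x - cut m x))\<^sup>2)) \<longlonglongrightarrow> 0"
      using AE_sqs_finite[OF F]
    proof eventually_elim
      case (elim x)
      from less_imp_neq[OF elim(2)] obtain C where C: "sqs F x = ennreal C" "0 \<le> C" by (rule ennreal_finiteE)
      obtain m1 where m1: "C \<le> real m1" using real_arch_simple by blast
      obtain m2 where m2: "1 / norm x < real m2" using reals_Archimedean2 by blast
      have "cut m x = F x" if "m \<ge> max m1 m2" for m
      proof -
        have "1 / norm x < real (Suc m)" using m2 that by linarith
        then have "1 / real (Suc m) < norm x" using elim(1) by (simp add: field_simps)
        moreover have "sqs F x \<le> ennreal (real m)" using C m1 that by (simp add: ennreal_leI)
        ultimately show ?thesis by (auto simp: cut_def)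
      qed
      then show ?case
        by (intro tendsto_eventually) (auto simp: eventually_sequentially intro!: exI[of _ "max m1 m2"])
    qed
  qed (auto simp: cut_def intro!: ennreal_leI)
  \<comment> \<open>\<open>Q_weighted\<close> with e = 1; the factor 2 does no harm because the
    limit sought is 0.\<close>
  have step: "L \<le> 2 * N2 (\<lambda>x. F x - cut m x)" for m
  proof (rule LIMSEQ_le[OF lim])
    have "(\<lambda>J. 2 * Q (cut m) (- int J) + 2 * N2 (\<lambda>x. F x - cut m x)) \<longlonglongrightarrow> 2 * 0 + 2 * N2 (\<lambda>x. F x - cut m x)"
      by (intro tendsto_add tendsto_const ennreal_tendsto_cmult cut_lim) simp
    then show "(\<lambda>J. 2 * Q (cut m) (- int J) + 2 * N2 (\<lambda>x. F x - cut m x)) \<longlonglongrightarrow> 2 * N2 (\<lambda>x. F x - cut m x)" by simp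
    have "Q F (- int J) \<le> 2 * Q (cut m) (- int J) + 2 * N2 (\<lambda>x. F x - cut m x)" for J
      using Q_weighted[OF cut square_integrable_diff[OF F cut], of 1 m m "- int J"] by simp
    then show "\<exists>N. \<forall>J\<ge>N. Q F (- int J) \<le> 2 * Q (cut m) (- int J) + 2 * N2 (\<lambda>x. F x - cut m x)"
      by blast
  qed
  have "L \<le> 2 * 0"
  proof (rule LIMSEQ_le_const)
    show "(\<lambda>m. 2 * N2 (\<lambda>x. F x - cut m x)) \<longlonglongrightarrow> 2 * 0"
      using diff_lim by (intro ennreal_tendsto_cmult) simp_all
  qed (use step in blast)
  then show ?thesis using lim by simp
qed

section \<open>Summation over all scales and the frame property\<close>

lemma level_sum:
  assumes F: "square_integrable F"
  shows "(\<integral>\<^sup>+j. ennreal ((real lam powi j) ^ CARD('n)) * (\<Sum>i\<in>I. D (dil (real lam powi j) F) i) \<partial>count_space UNIV) = N2 F"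
proof -
  define b where "b j = ennreal ((real lam powi j) ^ CARD('n)) * (\<Sum>i\<in>I. D (dil (real lam powi j) F) i)" for j
  \<comment> \<open>Induction over the number k of steps from -m; k = 2 m gives the symmetric
    window, whose two ends have the limits 0 and \<open>N2 F\<close>.\<close>
  have tele: "Q F (- int m) + (\<Sum>j\<in>{- int m..<int k - int m}. b j) = Q F (int k - int m)" for m k
  proof (induction k)
    case (Suc k)
    have "{- int m..<int (Suc k) - int m} = insert (int k - int m) {- int m..<int k - int m}" by auto
    then have "(\<Sum>j\<in>{- int m..<int (Suc k) - int m}. b j) = (\<Sum>j\<in>{- int m..<int k - int m}. b j) + b (int k - int m)"
      by (simp add: add.commute)
    then show ?case using Q_Suc[OF F, of "int k - int m"] Suc
      by (simp add: b_def add.assoc[symmetric] algebra_simps)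
  qed simp
  have "(\<lambda>m. \<integral>\<^sup>+j. b j * indicator {- int m..<int m} j \<partial>count_space UNIV) \<longlonglongrightarrow> (\<integral>\<^sup>+j. b j \<partial>count_space UNIV)"
  proof (rule nn_integral_LIMSEQ)
    show "incseq (\<lambda>m j. b j * indicator {- int m..<int m} j)"
      by (auto simp: incseq_def le_fun_def indicator_def)
    show "(\<lambda>m. b j * indicator {- int m..<int m} j) \<longlonglongrightarrow> b j" for j
      by (intro tendsto_eventually) (auto simp: eventually_sequentially indicator_def intro!: exI[of _ "Suc (nat \<bar>j\<bar>)"])
  qed simp
  moreover have "(\<integral>\<^sup>+j. b j * indicator {- int m..<int m} j \<partial>count_space UNIV) = (\<Sum>j\<in>{- int m..<int m}. b j)" for m
    by (simp add: nn_integral_count_space_indicator[symmetric] nn_integral_count_space_finite)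
  ultimately have lim: "(\<lambda>m. \<Sum>j\<in>{- int m..<int m}. b j) \<longlonglongrightarrow> (\<integral>\<^sup>+j. b j \<partial>count_space UNIV)" by simp
  have "(\<lambda>m. Q F (- int m) + (\<Sum>j\<in>{- int m..<int m}. b j)) \<longlonglongrightarrow> 0 + (\<integral>\<^sup>+j. b j \<partial>count_space UNIV)"
    by (intro tendsto_add Q_LIMSEQ_bot[OF F] lim)
  moreover have "Q F (- int m) + (\<Sum>j\<in>{- int m..<int m}. b j) = Q F (int m)" for m
    using tele[of m "2 * m"] by simp
  ultimately have "(\<lambda>m. Q F (int m)) \<longlonglongrightarrow> (\<integral>\<^sup>+j. b j \<partial>count_space UNIV)" by simp
  then show ?thesis using Q_LIMSEQ_top[OF F] LIMSEQ_unique unfolding b_def by blast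
qed


text \<open>Parseval contributes (2 pi)^n against the (2 pi)^(2n) in the denominator of
  \<open>wavelet_coefficient\<close>. The remaining 1 / (2 pi)^n is cancelled by Plancherel for f in
  \<open>tight_frame\<close>.\<close>

lemma wavelet_level_sum:
  assumes f: "has_fourier_L2 f F" and \<psi>: "has_fourier_L2 \<psi> (\<Psi> i)" and i: "i \<in> I"
  shows "(\<integral>\<^sup>+k. ennreal ((norm (L2_inner f (wavelet lam \<psi> j k)))\<^sup>2) \<partial>count_space UNIV)
    = ennreal (1 / (2 * pi) ^ CARD('n)) * (ennreal ((real lam powi j) ^ CARD('n)) * D (dil (real lam powi j) F) i)"
proof -
  let ?c = "real lam powi j" and ?w = "(2 * pi) ^ CARD('n)"
  note F = has_fourier_L2_square_integrable(2)[OF f]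
  have c: "?c > 0" by (rule scale_pos)
  have "(\<integral>\<^sup>+k. ennreal ((norm (L2_inner f (wavelet lam \<psi> j k)))\<^sup>2) \<partial>count_space UNIV)
    = (\<integral>\<^sup>+k. ennreal (?c ^ CARD('n) / ?w\<^sup>2) * ennreal ((cmod (\<integral>\<eta>. F (?c *\<^sub>R \<eta>) * cnj (\<Psi> i \<eta>) * ek (- k) \<eta> \<partial>lborel))\<^sup>2) \<partial>count_space UNIV)"
    unfolding wavelet_coefficient[OF f \<psi> lam_pos(1)]
    by (intro nn_integral_cong ennreal_mult) (use c in auto)
  also have "\<dots> = ennreal (?c ^ CARD('n) / ?w\<^sup>2) * (ennreal ?w * D (dil ?c F) i)"
    using D_finite[OF square_integrable_scale[OF F] i] unfolding D_def
    by (subst nn_integral_cmult) (simp_all only: parseval_br[OF square_integrable_scale[OF F] \<Psi>_square_integrable[OF i]], simp)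
  also have "\<dots> = ennreal (1 / ?w) * (ennreal (?c ^ CARD('n)) * D (dil ?c F) i)"
  proof -
    have "ennreal (x / w\<^sup>2) * (ennreal w * y) = ennreal (1 / w) * (ennreal x * y)" if "0 < w" "0 \<le> x" for x w y
      using that by (simp add: mult.assoc[symmetric] ennreal_mult[symmetric] power2_eq_square)
    then show ?thesis using c by simp
  qed
  finally show ?thesis .
qed

lemma tight_frame:
  assumes \<psi>: "\<And>i. i \<in> I \<Longrightarrow> has_fourier_L2 (\<psi> i) (\<Psi> i)"
  shows "tight_wavelet_frame lam I \<psi>"
  unfolding tight_wavelet_frame_def
proof (intro conjI ballI allI impI)
  show "finite I" by (rule finite_I)
  show "square_integrable (\<psi> i)" if "i \<in> I" for i
    by (rule has_fourier_L2_square_integrable(1)[OF \<psi>[OF that]])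
  fix f :: "real ^ 'n \<Rightarrow> complex" assume f: "square_integrable f"
  obtain F where F: "has_fourier_L2 f F" using has_fourier_L2_exists[OF f] .
  let ?w = "(2 * pi) ^ CARD('n)"
  let ?t = "\<lambda>i j k. (norm (L2_inner f (wavelet lam (\<psi> i) j k)))\<^sup>2"
  have "(\<integral>\<^sup>+z. ennreal (case z of (i, j, k) \<Rightarrow> ?t i j k) \<partial>count_space (I \<times> (UNIV :: int set) \<times> (UNIV :: (int ^ 'n) set)))
    = (\<Sum>i\<in>I. \<integral>\<^sup>+z. ennreal (case z of (j, k) \<Rightarrow> ?t i j k) \<partial>count_space UNIV)"
    using nn_integral_count_space_Times[OF finite_I, of "\<lambda>z. ennreal (case z of (i, j, k) \<Rightarrow> ?t i j k)"]
    by simp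
  also have "\<dots> = (\<Sum>i\<in>I. \<integral>\<^sup>+j. (\<integral>\<^sup>+k. ennreal (?t i j k) \<partial>count_space UNIV) \<partial>count_space UNIV)"
    by (subst nn_integral_fst_count_space[symmetric]) simp
  also have "\<dots> = (\<Sum>i\<in>I. \<integral>\<^sup>+j. ennreal (1 / ?w) * (ennreal ((real lam powi j) ^ CARD('n)) * D (dil (real lam powi j) F) i) \<partial>count_space UNIV)"
    by (intro sum.cong refl nn_integral_cong wavelet_level_sum[OF F \<psi>])
  also have "\<dots> = (\<integral>\<^sup>+j. (\<Sum>i\<in>I. ennreal (1 / ?w) * (ennreal ((real lam powi j) ^ CARD('n)) * D (dil (real lam powi j) F) i)) \<partial>count_space UNIV)"
    by (rule nn_integral_sum[symmetric]) simp
  also have "\<dots> = ennreal (1 / ?w) * (\<integral>\<^sup>+j. ennreal ((real lam powi j) ^ CARD('n)) * (\<Sum>i\<in>I. D (dil (real lam powi j) F) i) \<partial>count_space UNIV)"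
    unfolding sum_distrib_left[symmetric] by (rule nn_integral_cmult) simp
  also have "\<dots> = ennreal (1 / ?w) * (ennreal ?w * N2 f)"
    unfolding level_sum[OF has_fourier_L2_square_integrable(2)[OF F]] has_fourier_L2_norm[OF F] ..
  also have "\<dots> = N2 f" by (simp add: mult.assoc[symmetric] ennreal_mult[symmetric])
  also have "\<dots> = ennreal ((L2_norm f)\<^sup>2)"
    unfolding integral_norm_square[OF f] L2_norm_def by simp
  finally show "((\<lambda>(i, j, k). ?t i j k) has_sum (L2_norm f)\<^sup>2) (I \<times> UNIV \<times> UNIV)"
    by (subst has_sum_iff_nn_integral) auto
qed

theorem mask_system_tight_frame: "mask_system_tight_wavelet_frame lam \<tau> I q"
proof -
  have mother: "mother_wavelets lam \<tau> I q \<psi> \<longleftrightarrow> (\<forall>i\<in>I. has_fourier_L2 (\<psi> i) (\<Psi> i))" for \<psi>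
    unfolding mother_wavelets_def \<Psi>_def[abs_def] ..
  have "\<forall>i\<in>I. \<exists>\<psi>. has_fourier_L2 \<psi> (\<Psi> i)"
    using has_fourier_L2_surj[OF \<Psi>_square_integrable] by blast
  then have "\<exists>\<psi>. \<forall>i\<in>I. has_fourier_L2 (\<psi> i) (\<Psi> i)" by (rule bchoice)
  then show ?thesis
    unfolding mask_system_tight_wavelet_frame_def mother using tight_frame by blast
qed

end

section \<open>The algebra of the extension identity\<close>

text \<open>A and \<sigma> are the values of S at \<eta> and at its preimages m under multiplication
  by lam, P and G those of p and g at \<eta>, e the exponentials, T and s the values of the masks at
  the preimages, and M = lam^n. With a the low-pass coefficient and b the analysis of u by e,
  everything is expressed through |a|^2, the energy U of u and the sum R of the |P l|^2.\<close>

lemma extension_identity: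
  fixes P G :: "nat \<Rightarrow> complex" and T s :: "'m \<Rightarrow> complex" and \<sigma> :: "'m \<Rightarrow> real" and e :: "nat \<Rightarrow> 'm \<Rightarrow> complex"
    and A c :: real
  assumes \<Lambda>: "finite \<Lambda>" and A: "A > 0" and M: "0 < M" "N \<le> M"
    and G: "\<And>l. l \<in> {1..N} \<Longrightarrow> 1 / A - (cmod (P l))\<^sup>2 = real M * (cmod (G l))\<^sup>2"
    and P: "\<And>l. l \<in> {N<..M} \<Longrightarrow> (cmod (P l))\<^sup>2 = 1 / A"
    and s: "\<And>m. m \<in> \<Lambda> \<Longrightarrow> \<sigma> m * (cmod (s m))\<^sup>2 = 1"
    and T: "\<And>m. m \<in> \<Lambda> \<Longrightarrow> of_nat M * (T m * cnj (s m)) = (\<Sum>l=1..M. P l * e l m)"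
    and orth: "\<And>m m'. m \<in> \<Lambda> \<Longrightarrow> m' \<in> \<Lambda> \<Longrightarrow> (\<Sum>l=1..M. e l m * cnj (e l m')) = (if m = m' then of_nat M else 0)"
    and c: "c\<^sup>2 = 1 / real M"
  shows "A * (cmod (\<Sum>m\<in>\<Lambda>. cnj (T m) * u m))\<^sup>2
    + ((\<Sum>l=1..N. (cmod (\<Sum>m\<in>\<Lambda>. cnj (of_real A * T m * cnj (G l)) * u m))\<^sup>2)
      + (\<Sum>r=1..M. (cmod (\<Sum>m\<in>\<Lambda>. cnj (of_real c * (of_real (\<sigma> m) * s m * e r m - of_real A * T m * cnj (P r))) * u m))\<^sup>2))
    = (\<Sum>m\<in>\<Lambda>. \<sigma> m * (cmod (u m))\<^sup>2)"
proof -
  define a where "a = (\<Sum>m\<in>\<Lambda>. cnj (T m) * u m)"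
  define v where "v m = of_real (\<sigma> m) * cnj (s m) * u m" for m
  define b where "b r = (\<Sum>m\<in>\<Lambda>. v m * cnj (e r m))" for r
  define U where "U = (\<Sum>m\<in>\<Lambda>. \<sigma> m * (cmod (u m))\<^sup>2)"
  define R where "R = (\<Sum>l=1..M. (cmod (P l))\<^sup>2)"
  have ss: "complex_of_real (\<sigma> m) * (s m * cnj (s m)) = 1" if "m \<in> \<Lambda>" for m
  proof -
    have "complex_of_real (\<sigma> m) * of_real ((cmod (s m))\<^sup>2) = 1"
      using s[OF that] by (metis of_real_1 of_real_mult)
    then show ?thesis by (simp only: complex_norm_square)
  qed
  have q1: "(cmod (\<Sum>m\<in>\<Lambda>. cnj (of_real A * T m * cnj (G l)) * u m))\<^sup>2 = A\<^sup>2 * (cmod a)\<^sup>2 * (cmod (G l))\<^sup>2" for l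
  proof -
    have "(\<Sum>m\<in>\<Lambda>. cnj (of_real A * T m * cnj (G l)) * u m) = of_real A * G l * a"
      unfolding a_def sum_distrib_left by (intro sum.cong) (auto simp: mult_ac)
    then show ?thesis by (simp add: norm_mult power_mult_distrib)
  qed
  have q2: "(cmod (\<Sum>m\<in>\<Lambda>. cnj (of_real c * (of_real (\<sigma> m) * s m * e r m - of_real A * T m * cnj (P r))) * u m))\<^sup>2
     = (1 / real M) * (cmod (b r - of_real A * P r * a))\<^sup>2" for r
  proof -
    have "(\<Sum>m\<in>\<Lambda>. cnj (of_real c * (of_real (\<sigma> m) * s m * e r m - of_real A * T m * cnj (P r))) * u m)
      = of_real c * (b r - of_real A * P r * a)"
      unfolding a_def b_def v_def sum_distrib_left sum_subtractf[symmetric]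
      by (intro sum.cong) (auto simp: algebra_simps)
    then show ?thesis using c by (simp add: norm_mult power_mult_distrib)
  qed
  \<comment> \<open>Orthogonality of the columns of e: the analysis preserves energy up to the
    factor M, and \<sigma> |s|^2 = 1 turns the energy of v into U.\<close>
  have bb: "(\<Sum>r=1..M. b r * cnj (b r)) = of_real (real M * U)"
  proof -
    have "(\<Sum>r=1..M. b r * cnj (b r)) = (\<Sum>r=1..M. \<Sum>m\<in>\<Lambda>. \<Sum>m'\<in>\<Lambda>. v m * cnj (v m') * (e r m' * cnj (e r m)))"
      unfolding b_def cnj_sum sum_product by (intro sum.cong refl) (simp add: mult_ac)
    also have "\<dots> = (\<Sum>m\<in>\<Lambda>. \<Sum>r=1..M. \<Sum>m'\<in>\<Lambda>. v m * cnj (v m') * (e r m' * cnj (e r m)))"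
      by (rule sum.swap)
    also have "\<dots> = (\<Sum>m\<in>\<Lambda>. \<Sum>m'\<in>\<Lambda>. \<Sum>r=1..M. v m * cnj (v m') * (e r m' * cnj (e r m)))"
      by (intro sum.cong refl sum.swap)
    also have "\<dots> = (\<Sum>m\<in>\<Lambda>. \<Sum>m'\<in>\<Lambda>. v m * cnj (v m') * (if m' = m then of_nat M else 0))"
      by (intro sum.cong refl) (simp only: sum_distrib_left[symmetric] orth)
    also have "\<dots> = (\<Sum>m\<in>\<Lambda>. v m * cnj (v m) * of_nat M)"
      using \<Lambda> by (intro sum.cong refl) (simp add: if_distrib[of "(*) _"] cong: if_cong)
    also have "\<dots> = (\<Sum>m\<in>\<Lambda>. of_real (real M * (\<sigma> m * (cmod (u m))\<^sup>2)))"
    proof (intro sum.cong refl)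
      fix m assume m: "m \<in> \<Lambda>"
      have "v m * cnj (v m) = of_real (\<sigma> m) * (u m * cnj (u m)) * (of_real (\<sigma> m) * (s m * cnj (s m)))"
        by (simp add: v_def mult_ac)
      also have "\<dots> = of_real (\<sigma> m * (cmod (u m))\<^sup>2)"
        unfolding ss[OF m] of_real_mult complex_norm_square by simp
      finally show "v m * cnj (v m) * of_nat M = of_real (real M * (\<sigma> m * (cmod (u m))\<^sup>2))"
        by simp
    qed
    also have "\<dots> = of_real (real M * U)" by (simp add: U_def sum_distrib_left)
    finally show ?thesis .
  qed
  \<comment> \<open>The only place where the formula for \<tau> enters: correlating b with P gives
    back the low-pass coefficient. It evaluates the cross terms of the residuals.\<close>
  have Pb: "(\<Sum>r=1..M. cnj (P r) * b r) = of_nat M * a"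
  proof -
    have "(\<Sum>r=1..M. cnj (P r) * b r) = (\<Sum>r=1..M. \<Sum>m\<in>\<Lambda>. v m * cnj (P r * e r m))"
      unfolding b_def sum_distrib_left by (intro sum.cong refl) (simp add: mult_ac)
    also have "\<dots> = (\<Sum>m\<in>\<Lambda>. \<Sum>r=1..M. v m * cnj (P r * e r m))" by (rule sum.swap)
    also have "\<dots> = (\<Sum>m\<in>\<Lambda>. v m * cnj (of_nat M * (T m * cnj (s m))))"
      by (intro sum.cong refl) (simp only: T cnj_sum sum_distrib_left)
    also have "\<dots> = (\<Sum>m\<in>\<Lambda>. of_nat M * (cnj (T m) * u m))"
    proof (intro sum.cong refl)
      fix m assume m: "m \<in> \<Lambda>"
      have "v m * cnj (of_nat M * (T m * cnj (s m))) = of_nat M * (cnj (T m) * u m) * (of_real (\<sigma> m) * (s m * cnj (s m)))"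
        by (simp add: v_def mult_ac)
      then show "v m * cnj (of_nat M * (T m * cnj (s m))) = of_nat M * (cnj (T m) * u m)"
        unfolding ss[OF m] by simp
    qed
    finally show ?thesis by (simp add: a_def sum_distrib_left)
  qed
  have pt: "complex_of_real ((cmod (x - of_real A * p * a))\<^sup>2)
    = x * cnj x - of_real A * cnj a * (cnj p * x) - of_real A * a * cnj (cnj p * x) + of_real (A\<^sup>2) * (a * cnj a) * (p * cnj p)" for x p
    unfolding complex_norm_square by (simp add: algebra_simps power2_eq_square)
  have "complex_of_real (\<Sum>r=1..M. (cmod (b r - of_real A * P r * a))\<^sup>2)
    = (\<Sum>r=1..M. b r * cnj (b r) - of_real A * cnj a * (cnj (P r) * b r) - of_real A * a * cnj (cnj (P r) * b r) + of_real (A\<^sup>2 * (cmod a)\<^sup>2) * of_real ((cmod (P r))\<^sup>2))"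
    unfolding of_real_sum by (intro sum.cong refl) (simp only: pt, simp only: complex_norm_square of_real_mult)
  also have "\<dots> = of_real (real M * U) - of_real A * cnj a * (of_nat M * a) - of_real A * a * cnj (of_nat M * a) + of_real (A\<^sup>2 * (cmod a)\<^sup>2) * of_real R"
    unfolding Pb[symmetric] bb[symmetric] R_def
    by (simp add: sum.distrib sum_subtractf sum_distrib_left)
  also have "\<dots> = of_real (real M * U - 2 * A * real M * (cmod a)\<^sup>2 + A\<^sup>2 * (cmod a)\<^sup>2 * R)"
    by (simp only: of_real_add of_real_diff of_real_mult complex_norm_square) (simp add: algebra_simps)
  finally have sum2: "(\<Sum>r=1..M. (cmod (b r - of_real A * P r * a))\<^sup>2) = real M * U - 2 * A * real M * (cmod a)\<^sup>2 + A\<^sup>2 * (cmod a)\<^sup>2 * R"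
    by (simp only: of_real_eq_iff)
  have sum1: "real M * (\<Sum>l=1..N. (cmod (G l))\<^sup>2) = real M / A - R"
  proof -
    have "real M * (\<Sum>l=1..N. (cmod (G l))\<^sup>2) = (\<Sum>l=1..N. 1 / A - (cmod (P l))\<^sup>2)"
      unfolding sum_distrib_left by (intro sum.cong refl G[symmetric]) auto
    \<comment> \<open>The terms with l > N are 0, since |P l|^2 = 1 / A there.\<close>
    also have "\<dots> = (\<Sum>l=1..M. 1 / A - (cmod (P l))\<^sup>2)"
      using M P by (intro sum.mono_neutral_left) auto
    also have "\<dots> = real M / A - R" by (simp add: sum_subtractf R_def)
    finally show ?thesis .
  qed
  then have sum1': "(\<Sum>l=1..N. (cmod (G l))\<^sup>2) = 1 / A - R / real M"
    using M by (simp add: field_simps)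
  \<comment> \<open>The multiples of |a|^2 cancel: A from the low-pass term, A - A^2 R / M from the
    first family, and -2 A + A^2 R / M from the residuals.\<close>
  have "A * (cmod a)\<^sup>2 + (A\<^sup>2 * (cmod a)\<^sup>2 * (1 / A - R / real M) + (1 / real M) * (real M * U - 2 * A * real M * (cmod a)\<^sup>2 + A\<^sup>2 * (cmod a)\<^sup>2 * R)) = U"
    using A M by (simp add: field_simps power2_eq_square)
  then show ?thesis
    unfolding q1 q2 a_def[symmetric] U_def[symmetric] sum_distrib_left[symmetric] sum1' sum2 .
qed

text \<open>\<eta> cancels and a character sum over (Z/lam)^n remains. Adding 1 modulo lam in a
  coordinate i where m and m' differ permutes the digits and multiplies the sum by \<omega>, a root
  of unity other than 1 because 0 < |d_i| < lam.\<close>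

lemma digits_orthogonal:
  fixes m m' :: "int ^ 'n"
  assumes lam: "0 < lam" and m: "m \<in> digits lam" "m' \<in> digits lam"
  shows "(\<Sum>v\<in>digits lam. cis (int_vec v \<bullet> ((1 / real lam) *\<^sub>R (\<eta> + lat m))) * cnj (cis (int_vec v \<bullet> ((1 / real lam) *\<^sub>R (\<eta> + lat m')))))
    = (if m = m' then of_nat (card (digits lam :: (int ^ 'n) set)) else 0)"
proof -
  define d where "d = m - m'"
  let ?\<theta> = "2 * pi / real lam"
  have eq: "cis (int_vec v \<bullet> ((1 / real lam) *\<^sub>R (\<eta> + lat m))) * cnj (cis (int_vec v \<bullet> ((1 / real lam) *\<^sub>R (\<eta> + lat m'))))
    = cis (?\<theta> * (int_vec v \<bullet> int_vec d))" for v
    unfolding cis_cnj cis_mult d_def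
    by (rule arg_cong[where f=cis]) (simp add: lat_def int_vec_diff inner_add_right inner_diff_right algebra_simps diff_divide_distrib)
  show ?thesis
  proof (cases "m = m'")
    case True
    then show ?thesis unfolding eq by (simp add: d_def)
  next
    case False
    then obtain i where i: "d $ i \<noteq> 0" by (auto simp: d_def vec_eq_iff)
    have "\<bar>d $ i\<bar> < int lam" using m by (auto simp: d_def digits_def dest!: spec[of _ i])
    define \<omega> where "\<omega> = cis (?\<theta> * real_of_int (d $ i))"
    have "\<omega> \<noteq> 1"
    proof
      assume "\<omega> = 1"
      then have "cos (?\<theta> * real_of_int (d $ i)) = 1" by (simp add: \<omega>_def complex_eq_iff)
      then obtain z :: int where "?\<theta> * real_of_int (d $ i) = real_of_int z * 2 * pi"
        unfolding cos_one_2pi_int by blast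
      then have "real_of_int (d $ i) = real_of_int z * real lam" using lam by (simp add: field_simps)
      then have "d $ i = z * int lam" by (metis of_int_eq_iff of_int_mult of_int_of_nat_eq)
      then have "int lam dvd d $ i" by simp
      then show False using i \<open>\<bar>d $ i\<bar> < int lam\<close> by (meson dvd_imp_le_int not_le zdvd_not_zless zero_less_abs_iff dvd_abs_iff)
    qed
    define f where "f x v = (\<chi> j. if j = i then (v $ j + x) mod int lam else v $ j)" for x and v :: "int ^ 'n"
    have bij: "bij_betw (f 1) (digits lam) (digits lam)"
      by (rule bij_betwI[where g="f (- 1)"])
         (use lam in \<open>auto simp: f_def digits_def vec_eq_iff mod_diff_left_eq mod_add_left_eq\<close>)
    have shift: "cis (?\<theta> * (int_vec (f 1 v) \<bullet> int_vec d)) = cis (?\<theta> * (int_vec v \<bullet> int_vec d)) * \<omega>" for v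
    proof -
      \<comment> \<open>The carry of the addition modulo lam; it alters the phase by a multiple of 2
        pi.\<close>
      define z where "z = (v $ i + 1) div int lam"
      have z: "(v $ i + 1) mod int lam = v $ i + 1 - int lam * z"
        by (simp add: z_def minus_mult_div_eq_mod)
      have "int_vec (f 1 v) = int_vec v + (1 - real lam * real_of_int z) *\<^sub>R axis i 1"
        by (simp add: vec_eq_iff f_def z axis_def)
      then have ieq: "int_vec (f 1 v) \<bullet> int_vec d = int_vec v \<bullet> int_vec d + (1 - real lam * real_of_int z) * real_of_int (d $ i)"
        by (simp add: inner_add_left inner_axis')
      have "?\<theta> * (int_vec (f 1 v) \<bullet> int_vec d) = (?\<theta> * (int_vec v \<bullet> int_vec d) + ?\<theta> * real_of_int (d $ i)) + 2 * pi * real_of_int (- (z * d $ i))"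
        unfolding ieq using lam by (simp add: field_simps)
      then have "cis (?\<theta> * (int_vec (f 1 v) \<bullet> int_vec d)) = cis (?\<theta> * (int_vec v \<bullet> int_vec d) + ?\<theta> * real_of_int (d $ i))"
        by (simp only: cis_add_2pi_int)
      then show ?thesis by (simp add: \<omega>_def cis_mult)
    qed
    let ?s = "\<Sum>v\<in>digits lam. cis (?\<theta> * (int_vec v \<bullet> int_vec d))"
    have "?s = (\<Sum>v\<in>digits lam. cis (?\<theta> * (int_vec (f 1 v) \<bullet> int_vec d)))"
      by (rule sum.reindex_bij_betw[OF bij, symmetric])
    also have "\<dots> = ?s * \<omega>" unfolding shift by (simp add: sum_distrib_right)
    finally have "?s = 0" using \<open>\<omega> \<noteq> 1\<close> by simp
    then show ?thesis using False unfolding eq by simp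
  qed
qed

section \<open>Rational trigonometric polynomials\<close>

lemma trig_poly_lat:
  assumes "trig_poly t"
  shows "t (\<xi> + lat k) = t \<xi>"
proof -
  obtain K h where "finite K" "t = (\<lambda>x. \<Sum>k\<in>K. h k * ek k x)" using assms by (rule trig_polyE)
  then show ?thesis by (simp add: ek_lat)
qed

lemma trig_poly_Lipschitz_0:
  assumes "trig_poly t"
  obtains C where "\<And>\<xi>. cmod (t \<xi> - t 0) \<le> C * norm \<xi>"
proof -
  obtain K h where K: "finite K" "t = (\<lambda>x. \<Sum>k\<in>K. h k * ek k x)" using assms by (rule trig_polyE)
  have ek: "cmod (ek k \<xi> - 1) \<le> norm (int_vec k) * norm \<xi>" for k \<xi>
  proof -
    have "cmod (ek k \<xi> - 1) = 2 * \<bar>sin (- (int_vec k \<bullet> \<xi>) / 2)\<bar>"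
      unfolding ek_def cis_conv_exp by (rule dist_exp_i_1)
    also have "\<dots> \<le> 2 * \<bar>- (int_vec k \<bullet> \<xi>) / 2\<bar>" by (intro mult_left_mono abs_sin_x_le_abs_x) simp
    also have "\<dots> = \<bar>int_vec k \<bullet> \<xi>\<bar>" by simp
    also have "\<dots> \<le> norm (int_vec k) * norm \<xi>" by (rule Cauchy_Schwarz_ineq2)
    finally show ?thesis .
  qed
  have "cmod (t \<xi> - t 0) \<le> (\<Sum>k\<in>K. cmod (h k) * norm (int_vec k)) * norm \<xi>" for \<xi>
  proof -
    have "t \<xi> - t 0 = (\<Sum>k\<in>K. h k * (ek k \<xi> - 1))"
      unfolding K(2) sum_subtractf[symmetric] by (simp add: ek_def algebra_simps)
    also have "cmod \<dots> \<le> (\<Sum>k\<in>K. cmod (h k) * (norm (int_vec k) * norm \<xi>))"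
      by (rule sum_norm_le) (auto simp: norm_mult intro!: mult_left_mono ek)
    finally show ?thesis by (simp add: sum_distrib_right mult.assoc)
  qed
  then show ?thesis by (rule that)
qed

lemma rational_trig_polyE:
  assumes "rational_trig_poly f"
  obtains a b where "trig_poly a" "trig_poly b" "b \<noteq> (\<lambda>_. 0)" "f = (\<lambda>\<xi>. a \<xi> / b \<xi>)"
  using assms unfolding rational_trig_poly_def reduced_fraction_def by blast

lemma rational_trig_poly_measurable [measurable_dest]:
  assumes "rational_trig_poly f"
  shows "f \<in> borel_measurable borel"
proof -
  obtain a b where ab: "trig_poly a" "trig_poly b" "f = (\<lambda>\<xi>. a \<xi> / b \<xi>)"
    using assms by (rule rational_trig_polyE)
  note [measurable] = trig_poly_measurable[OF ab(1)] trig_poly_measurable[OF ab(2)]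
  show ?thesis unfolding ab(3) by measurable
qed

lemma rational_trig_poly_lat:
  assumes "rational_trig_poly f"
  shows "f (\<xi> + lat k) = f \<xi>"
proof -
  obtain a b where ab: "trig_poly a" "trig_poly b" "f = (\<lambda>\<xi>. a \<xi> / b \<xi>)"
    using assms by (rule rational_trig_polyE)
  show ?thesis unfolding ab(3) by (simp add: trig_poly_lat ab)
qed

text \<open>The denominator of a reduced fraction is a nonzero trigonometric polynomial, so its zero
  set is null. This makes the identities between masks usable almost everywhere.\<close>

lemma rational_trig_poly_AE_defined:
  assumes "rational_trig_poly f"
  shows "AE \<xi> in lborel. defined_at f \<xi>"
proof -
  obtain a b where ab: "reduced_fraction f a b" using assms unfolding rational_trig_poly_def by blast
  then have "AE \<xi> in lborel. b \<xi> \<noteq> 0"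
    unfolding reduced_fraction_def by (intro trig_poly_AE_nonzero) auto
  then show ?thesis
    by eventually_elim (use ab in \<open>auto simp: defined_at_def\<close>)
qed

lemma rational_trig_poly_AE_nonzero:
  assumes "rational_trig_poly f" and "f 0 \<noteq> 0"
  shows "AE \<xi> in lborel. f \<xi> \<noteq> 0"
proof -
  obtain a b where ab: "trig_poly a" "trig_poly b" "b \<noteq> (\<lambda>_. 0)" "f = (\<lambda>\<xi>. a \<xi> / b \<xi>)"
    using assms(1) by (rule rational_trig_polyE)
  have "a \<noteq> (\<lambda>_. 0)" using assms(2) ab(4) by auto
  from trig_poly_AE_nonzero[OF ab(1) this] trig_poly_AE_nonzero[OF ab(2,3)]
  show ?thesis by eventually_elim (simp add: ab(4))
qed

text \<open>The value 1 at 0 excludes the default value 0 of a division by zero, so the denominator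
  is nonzero at 0; numerator and denominator are Lipschitz there.\<close>

lemma rational_trig_poly_Lipschitz:
  assumes "rational_trig_poly f" and "f 0 = 1"
  shows "\<exists>C \<delta>. 0 < \<delta> \<and> (\<forall>\<xi>. norm \<xi> < \<delta> \<longrightarrow> cmod (f \<xi> - 1) \<le> C * norm \<xi>)"
proof -
  obtain a b where ab: "trig_poly a" "trig_poly b" "f = (\<lambda>\<xi>. a \<xi> / b \<xi>)"
    using assms(1) by (rule rational_trig_polyE)
  have b0: "b 0 \<noteq> 0" "a 0 = b 0" using assms(2) ab(3) by (auto simp: divide_eq_1_iff)
  obtain A where A: "\<And>\<xi>. cmod (a \<xi> - a 0) \<le> A * norm \<xi>" using trig_poly_Lipschitz_0[OF ab(1)] by blast
  obtain B where B: "\<And>\<xi>. cmod (b \<xi> - b 0) \<le> B * norm \<xi>" using trig_poly_Lipschitz_0[OF ab(2)] by blast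
  define \<beta> where "\<beta> = cmod (b 0)"
  have \<beta>: "\<beta> > 0" using b0 by (simp add: \<beta>_def)
  \<comment> \<open>Within this radius the denominator stays within half of |b 0| from b 0, hence
    has modulus at least \<beta> / 2.\<close>
  define \<delta> where "\<delta> = \<beta> / (2 * (\<bar>B\<bar> + 1))"
  have "0 < \<delta>" using \<beta> by (simp add: \<delta>_def)
  have "cmod (f \<xi> - 1) \<le> (2 * (A + B) / \<beta>) * norm \<xi>" if "norm \<xi> < \<delta>" for \<xi>
  proof -
    have "B * norm \<xi> \<le> (\<bar>B\<bar> + 1) * norm \<xi>" by (intro mult_right_mono) auto
    also have "\<dots> \<le> (\<bar>B\<bar> + 1) * \<delta>" using that by (intro mult_left_mono) auto
    also have "\<dots> = \<beta> / 2" by (simp add: \<delta>_def field_simps)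
    finally have "cmod (b 0 - b \<xi>) \<le> \<beta> / 2" using B[of \<xi>] by (simp add: norm_minus_commute)
    then have lower: "\<beta> / 2 \<le> cmod (b \<xi>)"
      using norm_triangle_ineq2[of "b 0" "b 0 - b \<xi>"] norm_triangle_ineq2[of "b 0" "b \<xi>"] unfolding \<beta>_def by linarith
    then have "b \<xi> \<noteq> 0" using \<beta> by auto
    then have "f \<xi> - 1 = ((a \<xi> - a 0) - (b \<xi> - b 0)) / b \<xi>" using b0 by (simp add: ab(3) field_simps)
    then have "cmod (f \<xi> - 1) = cmod ((a \<xi> - a 0) - (b \<xi> - b 0)) / cmod (b \<xi>)" by (simp add: norm_divide)
    also have "\<dots> \<le> cmod ((a \<xi> - a 0) - (b \<xi> - b 0)) / (\<beta> / 2)"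
      using lower \<beta> by (intro divide_left_mono mult_pos_pos) auto
    also have "\<dots> \<le> (A * norm \<xi> + B * norm \<xi>) / (\<beta> / 2)"
      using A[of \<xi>] B[of \<xi>] \<beta> norm_triangle_ineq4[of "a \<xi> - a 0" "b \<xi> - b 0"]
      by (intro divide_right_mono) auto
    finally show ?thesis by (simp add: algebra_simps add_divide_distrib)
  qed
  then show ?thesis using \<open>0 < \<delta>\<close> by blast
qed


theorem theorem3p2:
  fixes lam N :: nat
    and S s \<tau> :: "real ^ 'n \<Rightarrow> complex"
    and p g q1 q2 :: "nat \<Rightarrow> real ^ 'n \<Rightarrow> complex"
    and \<nu> :: "nat \<Rightarrow> int ^ 'n"
  assumes lam: "2 \<le> lam"
    and N: "1 \<le> N" "N \<le> lam ^ CARD('n)"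
    and \<nu>: "bij_betw \<nu> {1..lam ^ CARD('n)} {k. \<forall>i. 0 \<le> k $ i \<and> k $ i \<le> int lam - 1}"
    and S: "rational_trig_poly S"
      "\<And>\<xi>. defined_at S \<xi> \<Longrightarrow> S \<xi> \<in> \<real>\<^sub>\<ge>\<^sub>0"
      "isCont S 0" "S 0 = 1"
      "Linf_torus S" "Linf_torus (\<lambda>\<xi>. 1 / S \<xi>)"
    and p: "\<And>l. l \<in> {1..N} \<Longrightarrow> rational_trig_poly (p l)"
      "\<And>l. l \<in> {1..N} \<Longrightarrow> p l 0 = 1"
    and g: "\<And>l. l \<in> {1..N} \<Longrightarrow> rational_trig_poly (g l)"
    and pg: "\<And>l \<xi>. l \<in> {1..N} \<Longrightarrow> defined_at S \<xi> \<Longrightarrow> S \<xi> \<noteq> 0 \<Longrightarrow>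
        defined_at (p l) \<xi> \<Longrightarrow> defined_at (g l) \<xi> \<Longrightarrow>
        1 / S \<xi> - of_real ((cmod (p l \<xi>))\<^sup>2) = of_real (real lam ^ CARD('n) * (cmod (g l \<xi>))\<^sup>2)"
    and s: "rational_trig_poly s"
      "\<And>\<xi>. defined_at S \<xi> \<Longrightarrow> S \<xi> \<noteq> 0 \<Longrightarrow> defined_at s \<xi> \<Longrightarrow>
        of_real ((cmod (s \<xi>))\<^sup>2) = 1 / S \<xi>"
      "s 0 = 1"
    and p': "\<And>l. l \<in> {N<..lam ^ CARD('n)} \<Longrightarrow> rational_trig_poly (p l)"
      "\<And>l \<xi>. l \<in> {N<..lam ^ CARD('n)} \<Longrightarrow> defined_at S \<xi> \<Longrightarrow> S \<xi> \<noteq> 0 \<Longrightarrow>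
        defined_at (p l) \<xi> \<Longrightarrow> of_real ((cmod (p l \<xi>))\<^sup>2) = 1 / S \<xi>"
    and \<tau>: "rational_trig_poly \<tau>"
      "\<And>\<xi>. defined_at \<tau> \<xi> \<Longrightarrow> defined_at s \<xi> \<Longrightarrow> s \<xi> \<noteq> 0 \<Longrightarrow>
        (\<And>l. l \<in> {1..lam ^ CARD('n)} \<Longrightarrow> defined_at (p l) (real lam *\<^sub>R \<xi>)) \<Longrightarrow>
        \<tau> \<xi> = (1 / of_nat lam ^ CARD('n)) *
            (\<Sum>l = 1..lam ^ CARD('n). p l (real lam *\<^sub>R \<xi>) * cis (int_vec (\<nu> l) \<bullet> \<xi>)) / cnj (s \<xi>)"
      "\<tau> 0 = 1"
    and q1: "\<And>l \<xi>. l \<in> {1..N} \<Longrightarrow>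
        q1 l \<xi> = S (real lam *\<^sub>R \<xi>) * \<tau> \<xi> * cnj (g l (real lam *\<^sub>R \<xi>))"
    and q2: "\<And>m \<xi>. m \<in> {1..lam ^ CARD('n)} \<Longrightarrow>
        q2 m \<xi> = of_real (real lam powr (- real CARD('n) / 2)) *
          (S \<xi> * s \<xi> * cis (int_vec (\<nu> m) \<bullet> \<xi>) -
           S (real lam *\<^sub>R \<xi>) * \<tau> \<xi> * cnj (p m (real lam *\<^sub>R \<xi>)))"
  shows "mask_system_tight_wavelet_frame lam \<tau>
    ({1..N} <+> {1..lam ^ CARD('n)}) (case_sum q1 q2)"
proof -
  let ?M = "lam ^ CARD('n)"
  \<comment> \<open>The locale works with a real weight; at good points it agrees with S and is
    positive.\<close>
  define Sr where "Sr \<xi> = Re (S \<xi>)" for \<xi>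
  let ?I = "{1..N} <+> {1..?M}"
  let ?q = "case_sum q1 q2 :: nat + nat \<Rightarrow> real ^ 'n \<Rightarrow> complex"
  have rp: "rational_trig_poly (p l)" if "l \<in> {1..?M}" for l
    using that p(1)[of l] p'(1)[of l] by (cases "l \<le> N") auto
  have gN: "{1..N} \<subseteq> {1..?M}" using N by auto
  have digits: "digits lam = {k :: int ^ 'n. \<forall>i. 0 \<le> k $ i \<and> k $ i \<le> int lam - 1}"
    by (auto simp: digits_def)
  have card: "card (digits lam :: (int ^ 'n) set) = ?M"
    using bij_betw_same_card[OF \<nu>] unfolding digits by simp
  have M: "0 < ?M" using lam by simp
  have lat_dil: "real lam *\<^sub>R (\<xi> + lat k) = real lam *\<^sub>R \<xi> + lat (sc lam k)" for \<xi> and k :: "int ^ 'n"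
    by (simp add: lat_sc scaleR_add_right)
  have cis_lat: "cis (int_vec v \<bullet> (\<xi> + lat k)) = cis (int_vec v \<bullet> \<xi>)" for v k :: "int ^ 'n" and \<xi>
    using ek_lat[of "- v" \<xi> k] by (simp add: ek_def int_vec_minus)
  note [measurable] = rational_trig_poly_measurable[OF S(1)] rational_trig_poly_measurable[OF \<tau>(1)] rational_trig_poly_measurable[OF s(1)]
  \<comment> \<open>The points at which every hypothesis of the theorem on S, s, p, g and \<tau> may
    be invoked at the point itself and the divisions by S and s are genuine.\<close>
  define good where "good \<xi> \<longleftrightarrow> defined_at S \<xi> \<and> S \<xi> \<noteq> 0 \<and> defined_at s \<xi> \<and> s \<xi> \<noteq> 0 \<and> defined_at \<tau> \<xi>
      \<and> (\<forall>l\<in>{1..?M}. defined_at (p l) \<xi>) \<and> (\<forall>l\<in>{1..N}. defined_at (g l) \<xi>)" for \<xi>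
  have "AE \<xi> in lborel. \<forall>l\<in>{1..?M}. defined_at (p l) \<xi>"
    by (rule AE_finite_allI) (simp, rule rational_trig_poly_AE_defined[OF rp])
  moreover have "AE \<xi> in lborel. \<forall>l\<in>{1..N}. defined_at (g l) \<xi>"
    by (rule AE_finite_allI) (simp, rule rational_trig_poly_AE_defined[OF g])
  moreover have "AE \<xi> in lborel. S \<xi> \<noteq> 0" "AE \<xi> in lborel. s \<xi> \<noteq> 0"
    by (rule rational_trig_poly_AE_nonzero; simp add: S s)+
  ultimately have good: "AE \<xi> in lborel. good \<xi>"
    using rational_trig_poly_AE_defined[OF S(1)] rational_trig_poly_AE_defined[OF s(1)] rational_trig_poly_AE_defined[OF \<tau>(1)]
    unfolding good_def by eventually_elim blast
  have S_real: "S \<xi> = of_real (Sr \<xi>)" "0 < Sr \<xi>" if "good \<xi>" for \<xi>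
  proof -
    have "S \<xi> \<in> \<real>\<^sub>\<ge>\<^sub>0" "S \<xi> \<noteq> 0" using that S(2) by (auto simp: good_def)
    then show "S \<xi> = of_real (Sr \<xi>)" "0 < Sr \<xi>"
      unfolding Sr_def by (auto simp: complex_nonneg_Reals_iff complex_eq_iff less_le)
  qed
  \<comment> \<open>The formula for \<tau> at a preimage of \<eta> requires the p l to be defined at
    a lattice translate of \<eta>, so all translates must be good.\<close>
  have good_lat: "AE \<xi> in lborel. \<forall>k. good (\<xi> + lat k)"
    unfolding AE_all_countable
  proof
    fix k :: "int ^ 'n"
    show "AE \<xi> in lborel. good (\<xi> + lat k)" using AE_lborel_affine[OF good, of 1 "lat k"] by (simp add: add.commute)
  qed
  have good_\<zeta>: "AE \<xi> in lborel. \<forall>k. good ((1 / real lam) *\<^sub>R (\<xi> + lat k))"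
    unfolding AE_all_countable
  proof
    fix k :: "int ^ 'n"
    show "AE \<xi> in lborel. good ((1 / real lam) *\<^sub>R (\<xi> + lat k))"
      using AE_lborel_affine[OF good, of "1 / real lam" "(1 / real lam) *\<^sub>R lat k"] lam
      by (simp add: scaleR_add_right add.commute)
  qed
  interpret oep lam \<tau> Sr ?I ?q
  proof
    show "2 \<le> lam" by (rule lam)
    show "finite ?I" by simp
    show "\<tau> \<in> borel_measurable borel" "Sr \<in> borel_measurable borel"
      unfolding Sr_def[abs_def] by measurable
    show "?q i \<in> borel_measurable borel" if "i \<in> ?I" for i
    proof (cases i)
      case (Inl l)
      then have l: "l \<in> {1..N}" using that by auto
      note [measurable] = rational_trig_poly_measurable[OF g[OF l]]
      have "q1 l = (\<lambda>\<xi>. S (real lam *\<^sub>R \<xi>) * \<tau> \<xi> * cnj (g l (real lam *\<^sub>R \<xi>)))"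
        by (rule ext) (rule q1[OF l])
      then have "q1 l \<in> borel_measurable borel" by (simp only:) measurable
      then show ?thesis using Inl by simp
    next
      case (Inr m)
      then have m: "m \<in> {1..?M}" using that by auto
      note [measurable] = rational_trig_poly_measurable[OF rp[OF m]]
      have "q2 m = (\<lambda>\<xi>. of_real (real lam powr (- real CARD('n) / 2)) *
          (S \<xi> * s \<xi> * cis (int_vec (\<nu> m) \<bullet> \<xi>) -
           S (real lam *\<^sub>R \<xi>) * \<tau> \<xi> * cnj (p m (real lam *\<^sub>R \<xi>))))"
        by (rule ext) (rule q2[OF m])
      then have "q2 m \<in> borel_measurable borel" by (simp only:) measurable
      then show ?thesis using Inr by simp
    qed
    show "\<tau> (\<xi> + lat k) = \<tau> \<xi>" for \<xi> k by (rule rational_trig_poly_lat[OF \<tau>(1)])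
    show "Sr (\<xi> + lat k) = Sr \<xi>" for \<xi> k unfolding Sr_def by (simp add: rational_trig_poly_lat[OF S(1)])
    show "?q i (\<xi> + lat k) = ?q i \<xi>" if "i \<in> ?I" for i \<xi> k
    proof (cases i)
      case (Inl l)
      then have l: "l \<in> {1..N}" using that by auto
      have "q1 l (\<xi> + lat k) = q1 l \<xi>"
        unfolding q1[OF l] lat_dil
        by (simp only: rational_trig_poly_lat[OF S(1)] rational_trig_poly_lat[OF \<tau>(1)] rational_trig_poly_lat[OF g[OF l]])
      then show ?thesis using Inl by simp
    next
      case (Inr m)
      then have m: "m \<in> {1..?M}" using that by auto
      have "q2 m (\<xi> + lat k) = q2 m \<xi>"
        unfolding q2[OF m] lat_dil
        by (simp only: cis_lat rational_trig_poly_lat[OF S(1)] rational_trig_poly_lat[OF \<tau>(1)] rational_trig_poly_lat[OF s(1)] rational_trig_poly_lat[OF rp[OF m]])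
      then show ?thesis using Inr by simp
    qed
    show "AE \<xi> in lborel. 0 < Sr \<xi>" using good by eventually_elim (rule S_real)
    show "isCont Sr 0" unfolding Sr_def[abs_def] using S(3) by (rule isCont_Re)
    show "Sr 0 = 1" by (simp add: Sr_def S)
    show "\<exists>C \<delta>. 0 < \<delta> \<and> (\<forall>\<xi>. norm \<xi> < \<delta> \<longrightarrow> cmod (\<tau> \<xi> - 1) \<le> C * norm \<xi>)"
      by (rule rational_trig_poly_Lipschitz[OF \<tau>(1,3)])
    show "card (digits lam :: (int ^ 'n) set) = lam ^ CARD('n)" by (rule card)
    show "AE \<eta> in lborel. \<forall>u. Sr \<eta> * (cmod (\<Sum>m\<in>digits lam. cnj (\<tau> ((1 / real lam) *\<^sub>R (\<eta> + lat m))) * u m))\<^sup>2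
        + (\<Sum>i\<in>?I. (cmod (\<Sum>m\<in>digits lam. cnj (?q i ((1 / real lam) *\<^sub>R (\<eta> + lat m))) * u m))\<^sup>2)
      = (\<Sum>m\<in>digits lam. Sr ((1 / real lam) *\<^sub>R (\<eta> + lat m)) * (cmod (u m))\<^sup>2)"
      using good_lat good_\<zeta>
    proof (eventually_elim, intro allI)
      fix \<eta> :: "real ^ 'n" and u :: "int ^ 'n \<Rightarrow> complex"
      assume gl: "\<forall>k. good (\<eta> + lat k)" and gz: "\<forall>k. good ((1 / real lam) *\<^sub>R (\<eta> + lat k))"
      \<comment> \<open>The preimages of \<eta> under multiplication by lam, modulo the lattice. At
        lam z m = \<eta> + 2 pi m the periodic functions S, p and g take their values at
        \<eta>.\<close>
      define z where "z m = (1 / real lam) *\<^sub>R (\<eta> + lat m)" for m :: "int ^ 'n"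
      have lz: "real lam *\<^sub>R z m = \<eta> + lat m" for m using lam by (simp add: z_def)
      have gd: "good \<eta>" using gl[rule_format, of 0] by simp
      have gzm: "good (z m)" for m using gz by (simp add: z_def)
      note Sm = S_real[OF gd] S_real[OF gzm]
      have Slz: "S (real lam *\<^sub>R z m) = of_real (Sr \<eta>)" for m
        unfolding lz rational_trig_poly_lat[OF S(1)] by (rule Sm)
      have plz: "p l (real lam *\<^sub>R z m) = p l \<eta>" if "l \<in> {1..?M}" for l m
        unfolding lz by (rule rational_trig_poly_lat[OF rp[OF that]])
      have glz: "g l (real lam *\<^sub>R z m) = g l \<eta>" if "l \<in> {1..N}" for l m
        unfolding lz by (rule rational_trig_poly_lat[OF g[OF that]])
      define c where "c = real lam powr (- real CARD('n) / 2)"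
      have "Sr \<eta> * (cmod (\<Sum>m\<in>digits lam. cnj (\<tau> (z m)) * u m))\<^sup>2
        + ((\<Sum>l=1..N. (cmod (\<Sum>m\<in>digits lam. cnj (of_real (Sr \<eta>) * \<tau> (z m) * cnj (g l \<eta>)) * u m))\<^sup>2)
          + (\<Sum>r=1..?M. (cmod (\<Sum>m\<in>digits lam. cnj (of_real c * (of_real (Sr (z m)) * s (z m) * cis (int_vec (\<nu> r) \<bullet> z m) - of_real (Sr \<eta>) * \<tau> (z m) * cnj (p r \<eta>))) * u m))\<^sup>2))
        = (\<Sum>m\<in>digits lam. Sr (z m) * (cmod (u m))\<^sup>2)"
      proof (rule extension_identity)
        show "finite (digits lam :: (int ^ 'n) set)" by (rule finite_digits)
        show "0 < Sr \<eta>" by (rule Sm)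
        show "0 < ?M" by (rule M)
        show "N \<le> ?M" by (rule N)
        show "1 / Sr \<eta> - (cmod (p l \<eta>))\<^sup>2 = real ?M * (cmod (g l \<eta>))\<^sup>2" if l: "l \<in> {1..N}" for l
        proof -
          have "1 / S \<eta> - of_real ((cmod (p l \<eta>))\<^sup>2) = of_real (real lam ^ CARD('n) * (cmod (g l \<eta>))\<^sup>2)"
            using gd l gN by (intro pg) (auto simp: good_def)
          then have "complex_of_real (1 / Sr \<eta> - (cmod (p l \<eta>))\<^sup>2) = of_real (real ?M * (cmod (g l \<eta>))\<^sup>2)"
            unfolding Sm(1) by simp
          then show ?thesis by (simp only: of_real_eq_iff)
        qed
        show "(cmod (p l \<eta>))\<^sup>2 = 1 / Sr \<eta>" if l: "l \<in> {N<..?M}" for l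
        proof -
          have "of_real ((cmod (p l \<eta>))\<^sup>2) = 1 / S \<eta>"
            using gd l by (intro p'(2)) (auto simp: good_def)
          then have "complex_of_real ((cmod (p l \<eta>))\<^sup>2) = of_real (1 / Sr \<eta>)"
            unfolding Sm(1) by simp
          then show ?thesis by (simp only: of_real_eq_iff)
        qed
        show "Sr (z m) * (cmod (s (z m)))\<^sup>2 = 1" for m
        proof -
          have "of_real ((cmod (s (z m)))\<^sup>2) = 1 / S (z m)"
            using gzm[of m] by (intro s(2)) (auto simp: good_def)
          then have "complex_of_real ((cmod (s (z m)))\<^sup>2) = of_real (1 / Sr (z m))"
            unfolding Sm(3) by simp
          then have "(cmod (s (z m)))\<^sup>2 = 1 / Sr (z m)" by (simp only: of_real_eq_iff)
          then show ?thesis using Sm(4)[of m] by simp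
        qed
        show "of_nat ?M * (\<tau> (z m) * cnj (s (z m))) = (\<Sum>l=1..?M. p l \<eta> * cis (int_vec (\<nu> l) \<bullet> z m))" for m
        proof -
          have "\<tau> (z m) = (1 / of_nat lam ^ CARD('n)) *
            (\<Sum>l = 1..?M. p l (real lam *\<^sub>R z m) * cis (int_vec (\<nu> l) \<bullet> z m)) / cnj (s (z m))"
            using gzm[of m] gl by (intro \<tau>(2)) (auto simp: good_def lz)
          also have "(\<Sum>l = 1..?M. p l (real lam *\<^sub>R z m) * cis (int_vec (\<nu> l) \<bullet> z m)) = (\<Sum>l = 1..?M. p l \<eta> * cis (int_vec (\<nu> l) \<bullet> z m))"
            by (intro sum.cong refl) (simp only: plz)
          finally show ?thesis using gzm[of m] lam by (simp add: good_def)
        qed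
        \<comment> \<open>Since \<nu> enumerates the digits, the sum over l is the character sum of
          \<open>digits_orthogonal\<close>.\<close>
        show "(\<Sum>l=1..?M. cis (int_vec (\<nu> l) \<bullet> z m) * cnj (cis (int_vec (\<nu> l) \<bullet> z m'))) = (if m = m' then of_nat ?M else 0)"
          if "m \<in> digits lam" "m' \<in> digits lam" for m m'
        proof -
          have "(\<Sum>l=1..?M. cis (int_vec (\<nu> l) \<bullet> z m) * cnj (cis (int_vec (\<nu> l) \<bullet> z m')))
            = (\<Sum>v\<in>digits lam. cis (int_vec v \<bullet> z m) * cnj (cis (int_vec v \<bullet> z m')))"
            using \<nu> unfolding digits by (rule sum.reindex_bij_betw)
          then show ?thesis
            unfolding z_def using lam by (subst (asm) digits_orthogonal[OF _ that]) (simp_all add: card)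
        qed
        show "c\<^sup>2 = 1 / real ?M"
        proof -
          have "c\<^sup>2 = real lam powr (- real CARD('n))"
            unfolding c_def power2_eq_square powr_add[symmetric] by simp
          also have "\<dots> = 1 / real ?M" using lam by (simp add: powr_minus powr_realpow divide_inverse)
          finally show ?thesis .
        qed
      qed
      moreover have "(\<Sum>i\<in>?I. (cmod (\<Sum>m\<in>digits lam. cnj (?q i (z m)) * u m))\<^sup>2)
        = (\<Sum>l=1..N. (cmod (\<Sum>m\<in>digits lam. cnj (of_real (Sr \<eta>) * \<tau> (z m) * cnj (g l \<eta>)) * u m))\<^sup>2)
          + (\<Sum>r=1..?M. (cmod (\<Sum>m\<in>digits lam. cnj (of_real c * (of_real (Sr (z m)) * s (z m) * cis (int_vec (\<nu> r) \<bullet> z m) - of_real (Sr \<eta>) * \<tau> (z m) * cnj (p r \<eta>))) * u m))\<^sup>2)"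
      proof -
        have e1: "(\<Sum>m\<in>digits lam. cnj (q1 l (z m)) * u m) = (\<Sum>m\<in>digits lam. cnj (of_real (Sr \<eta>) * \<tau> (z m) * cnj (g l \<eta>)) * u m)"
          if "l \<in> {1..N}" for l
          by (intro sum.cong refl) (simp only: q1[OF that] Slz glz[OF that])
        have e2: "(\<Sum>m\<in>digits lam. cnj (q2 r (z m)) * u m) = (\<Sum>m\<in>digits lam. cnj (of_real c * (of_real (Sr (z m)) * s (z m) * cis (int_vec (\<nu> r) \<bullet> z m) - of_real (Sr \<eta>) * \<tau> (z m) * cnj (p r \<eta>))) * u m)"
          if "r \<in> {1..?M}" for r
          by (intro sum.cong refl) (simp only: q2[OF that] Slz plz[OF that] c_def[symmetric] Sm(3))
        show ?thesis
          unfolding sum.Plus[OF finite_atLeastAtMost finite_atLeastAtMost]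
          by (intro arg_cong2[where f="(+)"] sum.cong refl) (simp_all only: o_apply sum.case e1 e2)
      qed
      ultimately show "Sr \<eta> * (cmod (\<Sum>m\<in>digits lam. cnj (\<tau> ((1 / real lam) *\<^sub>R (\<eta> + lat m))) * u m))\<^sup>2
        + (\<Sum>i\<in>?I. (cmod (\<Sum>m\<in>digits lam. cnj (?q i ((1 / real lam) *\<^sub>R (\<eta> + lat m))) * u m))\<^sup>2)
      = (\<Sum>m\<in>digits lam. Sr ((1 / real lam) *\<^sub>R (\<eta> + lat m)) * (cmod (u m))\<^sup>2)"
        unfolding z_def by simp
    qed
  qed
  show ?thesis by (rule mask_system_tight_frame)
qed

end
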